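(* Let $q$ be a fixed odd prime power, and let $n\ge 1$ and $a_1,\dots,a_n\ge 1$ be fixed integers. For each $g$ let $k_1,\dots,k_n\in\{1,2,\dots\}$ (allowed to depend on $g$) be distinct and such that $\sum_{j=1}^{n}a_jk_j\le 2g-1$, and suppose that $\log_q g\ll \min(k_1,\dots,k_n)$, i.e. $\min(k_1,\dots,k_n)/\log_q g\to\infty$ as $g\to\infty$. Then, as $g\to\infty$, $$\Big\langle \prod_{j=1}^{n}(\operatorname{tr}\Theta_Q^{k_j})^{a_j}\Big\rangle=\prod_{j=1}^{n}\ \sum_{i_j=0}^{\lfloor a_j/2\rfloor}k_j^{\,i_j}\binom{a_j}{2i_j}\frac{(2i_j)!}{2^{i_j}\,(i_j)!}\,(-\eta_{k_j})^{a_j-2i_j}+o(1),$$ where $\eta_k=1$ if $k$ is even and $\eta_k=0$ if $k$ is odd (and $0^0=1$).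
   Context: $\mathbb{F}_q$ is the finite field of odd cardinality $q$. $\mathcal{H}_{2g+1}$ is the set of monic square-free polynomials $Q\in\mathbb{F}_q[x]$ of degree $2g+1$. For a function $F$ on $\mathcal{H}_{2g+1}$, $\langle F\rangle:=\frac{1}{\#\mathcal{H}_{2g+1}}\sum_{Q\in\mathcal{H}_{2g+1}}F(Q)$. For $Q\in\mathcal{H}_{2g+1}$ let $C_Q$ be the hyperelliptic curve (smooth projective, genus $g$) with affine equation $y^2=Q(x)$. Its zeta function is $Z_{C_Q}(u)=P_{C_Q}(u)/((1-u)(1-qu))$, where $P_{C_Q}\in\mathbb{Z}[u]$ has degree $2g$, and by the Riemann hypothesis for curves (Weil) $P_{C_Q}(u)=\det(I-u\sqrt q\,\Theta_Q)$ for a unitary $2g\times 2g$ matrix $\Theta_Q$, unique up to conjugacy (the unitarized Frobenius class). Equivalently, $P_{C_Q}(u)=\prod_{P}(1-\chi_Q(P)u^{\deg P})^{-1}$ for $|u|<1/q$, the product being over monic irreducible $P\in\mathbb{F}_q[x]$, with $\chi_Q(P)=\left(\frac{Q}{P}\right)$ the quadratic residue symbol (equal to $0$ if $P\mid Q$). *)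

theory Defs
  imports
    "HOL-Library.Cardinality"
    "HOL-Computational_Algebra.Computational_Algebra"
    "HOL-Algebra.Algebraic_Closure_Type"
    "Jordan_Normal_Form.Schur_Decomposition"
    "Jordan_Normal_Form.Determinant"
begin

definition hyp_ensemble :: "nat \<Rightarrow> 'a :: {finite, field} Polynomial.poly set" where
  "hyp_ensemble g =
     {Q. Polynomial.degree Q = 2 * g + 1 \<and> Polynomial.lead_coeff Q = 1 \<and> squarefree Q}"

definition hyp_avg :: "nat \<Rightarrow> ('a :: {finite, field} Polynomial.poly \<Rightarrow> complex) \<Rightarrow> complex" where
  "hyp_avg g F = (\<Sum>Q\<in>hyp_ensemble g. F Q) / of_nat (card (hyp_ensemble g :: 'a Polynomial.poly set))"

(* The subfield with q^r elements of the algebraic closure of the field 'a with q elements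
   (for r > 0). *)
definition ext_field :: "nat \<Rightarrow> 'a :: {finite, field} alg_closure set" where
  "ext_field r = {x. x ^ (CARD('a) ^ r) = x}"

(* The points over the degree r extension of the smooth projective model of y^2 = Q(x).
   For Q of odd degree the model has exactly one point at infinity, and that point is
   rational; it is encoded as None. *)
definition hyp_points ::
    "'a :: {finite, field} Polynomial.poly \<Rightarrow> nat \<Rightarrow> ('a alg_closure \<times> 'a alg_closure) option set" where
  "hyp_points Q r =
     insert None (Some ` {(x, y). x \<in> ext_field r \<and> y \<in> ext_field r \<and>
                                   y ^ 2 = Polynomial.poly (map_poly to_ac Q) x})"

(* Z(u) = exp (sum over r >= 1 of N_r u^r / r), N_r being the number of points over the degree r
   extension. The coefficient of index 0 in the exponent is x / 0 = 0. *)
definition hyp_zeta :: "'a :: {finite, field} Polynomial.poly \<Rightarrow> complex fps" where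
  "hyp_zeta Q =
     fps_compose (fps_exp 1) (Abs_fps (\<lambda>r. of_nat (card (hyp_points Q r)) / of_nat r))"

(* P(u), where Z(u) = P(u) / ((1 - u) (1 - q u)). *)
definition hyp_zeta_numerator :: "'a :: {finite, field} Polynomial.poly \<Rightarrow> complex fps" where
  "hyp_zeta_numerator Q =
     hyp_zeta Q * ((1 - fps_X) * (1 - fps_const (of_nat CARD('a)) * fps_X))"

definition unitary_mat :: "nat \<Rightarrow> complex mat \<Rightarrow> bool" where
  "unitary_mat N A \<longleftrightarrow> A \<in> carrier_mat N N \<and> mat_adjoint A * A = 1\<^sub>m N"

definition mat_trace :: "'a :: comm_monoid_add mat \<Rightarrow> 'a" where
  "mat_trace A = (\<Sum>i<dim_row A. A $$ (i, i))"

(* The polynomial det (I - c u A) in the variable u. *)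
definition rev_char_poly :: "nat \<Rightarrow> complex \<Rightarrow> complex mat \<Rightarrow> complex Polynomial.poly" where
  "rev_char_poly N c A = det (1\<^sub>m N - [:0, c:] \<cdot>\<^sub>m map_mat (\<lambda>z. [:z:]) A)"

(* A is a representative of the unitarized Frobenius class of y^2 = Q(x), of genus g. This
   determines A up to conjugation, hence the traces of its powers. *)
definition unitarized_frobenius ::
    "nat \<Rightarrow> 'a :: {finite, field} Polynomial.poly \<Rightarrow> complex mat \<Rightarrow> bool" where
  "unitarized_frobenius g Q A \<longleftrightarrow>
     unitary_mat (2 * g) A \<and>
     hyp_zeta_numerator Q =
       fps_of_poly (rev_char_poly (2 * g) (of_real (sqrt (real CARD('a)))) A)"

definition eta :: "nat \<Rightarrow> complex" where
  "eta k = (if even k then 1 else 0)"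

end

theory Submission
  imports Defs
begin

text \<open>Let \<open>\<chi>\<^sub>k\<close> be the quadratic character of the field with \<open>q\<^sup>k\<close> elements. Comparing logarithmic
  derivatives of both expressions for the zeta function shows that the trace of \<open>\<Theta>\<^sub>Q\<^sup>k\<close> is
  \<open>-q\<^bsup>-k/2\<^esup>\<close> times the sum of \<open>\<chi>\<^sub>k(Q(x))\<close> over that field. The points \<open>x\<close> of the subfield of
  index two contribute \<open>-\<eta>\<^sub>k\<close>, those of the other proper subfields are negligible, and what remains is
  \<open>-T\<^sub>k(Q)\<close>, a sum over the points of exact degree \<open>k\<close>.

  For a uniformly random monic polynomial of degree \<open>N\<close>, the values at Frobenius orbits of total degree
  at most \<open>N\<close> are independent and uniform, because evaluation is an injective linear map between
  spaces of the same size. Each orbit of degree \<open>k\<close> thus yields an independent random sign, and the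
  moments of \<open>T\<^sub>k\<close> are those of a sum of about \<open>q\<^sup>k/k\<close> signs scaled by \<open>k q\<^bsup>-k/2\<^esup>\<close>, hence nearly
  Gaussian with variance \<open>k\<close>.

  To pass to squarefree polynomials, write a monic polynomial as \<open>a\<^sup>2 Q\<close> with \<open>Q\<close> squarefree. Since
  \<open>T\<^sub>k(a\<^sup>2 Q) = T\<^sub>k(Q)\<close> when the degree of \<open>a\<close> is less than \<open>k\<close>, the sum over squarefree polynomials
  of degree \<open>D\<close> is the sum over all monic ones of degree \<open>D\<close> minus \<open>q\<close> times the one of degree
  \<open>D - 2\<close>, up to terms where \<open>a\<close> has degree at least \<open>min k\<^sub>j\<close>. As \<open>\<Theta>\<^sub>Q\<close> is unitary, these are
  bounded trivially by \<open>g\<^sup>c q\<^bsup>-min k\<^esup>\<close> relative to the main term, which tends to \<open>0\<close>.\<close>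

section \<open>Frobenius and the finite subfields of the algebraic closure\<close>

text \<open>The bound \<open>2 * g - 1\<close> is dictated by the sieve: it uses averages over all
  monic polynomials of degrees \<open>2 * g + 1\<close> and \<open>2 * g - 1\<close>, and the values
  at the orbits must be independent in the smaller degree as well. Both averages are then exactly
  the same number, and \<open>q^D - q * q^(D - 2)\<close> is exactly the number of squarefree
  polynomials, so the main term passes through the sieve without error. Distinctness of the
  \<open>k_j\<close> keeps the orbits of different \<open>j\<close> apart. The obstacle is the size
  of \<open>T_k\<close>: a priori it can reach \<open>q^(k/2)\<close>, far too much for the terms
  that the sieve discards. Unitarity bounds it linearly in the degree and \<open>k\<close>, and this
  extends to every monic polynomial of odd degree, because its squarefree part has odd degree and
  again defines a curve of the family, possibly of smaller genus. All errors are a power of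
  \<open>g\<close> times \<open>q powr (- K / 6)\<close>, where \<open>K\<close> is the least
  \<open>k_j\<close>. Here \<open>1/6 = 1/2 - 1/3\<close> compares the normalisation
  \<open>q^(k/2)\<close> with the \<open>q^(k/3)\<close> points of subfields of index at least
  three.\<close>

definition ac_eval :: "'a :: field Polynomial.poly \<Rightarrow> 'a alg_closure \<Rightarrow> 'a alg_closure" where
  "ac_eval B x = Polynomial.poly (map_poly to_ac B) x"

lemma field_hom_to_ac: "field_hom (to_ac :: 'a :: field \<Rightarrow> 'a alg_closure)"
  by unfold_locales simp_all

lemma inj_comm_ring_hom_to_ac: "inj_comm_ring_hom (to_ac :: 'a :: field \<Rightarrow> 'a alg_closure)"
  by unfold_locales simp_all

lemma ac_eval_add: "ac_eval (A + B) x = ac_eval A x + ac_eval B x"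
  and ac_eval_diff: "ac_eval (A - B) x = ac_eval A x - ac_eval B x"
  and ac_eval_mult: "ac_eval (A * B) x = ac_eval A x * ac_eval B x"
  and ac_eval_power: "ac_eval (A ^ n) x = ac_eval A x ^ n"
proof -
  interpret field_hom to_ac by (rule field_hom_to_ac)
  interpret inj_comm_ring_hom to_ac by (rule inj_comm_ring_hom_to_ac)
  interpret H: map_poly_comm_ring_hom to_ac by unfold_locales
  show "ac_eval (A + B) x = ac_eval A x + ac_eval B x"
    "ac_eval (A - B) x = ac_eval A x - ac_eval B x"
    "ac_eval (A * B) x = ac_eval A x * ac_eval B x"
    by (simp_all add: ac_eval_def hom_distribs)
  show "ac_eval (A ^ n) x = ac_eval A x ^ n"
    by (simp add: ac_eval_def hom_distribs)
qed

lemma degree_map_poly_to_ac [simp]: "Polynomial.degree (map_poly to_ac B) = Polynomial.degree B"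
  by (rule degree_map_poly) auto

lemma map_poly_to_ac_eq_0_iff [simp]: "map_poly to_ac B = 0 \<longleftrightarrow> B = 0"
  by (metis map_poly_eq_0_iff to_ac_0 to_ac_eq_0_iff)

lemma ac_eval_altdef:
  "ac_eval B x = (\<Sum>i\<le>Polynomial.degree B. to_ac (Polynomial.coeff B i) * x ^ i)"
  unfolding ac_eval_def by (subst poly_altdef) (simp add: coeff_map_poly)

lemma field_power_card:
  fixes x :: "'a :: {finite, field}"
  shows "x ^ CARD('a) = x"
proof (cases "x = 0")
  case False
  define U where "U = UNIV - {0 :: 'a}"
  have "(\<Prod>y\<in>U. x * y) = (\<Prod>y\<in>U. y)"
    by (rule prod.reindex_bij_witness[of _ "\<lambda>y. y / x" "\<lambda>y. x * y"])
       (use False in \<open>auto simp: U_def\<close>)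
  moreover have "(\<Prod>y\<in>U. x * y) = x ^ card U * (\<Prod>y\<in>U. y)"
    by (simp add: prod.distrib)
  moreover have "(\<Prod>y\<in>U. y) \<noteq> 0"
    by (auto simp: U_def)
  ultimately have "x ^ card U = 1"
    by simp
  moreover have "CARD('a) = Suc (card U)"
    unfolding U_def by (subst card_Diff_singleton) (auto simp: card_gt_0_iff)
  ultimately show ?thesis
    by simp
qed (auto simp: card_gt_0_iff)

lemma one_less_CARD_field: "1 < CARD('a :: {finite, field})"
proof -
  have "card {0, 1 :: 'a} \<le> CARD('a)"
    by (rule card_mono) auto
  then show ?thesis
    by simp
qed

text \<open>The polynomial \<open>(X + 1)\<^sup>q - X\<^sup>q - 1\<close> has degree less than \<open>q\<close> and vanishes on the
  whole field.\<close>
lemma linear_power_card: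
  "[:1, 1 :: 'a :: {finite, field}:] ^ CARD('a) = Polynomial.monom 1 (CARD('a)) + 1"
proof (rule poly_eqI_degree_lead_coeff[where n = "CARD('a)" and A = UNIV])
  have d: "Polynomial.degree ([:1, 1 :: 'a:] ^ CARD('a)) = CARD('a)"
    by (simp add: degree_power_eq)
  then show "Polynomial.degree ([:1, 1 :: 'a:] ^ CARD('a)) \<le> CARD('a)"
    by simp
  have "Polynomial.lead_coeff ([:1, 1 :: 'a:] ^ CARD('a)) = 1"
    by (simp add: lead_coeff_power)
  with d show "Polynomial.coeff ([:1, 1 :: 'a:] ^ CARD('a)) (CARD('a)) =
      Polynomial.coeff (Polynomial.monom 1 (CARD('a)) + 1) (CARD('a))"
    by (simp add: coeff_1)
  show "Polynomial.degree (Polynomial.monom (1 :: 'a) (CARD('a)) + 1) \<le> CARD('a)"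
    by (rule degree_add_le) (auto simp: degree_monom_le)
qed (simp_all add: poly_monom field_power_card poly_power add.commute)

text \<open>\<open>linear_power_card\<close> at \<open>x / y\<close>, homogenised by
  \<open>y^q\<close>: Frobenius is additive, obtained without mentioning the characteristic.\<close>

lemma add_power_card:
  fixes x y :: "'a :: {finite, field} alg_closure"
  shows "(x + y) ^ CARD('a) = x ^ CARD('a) + y ^ CARD('a)"
proof (cases "y = 0")
  case False
  have "ac_eval ([:1, 1 :: 'a:] ^ CARD('a)) (x / y) = ac_eval (Polynomial.monom 1 (CARD('a)) + 1) (x / y)"
    by (simp add: linear_power_card)
  then have "(1 + x / y) ^ CARD('a) = (x / y) ^ CARD('a) + 1"
    by (simp add: ac_eval_power ac_eval_add) (simp add: ac_eval_def map_poly_monom poly_monom map_poly_pCons)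
  then have "(y * (1 + x / y)) ^ CARD('a) = y ^ CARD('a) * ((x / y) ^ CARD('a) + 1)"
    by (simp only: power_mult_distrib)
  also have "\<dots> = x ^ CARD('a) + y ^ CARD('a)"
    using False by (simp add: field_simps power_divide)
  also have "y * (1 + x / y) = x + y"
    using False by (simp add: field_simps)
  finally show ?thesis .
qed (auto simp: card_gt_0_iff)

lemma add_power_card_power:
  fixes x y :: "'a :: {finite, field} alg_closure"
  shows "(x + y) ^ (CARD('a) ^ r) = x ^ (CARD('a) ^ r) + y ^ (CARD('a) ^ r)"
  by (induction r) (simp_all add: power_mult add_power_card mult.commute[of "CARD('a)"])

lemma uminus_power_card_power:
  fixes x :: "'a :: {finite, field} alg_closure"
  shows "(- x) ^ (CARD('a) ^ r) = - (x ^ (CARD('a) ^ r))"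
proof -
  have "(- x) ^ (CARD('a) ^ r) + x ^ (CARD('a) ^ r) = (- x + x) ^ (CARD('a) ^ r)"
    by (simp only: add_power_card_power)
  also have "\<dots> = 0"
    by (auto simp: card_gt_0_iff)
  finally show ?thesis
    by (simp add: eq_neg_iff_add_eq_0)
qed

lemma power_card_power_cancel:
  fixes x y :: "'a :: {finite, field} alg_closure"
  assumes "x ^ (CARD('a) ^ r) = y ^ (CARD('a) ^ r)"
  shows "x = y"
proof -
  have "(x - y) ^ (CARD('a) ^ r) = 0"
    using add_power_card_power[of x "- y" r] assms by (simp add: uminus_power_card_power)
  then show ?thesis
    by simp
qed

lemma sum_power_card_power:
  fixes f :: "'b \<Rightarrow> 'a :: {finite, field} alg_closure"
  shows "sum f A ^ (CARD('a) ^ r) = (\<Sum>i\<in>A. f i ^ (CARD('a) ^ r))"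
proof (cases "finite A")
  case True
  then show ?thesis
    by (induction A rule: finite_induct) (auto simp: add_power_card_power)
qed (auto simp: card_gt_0_iff)

lemma power_card_power_add:
  fixes x :: "'b :: monoid_mult"
  shows "x ^ (c ^ (r + s)) = (x ^ (c ^ r)) ^ (c ^ s)"
  by (simp add: power_add power_mult)

lemma to_ac_power_card_power: "to_ac (c :: 'a :: {finite, field}) ^ (CARD('a) ^ r) = to_ac c"
  by (induction r) (simp_all add: power_mult field_power_card flip: to_ac_power)

lemma ac_eval_frobenius:
  fixes B :: "'a :: {finite, field} Polynomial.poly"
  shows "ac_eval B (x ^ (CARD('a) ^ r)) = ac_eval B x ^ (CARD('a) ^ r)"
  by (simp add: ac_eval_altdef sum_power_card_power power_mult_distrib to_ac_power_card_power
        power_mult[symmetric] mult.commute)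

lemma ext_field_iff: "x \<in> ext_field r \<longleftrightarrow> x ^ (CARD('a) ^ r) = x"
  for x :: "'a :: {finite, field} alg_closure"
  by (simp add: ext_field_def)

lemma ext_field_closed:
  fixes x y :: "'a :: {finite, field} alg_closure"
  assumes "x \<in> ext_field r" "y \<in> ext_field r"
  shows "x + y \<in> ext_field r" "x - y \<in> ext_field r" "x * y \<in> ext_field r"
    "x / y \<in> ext_field r" "x ^ n \<in> ext_field r" "- x \<in> ext_field r"
  using assms add_power_card_power[of x "-y" r]
  by (simp_all add: ext_field_iff add_power_card_power uminus_power_card_power power_mult_distrib
       power_divide power_mult[symmetric] mult.commute[of n]) (simp add: power_mult)

lemma zero_in_ext_field [simp]: "(0 :: 'a :: {finite, field} alg_closure) \<in> ext_field r"
  and one_in_ext_field [simp]: "(1 :: 'a :: {finite, field} alg_closure) \<in> ext_field r"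
  by (auto simp: ext_field_iff card_gt_0_iff)

lemma ac_eval_in_ext_field:
  fixes B :: "'a :: {finite, field} Polynomial.poly"
  assumes "x \<in> ext_field r"
  shows "ac_eval B x \<in> ext_field r"
  using assms by (simp add: ext_field_iff flip: ac_eval_frobenius)

text \<open>The set consists of the roots of \<open>X^n - X\<close> with \<open>n = q^r\<close>.
  This polynomial splits over the closure and is separable, so it has as many roots as its
  degree.\<close>

lemma finite_card_ext_field:
  assumes "r > 0"
  shows "finite (ext_field r :: 'a :: {finite, field} alg_closure set)"
    and "card (ext_field r :: 'a alg_closure set) = CARD('a) ^ r"
proof -
  define n where "n = CARD('a) ^ r"
  have n: "1 < n"
    unfolding n_def using one_less_CARD_field assms by (rule one_less_power)
  define p :: "'a alg_closure Polynomial.poly" where "p = Polynomial.monom 1 n - [:0, 1:]"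
  have deg: "Polynomial.degree p = n"
    unfolding p_def using n
    by (metis (no_types, lifting) degree_add_eq_left degree_minus degree_monom_eq degree_pCons_eq_if
        diff_conv_add_uminus One_nat_def pCons_eq_0_iff zero_neq_one)
  have p0: "p \<noteq> 0"
    using deg n by auto
  have roots: "{x. Polynomial.poly p x = 0} = (ext_field r :: 'a alg_closure set)"
    by (auto simp: p_def ext_field_def poly_monom n_def)
  show "finite (ext_field r :: 'a alg_closure set)"
    using poly_roots_finite[OF p0] roots by simp
  \<comment> \<open>As \<open>q = 0\<close> in the field, the derivative of \<open>p\<close> is the constant \<open>-1\<close>.\<close>
  have "of_nat CARD('a) = (0 :: 'a)"
  proof -
    \<comment> \<open>At \<open>0\<close> the left derivative is \<open>q\<close> and the right one
      is \<open>0\<close>, because \<open>q > 1\<close>.\<close>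
    have "pderiv ([:1, 1 :: 'a:] ^ CARD('a)) = pderiv (Polynomial.monom 1 (CARD('a)) + 1)"
      by (simp add: linear_power_card)
    then have "Polynomial.poly (pderiv ([:1, 1 :: 'a:] ^ CARD('a))) 0 = Polynomial.poly (pderiv (Polynomial.monom 1 (CARD('a)) + 1)) 0"
      by simp
    then show ?thesis using one_less_CARD_field[where ?'a = 'a]
      by (simp add: pderiv_power pderiv_add pderiv_monom poly_monom pderiv_pCons poly_power power_0_left split: if_splits)
  qed
  then have "to_ac (of_nat CARD('a) :: 'a) = to_ac 0"
    by simp
  then have "of_nat n = (0 :: 'a alg_closure)"
    using assms by (simp add: n_def)
  then have "pderiv p = [:-1:]"
    by (simp add: p_def pderiv_diff pderiv_monom pderiv_pCons)
  then have pd: "Polynomial.poly (pderiv p) x \<noteq> 0" for x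
    by simp
  obtain M where M: "size M = Polynomial.degree p"
      "p = Polynomial.smult (Polynomial.lead_coeff p) (\<Prod>x\<in>#M. [:- x, 1:])"
    using alg_closed_imp_factorization[OF p0] by blast
  have "count M a \<le> 1" for a
  proof (rule ccontr)
    assume "\<not> count M a \<le> 1"
    then have "{#a, a#} \<subseteq># M"
      by (auto simp: subseteq_mset_def)
    then obtain M' where M': "M = {#a, a#} + M'"
      by (auto simp: subset_mset.le_iff_add)
    define r where "r = Polynomial.smult (Polynomial.lead_coeff p) (\<Prod>x\<in>#M'. [:- x, 1:])"
    have "p = [:- a, 1:] * ([:- a, 1:] * r)"
      by (subst M(2)) (simp add: M' r_def)
    then have "Polynomial.poly (pderiv p) a = Polynomial.poly (pderiv ([:- a, 1:] * ([:- a, 1:] * r))) a"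
      by (rule arg_cong)
    also have "\<dots> = 0"
      by (simp only: pderiv_mult poly_add poly_mult) simp
    finally have "Polynomial.poly (pderiv p) a = 0" .
    with pd show False
      by blast
  qed
  then have "count M a = 1" if "a \<in># M" for a
    using that by (metis One_nat_def count_greater_zero_iff le_less less_one not_less_eq)
  then have "card (set_mset M) = size M"
    by (simp add: size_multiset_overloaded_eq)
  moreover have "set_mset M = {x. Polynomial.poly p x = 0}"
    using p0 by (subst M(2)) (auto simp: poly_prod_mset prod_mset_zero_iff image_iff)
  ultimately show "card (ext_field r :: 'a alg_closure set) = CARD('a) ^ r"
    using roots deg n_def M(1) by simp
qed

section \<open>Frobenius orbits and equidistribution of values\<close>

lemma ext_field_mult: 
  fixes x :: "'a :: {finite, field} alg_closure"
  assumes "x \<in> ext_field d"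
  shows "x \<in> ext_field (d * c)"
proof (induction c)
  case 0
  then show ?case by (simp add: ext_field_iff)
next
  case (Suc c)
  then show ?case
    using assms by (simp add: ext_field_iff power_card_power_add)
qed

text \<open>The Euclidean step: it makes the least positive degree of a field containing
  \<open>x\<close> divide every other such degree.\<close>

lemma ext_field_mod:
  fixes x :: "'a :: {finite, field} alg_closure"
  assumes "x \<in> ext_field d" "x \<in> ext_field k"
  shows "x \<in> ext_field (k mod d)"
proof -
  have "x = x ^ (CARD('a) ^ (d * (k div d) + k mod d))"
    using assms(2) by (simp add: ext_field_iff)
  also have "\<dots> = x ^ (CARD('a) ^ (k mod d))"
    using ext_field_mult[OF assms(1), of "k div d"]
    by (simp only: power_card_power_add) (simp add: ext_field_iff)
  finally show ?thesis
    by (simp add: ext_field_iff)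
qed

text \<open>For \<open>k > 0\<close> these are the roots of the monic irreducible polynomials of
  degree \<open>k\<close>; each such polynomial corresponds to one Frobenius orbit.\<close>

definition prim_elems :: "nat \<Rightarrow> 'a :: {finite, field} alg_closure set" where
  "prim_elems k = {x \<in> ext_field k. \<forall>d. 0 < d \<and> d < k \<longrightarrow> x \<notin> ext_field d}"

lemma prim_elems_subset: "prim_elems k \<subseteq> ext_field k"
  by (auto simp: prim_elems_def)

lemma finite_prim_elems [simp]: "k > 0 \<Longrightarrow> finite (prim_elems k)"
  by (rule finite_subset[OF prim_elems_subset]) (rule finite_card_ext_field)

lemma ext_field_prim_elemsE:
  assumes "x \<in> ext_field k" "k > 0"
  obtains d where "d > 0" "d dvd k" "x \<in> prim_elems d"
proof -
  define d where "d = (LEAST d. d > 0 \<and> x \<in> ext_field d)"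
  have d: "d > 0 \<and> x \<in> ext_field d"
    unfolding d_def by (rule LeastI[of _ k]) (use assms in auto)
  have min: "x \<notin> ext_field e" if "0 < e" "e < d" for e
    using not_less_Least[of e "\<lambda>d. d > 0 \<and> x \<in> ext_field d"] that by (auto simp: d_def)
  have "x \<in> prim_elems d"
    using d min by (auto simp: prim_elems_def)
  moreover have "k mod d = 0"
    using min[of "k mod d"] ext_field_mod[of x d k] d assms by auto
  ultimately show ?thesis
    using that d by auto
qed

text \<open>Frobenius is injective, so a coincidence of the \<open>i\<close>-th and
  \<open>j\<close>-th conjugates would place \<open>x\<close> in the field of degree
  \<open>j - i < k\<close>.\<close>

lemma prim_elems_inj:
  fixes x :: "'a :: {finite, field} alg_closure"
  assumes "x \<in> prim_elems k"
  shows "inj_on (\<lambda>i. x ^ (CARD('a) ^ i)) {..<k}"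
proof (rule linorder_inj_onI)
  fix i j assume ij: "i < j" "i \<in> {..<k}" "j \<in> {..<k}"
  show "x ^ (CARD('a) ^ i) \<noteq> x ^ (CARD('a) ^ j)"
  proof
    assume "x ^ (CARD('a) ^ i) = x ^ (CARD('a) ^ j)"
    also have "\<dots> = (x ^ (CARD('a) ^ (j - i))) ^ (CARD('a) ^ i)"
      using ij by (simp flip: power_card_power_add)
    finally have "x = x ^ (CARD('a) ^ (j - i))"
      by (rule power_card_power_cancel)
    then have "x \<in> ext_field (j - i)"
      by (simp add: ext_field_iff)
    with assms ij show False
      by (auto simp: prim_elems_def)
  qed
qed auto

lemma ext_field_frobenius:
  fixes x :: "'a :: {finite, field} alg_closure"
  shows "x ^ (CARD('a) ^ i) \<in> ext_field k \<longleftrightarrow> x \<in> ext_field k"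
proof -
  have *: "(x ^ (CARD('a) ^ i)) ^ (CARD('a) ^ k) = (x ^ (CARD('a) ^ k)) ^ (CARD('a) ^ i)"
    by (simp add: add.commute flip: power_card_power_add)
  show ?thesis
    unfolding ext_field_iff * using power_card_power_cancel by auto
qed

lemma prim_elems_frobenius:
  fixes x :: "'a :: {finite, field} alg_closure"
  shows "x ^ (CARD('a) ^ i) \<in> prim_elems k \<longleftrightarrow> x \<in> prim_elems k"
  by (simp add: prim_elems_def ext_field_frobenius)

definition frob_orbit :: "'a :: {finite, field} alg_closure \<Rightarrow> 'a alg_closure set" where
  "frob_orbit x = range (\<lambda>i. x ^ (CARD('a) ^ i))"

lemma frob_orbit_self: "x \<in> frob_orbit x"
  unfolding frob_orbit_def by (rule range_eqI[of _ _ 0]) simp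

text \<open>Only the symmetry of being conjugate needs an argument: Frobenius has finite order on
  \<open>x\<close>, so \<open>k * i - i\<close> further steps lead from the \<open>i\<close>-th
  conjugate back to \<open>x\<close>.\<close>

lemma frob_orbit_eq:
  assumes "x \<in> ext_field k" "k > 0" "y \<in> frob_orbit x"
  shows "frob_orbit y = frob_orbit x"
proof -
  have sub: "frob_orbit v \<subseteq> frob_orbit u" if "v \<in> frob_orbit u" for u v :: "'a alg_closure"
    using that by (auto simp: frob_orbit_def simp flip: power_card_power_add)
  obtain i where i: "y = x ^ (CARD('a) ^ i)"
    using assms(3) by (auto simp: frob_orbit_def)
  have "x = x ^ (CARD('a) ^ (k * i))"
    using ext_field_mult[OF assms(1), of i] by (simp add: ext_field_iff)
  also have "k * i = i + (k * i - i)"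
    using assms(2) by (cases k) auto
  also have "x ^ (CARD('a) ^ (i + (k * i - i))) = y ^ (CARD('a) ^ (k * i - i))"
    by (simp add: i power_card_power_add)
  finally have "x \<in> frob_orbit y"
    unfolding frob_orbit_def by (rule range_eqI)
  with sub[OF this] sub[OF assms(3)] show ?thesis
    by blast
qed

lemma frob_orbit_altdef:
  fixes x :: "'a :: {finite, field} alg_closure"
  assumes "x \<in> ext_field k" "k > 0"
  shows "frob_orbit x = (\<lambda>i. x ^ (CARD('a) ^ i)) ` {..<k}"
proof -
  have "x ^ (CARD('a) ^ i) = x ^ (CARD('a) ^ (i mod k))" for i
  proof -
    have "x ^ (CARD('a) ^ i) = (x ^ (CARD('a) ^ (k * (i div k)))) ^ (CARD('a) ^ (i mod k))"
      by (simp flip: power_card_power_add)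
    then show ?thesis
      using ext_field_mult[OF assms(1), of "i div k"] by (simp add: ext_field_iff)
  qed
  then show ?thesis
    using assms(2) unfolding frob_orbit_def
    by (auto intro!: image_eqI[of _ _ "_ mod k"])
qed

text \<open>A transversal of the orbits. The bijection reduces a sum over
  \<open>prim_elems k\<close> to \<open>k\<close> times a sum over \<open>R\<close> when the summand
  is constant on orbits; the last property is what independence of the values requires.\<close>

lemma orbit_representatives:
  assumes "k > 0"
  obtains R :: "'a :: {finite, field} alg_closure set" where
    "R \<subseteq> prim_elems k"
    "bij_betw (\<lambda>(x, i). x ^ (CARD('a) ^ i)) (R \<times> {..<k}) (prim_elems k)"
    "\<And>x y. x \<in> R \<Longrightarrow> y \<in> R \<Longrightarrow> y \<in> frob_orbit x \<Longrightarrow> x = y"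
proof -
  define rep where "rep = (\<lambda>w :: 'a alg_closure set. SOME y. y \<in> w)"
  define R where "R = (\<lambda>x. rep (frob_orbit x)) ` prim_elems k"
  have rep: "rep (frob_orbit x) \<in> frob_orbit x" for x :: "'a alg_closure"
    unfolding rep_def by (rule someI[of _ x]) (rule frob_orbit_self)
  have orb: "frob_orbit y = frob_orbit x" if "x \<in> prim_elems k" "y \<in> frob_orbit x" 
    for x y :: "'a alg_closure"
    using frob_orbit_eq[of x k y] that assms prim_elems_subset by blast
  have R: "x \<in> prim_elems k" "rep (frob_orbit x) = x" if xR: "x \<in> R" for x
  proof -
    obtain y where y: "y \<in> prim_elems k" "x = rep (frob_orbit y)"
      using xR by (auto simp: R_def)
    have x: "x \<in> frob_orbit y"
      using rep[of y] y by simp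
    then show "x \<in> prim_elems k"
      using y by (auto simp: frob_orbit_def prim_elems_frobenius)
    show "rep (frob_orbit x) = x"
      using orb[OF y(1) x] y(2) by simp
  qed
  have 3: "x = y" if "x \<in> R" "y \<in> R" "y \<in> frob_orbit x" for x y
    using that R orb by metis
  have "bij_betw (\<lambda>(x, i). x ^ (CARD('a) ^ i)) (R \<times> {..<k}) (prim_elems k)"
  proof (rule bij_betwI')
    fix a b assume a: "a \<in> R \<times> {..<k}" and b: "b \<in> R \<times> {..<k}"
    obtain x i where xi: "a = (x, i)" "x \<in> R" "i < k" using a by auto
    obtain y j where yj: "b = (y, j)" "y \<in> R" "j < k" using b by auto
    have "a = b" if *: "x ^ (CARD('a) ^ i) = y ^ (CARD('a) ^ j)"
    proof -
      have "frob_orbit (x ^ (CARD('a) ^ i)) = frob_orbit x"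
        by (rule orb[OF R(1)[OF xi(2)]]) (simp add: frob_orbit_def)
      moreover have "frob_orbit (y ^ (CARD('a) ^ j)) = frob_orbit y"
        by (rule orb[OF R(1)[OF yj(2)]]) (simp add: frob_orbit_def)
      ultimately have "frob_orbit x = frob_orbit y"
        using * by simp
      then have "x = y"
        using 3[OF xi(2) yj(2)] frob_orbit_self[of y] by blast
      with inj_onD[OF prim_elems_inj[OF R(1)[OF xi(2)]], of i j] * xi yj show ?thesis
        by simp
    qed
    then show "((case a of (x, i) \<Rightarrow> x ^ (CARD('a) ^ i)) = (case b of (x, i) \<Rightarrow> x ^ (CARD('a) ^ i))) = (a = b)"
      by (auto simp: xi yj)
  next
    fix a assume "a \<in> R \<times> {..<k}"
    then show "(case a of (x, i) \<Rightarrow> x ^ (CARD('a) ^ i)) \<in> prim_elems k"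
      using R by (auto simp: prim_elems_frobenius)
  next
    fix y :: "'a alg_closure" assume y: "y \<in> prim_elems k"
    define x where "x = rep (frob_orbit y)"
    have x: "x \<in> R"
      using y by (auto simp: R_def x_def)
    have "y \<in> frob_orbit x"
      using orb[OF y rep] frob_orbit_self[of y] by (simp add: x_def)
    moreover have "x \<in> ext_field k"
      using R[OF x] prim_elems_subset by blast
    ultimately obtain i where "i < k" "y = x ^ (CARD('a) ^ i)"
      using assms by (auto simp: frob_orbit_altdef)
    then show "\<exists>a\<in>R \<times> {..<k}. y = (case a of (x, i) \<Rightarrow> x ^ (CARD('a) ^ i))"
      using x by auto
  qed
  with 3 R show ?thesis
    by (intro that[of R]) auto
qed

text \<open>Vanishing coefficients rather than a bound on the degree: the zero polynomial has degree
  \<open>0\<close>, and it must belong to the space even for \<open>m = 0\<close>.\<close>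

definition polys_lt :: "nat \<Rightarrow> 'a :: zero Polynomial.poly set" where
  "polys_lt m = {p. \<forall>i\<ge>m. Polynomial.coeff p i = 0}"

lemma polys_lt_Suc: "polys_lt (Suc m) = (\<lambda>(a, p). pCons a p) ` (UNIV \<times> polys_lt m)"
proof (intro equalityI subsetI)
  fix p :: "'a Polynomial.poly" assume p: "p \<in> polys_lt (Suc m)"
  obtain a r where ar: "p = pCons a r"
    by (cases p)
  have "Polynomial.coeff r i = 0" if "i \<ge> m" for i
    using p that unfolding polys_lt_def ar by (auto dest: spec[of _ "Suc i"])
  then show "p \<in> (\<lambda>(a, p). pCons a p) ` (UNIV \<times> polys_lt m)"
    using ar by (auto simp: polys_lt_def)
qed (auto simp: polys_lt_def coeff_pCons split: nat.splits)

lemma finite_card_polys_lt: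
  "finite (polys_lt m :: 'a :: {finite, zero} Polynomial.poly set) \<and>
   card (polys_lt m :: 'a Polynomial.poly set) = CARD('a) ^ m"
proof (induction m)
  case 0
  have "polys_lt 0 = {0 :: 'a Polynomial.poly}"
    by (auto simp: polys_lt_def poly_eq_iff)
  then show ?case by simp
next
  case (Suc m)
  have "inj_on (\<lambda>(a, p). pCons a p) (UNIV \<times> (polys_lt m :: 'a Polynomial.poly set))"
    by (auto simp: inj_on_def)
  with Suc show ?case
    by (simp add: polys_lt_Suc card_image card_cartesian_product)
qed

lemma polys_lt_diff: "p \<in> polys_lt m \<Longrightarrow> r \<in> polys_lt m \<Longrightarrow> p - r \<in> polys_lt m"
  for p r :: "'a :: comm_ring_1 Polynomial.poly"
  by (auto simp: polys_lt_def)

definition monic_polys :: "nat \<Rightarrow> 'a :: comm_ring_1 Polynomial.poly set" where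
  "monic_polys N = {B. Polynomial.degree B = N \<and> Polynomial.lead_coeff B = 1}"

lemma monic_polys_eq: "monic_polys N = (\<lambda>p. Polynomial.monom 1 N + p) ` polys_lt N"
proof (intro equalityI subsetI)
  fix B :: "'a Polynomial.poly" assume B: "B \<in> monic_polys N"
  have "B - Polynomial.monom 1 N \<in> polys_lt N"
    using B by (auto simp: monic_polys_def polys_lt_def coeff_eq_0 le_less)
  then show "B \<in> (\<lambda>p. Polynomial.monom 1 N + p) ` polys_lt N"
    by (rule rev_image_eqI) simp
next
  fix B :: "'a Polynomial.poly" assume "B \<in> (\<lambda>p. Polynomial.monom 1 N + p) ` polys_lt N"
  then have c: "Polynomial.coeff B N = 1" "\<And>i. i > N \<Longrightarrow> Polynomial.coeff B i = 0"
    by (auto simp: polys_lt_def)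
  have "Polynomial.degree B = N"
    using c by (intro antisym le_degree degree_le) auto
  with c show "B \<in> monic_polys N"
    by (simp add: monic_polys_def)
qed

lemma finite_card_monic_polys:
  "finite (monic_polys N :: 'a :: {finite, field} Polynomial.poly set)"
  "card (monic_polys N :: 'a :: {finite, field} Polynomial.poly set) = CARD('a) ^ N"
  using finite_card_polys_lt[where ?'a = 'a and m = N] by (simp_all add: monic_polys_eq card_image)

section \<open>Independence of the values at points of distinct orbits\<close>

lemma monic_polys_shift:
  fixes R :: "'a :: comm_ring_1 Polynomial.poly"
  assumes "R \<in> polys_lt m" "m \<le> N"
  shows "bij_betw (\<lambda>B. B + R) (monic_polys N) (monic_polys N)"
proof -
  have "B + P \<in> monic_polys N" if "B \<in> monic_polys N" "P \<in> polys_lt m" for B P :: "'a Polynomial.poly"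
  proof -
    obtain C where "B = Polynomial.monom 1 N + C" "C \<in> polys_lt N"
      using \<open>B \<in> _\<close> by (auto simp: monic_polys_eq)
    then show ?thesis
      using assms(2) \<open>P \<in> _\<close> unfolding monic_polys_eq
      by (intro image_eqI[of _ _ "C + P"]) (auto simp: polys_lt_def algebra_simps)
  qed
  from this[OF _ assms(1)] this[of _ "- R"] assms(1) show ?thesis
    by (intro bij_betwI[where g = "\<lambda>B. B - R"]) (auto simp: polys_lt_def)
qed

text \<open>A form of the Chinese remainder theorem. A polynomial that vanishes on \<open>S\<close>
  vanishes at all conjugates as well, and there are \<open>m\<close> of them, more than its degree
  allows; both sides have \<open>q^m\<close> elements.\<close>

lemma evaluation_bij:
  fixes S :: "'a :: {finite, field} alg_closure set"
  assumes S: "finite S" "\<And>x. x \<in> S \<Longrightarrow> x \<in> prim_elems (dg x)" "\<And>x. x \<in> S \<Longrightarrow> dg x > 0"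
    and nc: "\<And>x y. x \<in> S \<Longrightarrow> y \<in> S \<Longrightarrow> y \<in> frob_orbit x \<Longrightarrow> x = y"
  shows "bij_betw (\<lambda>R. \<lambda>x\<in>S. ac_eval R x) (polys_lt (\<Sum>x\<in>S. dg x)) (\<Pi>\<^sub>E x\<in>S. ext_field (dg x))"
proof -
  define m where "m = (\<Sum>x\<in>S. dg x)"
  define E where "E = (\<lambda>R. \<lambda>x\<in>S. ac_eval (R :: 'a Polynomial.poly) x)"
  have ef: "x \<in> ext_field (dg x)" if "x \<in> S" for x
    using S(2)[OF that] prim_elems_subset by blast
  have card_orb: "card (frob_orbit x) = dg x" "finite (frob_orbit x)" if "x \<in> S" for x
    using prim_elems_inj[OF S(2)[OF that]] 
    by (simp_all add: frob_orbit_altdef[OF ef S(3)] that card_image)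
  have disj: "frob_orbit x \<inter> frob_orbit y = {}" if "x \<in> S" "y \<in> S" "x \<noteq> y" for x y
  proof (rule ccontr)
    assume "frob_orbit x \<inter> frob_orbit y \<noteq> {}"
    then obtain z where "z \<in> frob_orbit x" "z \<in> frob_orbit y" by blast
    then have "frob_orbit x = frob_orbit y"
      using frob_orbit_eq[OF ef S(3)] that by metis
    then show False
      using nc[OF that(1,2)] frob_orbit_self[of y] that by simp
  qed
  have cardU: "card (\<Union>x\<in>S. frob_orbit x) = m"
    unfolding m_def using card_orb disj S(1) by (subst card_UN_disjoint) auto
  have inj: "inj_on E (polys_lt m)"
  proof (rule inj_onI)
    fix P R :: "'a Polynomial.poly" assume PR: "P \<in> polys_lt m" "R \<in> polys_lt m" "E P = E R"
    define D where "D = P - R"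
    have D: "D \<in> polys_lt m"
      using PR by (simp add: D_def polys_lt_diff)
    have "ac_eval D x = 0" if "x \<in> S" for x
      using fun_cong[OF PR(3), of x] that by (simp add: E_def D_def ac_eval_diff)
    then have "(\<Union>x\<in>S. frob_orbit x) \<subseteq> {x. Polynomial.poly (map_poly to_ac D) x = 0}"
      by (auto simp: frob_orbit_def ac_eval_frobenius simp flip: ac_eval_def)
    have "D = 0"
    proof (rule ccontr)
      assume "D \<noteq> 0"
      then have D0: "map_poly to_ac D \<noteq> 0"
        by simp
      have "m \<le> card {x. Polynomial.poly (map_poly to_ac D) x = 0}"
        unfolding cardU[symmetric] using \<open>_ \<subseteq> _\<close> by (intro card_mono poly_roots_finite D0)
      also have "\<dots> \<le> Polynomial.degree D"
        using card_poly_roots_bound[OF D0] by simp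
      finally have "Polynomial.coeff D (Polynomial.degree D) = 0"
        using D by (auto simp: polys_lt_def)
      with \<open>D \<noteq> 0\<close> show False
        by simp
    qed
    then show "P = R"
      by (simp add: D_def)
  qed
  have sub: "E ` polys_lt m \<subseteq> (\<Pi>\<^sub>E x\<in>S. ext_field (dg x))"
    using ac_eval_in_ext_field[OF ef] by (auto simp: E_def)
  have fin: "finite (\<Pi>\<^sub>E x\<in>S. ext_field (dg x) :: 'a alg_closure set)"
    using S by (intro finite_PiE finite_card_ext_field) auto
  have "card (\<Pi>\<^sub>E x\<in>S. ext_field (dg x) :: 'a alg_closure set) = CARD('a) ^ m"
    using S by (simp add: card_PiE finite_card_ext_field m_def power_sum)
  also have "\<dots> = card (E ` polys_lt m)"
    using finite_card_polys_lt[where ?'a = 'a] by (simp add: card_image[OF inj])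
  finally have "E ` polys_lt m = (\<Pi>\<^sub>E x\<in>S. ext_field (dg x))"
    using card_subset_eq[OF fin sub] by simp
  with inj show ?thesis
    by (simp add: bij_betw_def E_def m_def)
qed

lemma sum_monic_polys_eval:
  fixes S :: "'a :: {finite, field} alg_closure set"
    and h :: "'a alg_closure \<Rightarrow> 'a alg_closure \<Rightarrow> real"
  assumes S: "finite S" "\<And>x. x \<in> S \<Longrightarrow> x \<in> prim_elems (dg x)" "\<And>x. x \<in> S \<Longrightarrow> dg x > 0"
    and nc: "\<And>x y. x \<in> S \<Longrightarrow> y \<in> S \<Longrightarrow> y \<in> frob_orbit x \<Longrightarrow> x = y"
    and le: "(\<Sum>x\<in>S. dg x) \<le> N"
  shows "(\<Sum>B\<in>monic_polys N. \<Prod>x\<in>S. h x (ac_eval B x)) =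
    real CARD('a) ^ N * (\<Prod>x\<in>S. (\<Sum>z\<in>ext_field (dg x). h x z) / real CARD('a) ^ dg x)"
proof -
  define m where "m = (\<Sum>x\<in>S. dg x)"
  let ?M = "monic_polys N :: 'a Polynomial.poly set" and ?V = "polys_lt m :: 'a Polynomial.poly set"
  define H where "H = (\<lambda>B. \<Prod>x\<in>S. h x (ac_eval B x))"
  have ef: "x \<in> ext_field (dg x)" if "x \<in> S" for x
    using S(2)[OF that] prim_elems_subset by blast
  have q: "real CARD('a) > 0" by (simp add: card_gt_0_iff)
  have inner: "(\<Sum>R\<in>?V. H (B + R)) = (\<Prod>x\<in>S. \<Sum>z\<in>ext_field (dg x). h x z)" for B :: "'a Polynomial.poly"
  proof -
    have "(\<Sum>R\<in>?V. H (B + R)) = (\<Sum>R\<in>?V. \<Prod>x\<in>S. h x (ac_eval B x + (\<lambda>x\<in>S. ac_eval R x) x))"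
      by (simp add: H_def ac_eval_add)
    also have "\<dots> = (\<Sum>u\<in>(\<Pi>\<^sub>E x\<in>S. ext_field (dg x)). \<Prod>x\<in>S. h x (ac_eval B x + u x))"
      unfolding m_def by (rule sum.reindex_bij_betw[OF evaluation_bij[OF S nc]])
    also have "\<dots> = (\<Prod>x\<in>S. \<Sum>z\<in>ext_field (dg x). h x (ac_eval B x + z))"
      using S by (intro prod_sum_PiE[symmetric] finite_card_ext_field)
    also have "\<dots> = (\<Prod>x\<in>S. \<Sum>z\<in>ext_field (dg x). h x z)"
    proof (rule prod.cong[OF refl])
      fix x assume x: "x \<in> S"
      have "ac_eval B x \<in> ext_field (dg x)"
        using ac_eval_in_ext_field[OF ef[OF x]] .
      then show "(\<Sum>z\<in>ext_field (dg x). h x (ac_eval B x + z)) = (\<Sum>z\<in>ext_field (dg x). h x z)"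
        by (intro sum.reindex_bij_witness[of _ "\<lambda>z. z - ac_eval B x" "\<lambda>z. ac_eval B x + z"])
           (auto intro: ext_field_closed)
    qed
    finally show ?thesis .
  qed
  \<comment> \<open>Averaging over translations by \<open>polys_lt m\<close>: each one permutes the
    monic polynomials because \<open>m \<le> N\<close>, and by \<open>inner\<close> the sum over the
    translations does not depend on \<open>B\<close>.\<close>
  have "real (CARD('a) ^ m) * (\<Sum>B\<in>?M. H B) = (\<Sum>R\<in>?V. \<Sum>B\<in>?M. H B)"
    using finite_card_polys_lt[where ?'a = 'a] by simp
  also have "\<dots> = (\<Sum>R\<in>?V. \<Sum>B\<in>?M. H (B + R))"
    using monic_polys_shift[where m = m and N = N and ?'a = 'a] le m_def
    by (intro sum.cong refl sum.reindex_bij_betw[symmetric]) auto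
  also have "\<dots> = (\<Sum>B\<in>?M. \<Sum>R\<in>?V. H (B + R))"
    by (rule sum.swap)
  also have "\<dots> = real CARD('a) ^ N * (\<Prod>x\<in>S. \<Sum>z\<in>ext_field (dg x). h x z)"
    by (simp add: inner finite_card_monic_polys)
  finally have "(\<Sum>B\<in>?M. H B) = real CARD('a) ^ N * ((\<Prod>x\<in>S. \<Sum>z\<in>ext_field (dg x). h x z) / real CARD('a) ^ m)"
    using q by (simp add: field_simps)
  also have "real CARD('a) ^ m = (\<Prod>x\<in>S. real CARD('a) ^ dg x)"
    by (simp add: m_def power_sum)
  finally show ?thesis
    by (simp add: H_def prod_dividef)
qed

section \<open>The quadratic character\<close>

text \<open>The number of square roots minus one. For odd \<open>q\<close> this is the quadratic
  character on the field with \<open>q^k\<close> elements, with value \<open>0\<close> at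
  \<open>0\<close>; in this form it counts points on the curve directly.\<close>

definition quad_char :: "nat \<Rightarrow> 'a :: {finite, field} alg_closure \<Rightarrow> real" where
  "quad_char k z = real (card {y \<in> ext_field k. y ^ 2 = z}) - 1"

lemma two_neq_zero_alg_closure:
  assumes "odd CARD('a :: {finite, field})"
  shows "(2 :: 'a alg_closure) \<noteq> 0"
proof
  assume two: "(2 :: 'a alg_closure) = 0"
  have two': "(1 :: 'a) + 1 = 0"
    using two by (metis to_ac_add to_ac_1 to_ac_eq_0_iff one_add_one)
  \<comment> \<open>Translation by \<open>1\<close> would be a fixed-point free involution of a set of odd size.\<close>
  have "even (card (UNIV :: 'a set))"
  proof -
    have "2 dvd card (\<Union>(range (\<lambda>x :: 'a. {x, x + 1})))"
    proof (rule dvd_partition)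
      show "\<forall>c\<in>range (\<lambda>x :: 'a. {x, x + 1}). 2 dvd card c"
        by (auto simp: card_insert_if)
      show "\<forall>c1\<in>range (\<lambda>x :: 'a. {x, x + 1}). \<forall>c2\<in>range (\<lambda>x :: 'a. {x, x + 1}). c1 \<noteq> c2 \<longrightarrow> c1 \<inter> c2 = {}"
        using two' by (auto simp: add.assoc)
    qed auto
    moreover have "\<Union>(range (\<lambda>x :: 'a. {x, x + 1})) = UNIV" by auto
    ultimately show ?thesis by simp
  qed
  with assms show False by simp
qed

text \<open>The \<open>c\<close>-th moment of the quadratic character at a uniform point of a field
  with \<open>y\<close> elements: even positive powers miss only the point \<open>0\<close>.\<close>

definition char_moment :: "real \<Rightarrow> nat \<Rightarrow> real" where
  "char_moment y c = (if c = 0 then 1 else if odd c then 0 else 1 - 1 / y)"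

lemma quad_char_0: "quad_char k (0 :: 'a :: {finite, field} alg_closure) = 0"
proof -
  have "{y \<in> ext_field k. y ^ 2 = (0 :: 'a alg_closure)} = {0}"
    by auto
  then show ?thesis
    by (simp add: quad_char_def)
qed

lemma quad_char_eq_neg1:
  assumes "\<And>y. y \<in> ext_field k \<Longrightarrow> y ^ 2 \<noteq> (z :: 'a :: {finite, field} alg_closure)"
  shows "quad_char k z = - 1"
proof -
  have "{w \<in> ext_field k. w ^ 2 = z} = {}"
    using assms by auto
  then show ?thesis
    by (simp only: quad_char_def) simp
qed

text \<open>Every \<open>y\<close> is a square root of exactly one \<open>z\<close>, so the numbers
  of square roots add up to the size of the field.\<close>

lemma sum_quad_char:
  assumes "k > 0"
  shows "(\<Sum>z\<in>ext_field k. quad_char k (z :: 'a :: {finite, field} alg_closure)) = 0"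
proof -
  note F = finite_card_ext_field[OF assms, where ?'a = 'a]
  have "(\<Sum>z\<in>ext_field k. card {y \<in> ext_field k. y ^ 2 = (z :: 'a alg_closure)}) = card (ext_field k :: 'a alg_closure set)"
    using F ext_field_closed(5)[where ?'a = 'a]
      sum.group[OF F(1) F(1), of "\<lambda>y. y ^ 2" "\<lambda>_. 1 :: nat"]
    by (auto simp: image_subset_iff)
  then have "(\<Sum>z\<in>ext_field k. real (card {y \<in> ext_field k. y ^ 2 = (z :: 'a alg_closure)})) =
      real (card (ext_field k :: 'a alg_closure set))"
    by (simp flip: of_nat_sum)
  then show ?thesis
    by (simp add: quad_char_def sum_subtractf)
qed

lemma quad_char_frobenius:
  assumes "k > 0" "z \<in> ext_field k"
  shows "quad_char k (z ^ (CARD('a :: {finite, field}) ^ i)) = quad_char k (z :: 'a alg_closure)"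
proof -
  define f where "f = (\<lambda>y :: 'a alg_closure. y ^ (CARD('a) ^ i))"
  have inj: "inj_on f A" for A
    unfolding f_def by (auto intro!: inj_onI dest: power_card_power_cancel)
  have "f ` ext_field k \<subseteq> ext_field k"
    by (auto simp: f_def ext_field_frobenius)
  then have surj: "f ` ext_field k = ext_field k"
    using finite_card_ext_field[OF assms(1), where ?'a = 'a]
    by (intro card_subset_eq) (auto simp: card_image[OF inj])
  have "{y \<in> ext_field k. y ^ 2 = f z} = f ` {y \<in> ext_field k. y ^ 2 = z}"
  proof (intro equalityI subsetI)
    fix y assume y: "y \<in> {y \<in> ext_field k. y ^ 2 = f z}"
    then obtain w where w: "w \<in> ext_field k" "y = f w"
      using surj by blast
    have "f (w ^ 2) = f z"
      using y w(2) by (simp add: f_def power_mult[symmetric] mult.commute)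
    then have "w ^ 2 = z"
      unfolding f_def by (rule power_card_power_cancel)
    with w show "y \<in> f ` {y \<in> ext_field k. y ^ 2 = z}"
      by blast
  next
    fix y assume "y \<in> f ` {y \<in> ext_field k. y ^ 2 = z}"
    then show "y \<in> {y \<in> ext_field k. y ^ 2 = f z}"
      by (auto simp: f_def ext_field_frobenius mult.commute simp flip: power_mult)
  qed
  then have "card {y \<in> ext_field k. y ^ 2 = f z} = card {y \<in> ext_field k. y ^ 2 = z}"
    by (simp add: card_image[OF inj])
  then show ?thesis
    by (simp add: quad_char_def f_def)
qed

lemma quad_char_mult_square:
  assumes "w \<in> ext_field k" "w \<noteq> 0"
  shows "quad_char k (w ^ 2 * z) = quad_char k (z :: 'a :: {finite, field} alg_closure)"
proof -
  have "bij_betw (\<lambda>y. w * y) {y \<in> ext_field k. y ^ 2 = z} {y \<in> ext_field k. y ^ 2 = w ^ 2 * z}"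
    using assms ext_field_closed(3,4)
    by (intro bij_betwI[where g = "\<lambda>y. y / w"]) (auto simp: power_mult_distrib power_divide)
  then show ?thesis
    by (simp add: quad_char_def bij_betw_same_card)
qed

context
  assumes odd_q: "odd CARD('a :: {finite, field})"
begin

lemma neg_neq_self: "x \<noteq> 0 \<Longrightarrow> - x \<noteq> (x :: 'a alg_closure)"
  using two_neq_zero_alg_closure[OF odd_q]
  by (metis add_eq_0_iff mult_2 mult_eq_0_iff)

lemma quad_char_eq_1:
  assumes "y \<in> ext_field k" "y ^ 2 = (z :: 'a alg_closure)" "z \<noteq> 0"
  shows "quad_char k z = 1"
proof -
  have "{w \<in> ext_field k. w ^ 2 = z} = {y, - y}"
    using assms ext_field_closed[OF assms(1) assms(1)] by (auto simp: power2_eq_iff)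
  moreover have "- y \<noteq> y"
    using assms neg_neq_self[of y] by auto
  ultimately show ?thesis
    by (auto simp: quad_char_def card_insert_if)
qed

lemma quad_char_cases: 
  "quad_char k (z :: 'a alg_closure) = (if z = 0 then 0 else 1) \<or> quad_char k z = - 1"
  using quad_char_0 quad_char_eq_1 quad_char_eq_neg1 by metis

lemma abs_quad_char_le: "\<bar>quad_char k (z :: 'a alg_closure)\<bar> \<le> 1"
  using quad_char_cases[of k z] by (auto split: if_splits)

text \<open>Frobenius of the subfield sends a square root \<open>y\<close> of \<open>z\<close> to
  \<open>y\<close> or \<open>- y\<close>, so applying it twice fixes \<open>y\<close>. This is where
  the bias \<open>eta\<close> for even \<open>k\<close> comes from.\<close>

lemma quad_char_subfield:
  assumes "z \<in> ext_field d" "z \<noteq> 0"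
  shows "quad_char (2 * d) (z :: 'a alg_closure) = 1"
proof -
  obtain y where y: "y ^ 2 = z"
    using nth_root_exists[of 2 z] by auto
  have "(y ^ (CARD('a) ^ d)) ^ 2 = (y ^ 2) ^ (CARD('a) ^ d)"
    by (simp add: mult.commute flip: power_mult)
  also have "\<dots> = y ^ 2"
    using assms y by (simp add: ext_field_iff)
  finally have "y ^ (CARD('a) ^ d) = y \<or> y ^ (CARD('a) ^ d) = - y"
    by (simp add: power2_eq_iff)
  then have "(y ^ (CARD('a) ^ d)) ^ (CARD('a) ^ d) = y"
    by (auto simp: uminus_power_card_power)
  then have "y \<in> ext_field (2 * d)"
    by (simp add: ext_field_iff mult_2 power_card_power_add)
  then show ?thesis
    using y assms by (intro quad_char_eq_1) auto
qed

lemma avg_quad_char_power: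
  assumes "k > 0"
  shows "(\<Sum>z\<in>ext_field k. quad_char k (z :: 'a alg_closure) ^ c) / real CARD('a) ^ k = char_moment (real CARD('a) ^ k) c"
proof -
  note F = finite_card_ext_field[OF assms, where ?'a = 'a]
  have q: "real CARD('a) ^ k > 0"
    by (simp add: card_gt_0_iff)
  consider "c = 0" | "odd c" | "even c" "c > 0" by blast
  then show ?thesis
  proof cases
    case 1
    then show ?thesis
      using F q by (simp add: char_moment_def)
  next
    case 2
    have "quad_char k z ^ c = quad_char k z" for z :: "'a alg_closure"
      using quad_char_cases[of k z] quad_char_0[of k] 2 by (auto split: if_splits simp: odd_pos)
    then show ?thesis
      using 2 sum_quad_char[OF assms, where ?'a = 'a] by (simp add: char_moment_def odd_pos)
  next
    case 3
    have "quad_char k z ^ c = 1 - (if z = 0 then 1 else 0)" for z :: "'a alg_closure"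
      using quad_char_cases[of k z] quad_char_0[of k] 3 by (auto split: if_splits)
    then have "(\<Sum>z\<in>ext_field k. quad_char k (z :: 'a alg_closure) ^ c) = real CARD('a) ^ k - 1"
      using F by (simp add: sum_subtractf)
    then show ?thesis
      using 3 q by (simp add: char_moment_def diff_divide_distrib)
  qed
qed

lemma sum_monic_polys_quad_char:
  fixes S :: "'a alg_closure set"
  assumes S: "finite S" "\<And>x. x \<in> S \<Longrightarrow> x \<in> prim_elems (dg x)" "\<And>x. x \<in> S \<Longrightarrow> dg x > 0"
    and nc: "\<And>x y. x \<in> S \<Longrightarrow> y \<in> S \<Longrightarrow> y \<in> frob_orbit x \<Longrightarrow> x = y"
    and le: "(\<Sum>x\<in>S. dg x) \<le> N"
  shows "(\<Sum>B\<in>monic_polys N. \<Prod>x\<in>S. quad_char (dg x) (ac_eval B x) ^ c x) =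
    real CARD('a) ^ N * (\<Prod>x\<in>S. char_moment (real CARD('a) ^ dg x) (c x))"
proof -
  have "(\<Sum>B\<in>monic_polys N. \<Prod>x\<in>S. quad_char (dg x) (ac_eval B x) ^ c x) =
    real CARD('a) ^ N * (\<Prod>x\<in>S. (\<Sum>z\<in>ext_field (dg x). quad_char (dg x) (z :: 'a alg_closure) ^ c x) / real CARD('a) ^ dg x)"
    by (rule sum_monic_polys_eval[OF S nc le, where h = "\<lambda>x z. quad_char (dg x) z ^ c x"])
  also have "(\<Prod>x\<in>S. (\<Sum>z\<in>ext_field (dg x). quad_char (dg x) (z :: 'a alg_closure) ^ c x) / real CARD('a) ^ dg x) =
      (\<Prod>x\<in>S. char_moment (real CARD('a) ^ dg x) (c x))"
    using S(3) by (intro prod.cong refl avg_quad_char_power) auto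
  finally show ?thesis .
qed

end

section \<open>Traces and reversed characteristic polynomials\<close>

lemma mat_trace_comm:
  fixes A B :: "'a :: comm_semiring_0 mat"
  assumes "A \<in> carrier_mat n m" "B \<in> carrier_mat m n"
  shows "mat_trace (A * B) = mat_trace (B * A)"
proof -
  have "mat_trace (A * B) = (\<Sum>i<n. \<Sum>j<m. A $$ (i, j) * B $$ (j, i))"
    using assms by (auto simp: mat_trace_def scalar_prod_def lessThan_atLeast0 intro!: sum.cong)
  also have "\<dots> = (\<Sum>j<m. \<Sum>i<n. B $$ (j, i) * A $$ (i, j))"
    by (subst sum.swap) (simp add: mult.commute)
  also have "\<dots> = mat_trace (B * A)"
    using assms by (auto simp: mat_trace_def scalar_prod_def lessThan_atLeast0 intro!: sum.cong)
  finally show ?thesis .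
qed

lemma upper_triangular_mult:
  fixes A B :: "'a :: comm_semiring_1 mat"
  assumes A: "A \<in> carrier_mat n n" "\<And>i j. j < i \<Longrightarrow> i < n \<Longrightarrow> A $$ (i, j) = 0"
    and B: "B \<in> carrier_mat n n" "\<And>i j. j < i \<Longrightarrow> i < n \<Longrightarrow> B $$ (i, j) = 0"
  shows "j < i \<Longrightarrow> i < n \<Longrightarrow> (A * B) $$ (i, j) = 0"
    and "i < n \<Longrightarrow> (A * B) $$ (i, i) = A $$ (i, i) * B $$ (i, i)"
proof -
  have *: "(A * B) $$ (i, j) = (\<Sum>l<n. A $$ (i, l) * B $$ (l, j))" if "i < n" "j < n" for i j
    using that A(1) B(1) by (auto simp: scalar_prod_def lessThan_atLeast0 intro!: sum.cong)
  have **: "A $$ (i, l) * B $$ (l, j) = 0" if "i < n" "l < n" "j \<le> i" "l \<noteq> i \<or> j < i" for i j l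
    using that A(2)[of l i] B(2)[of j l] by (cases "l < i") auto
  show "j < i \<Longrightarrow> i < n \<Longrightarrow> (A * B) $$ (i, j) = 0"
    using ** by (subst *) (auto intro!: sum.neutral)
  show "(A * B) $$ (i, i) = A $$ (i, i) * B $$ (i, i)" if "i < n"
  proof -
    have "(\<Sum>l<n. A $$ (i, l) * B $$ (l, i)) = (\<Sum>l\<in>{i}. A $$ (i, l) * B $$ (l, i))"
      using that ** by (intro sum.mono_neutral_right) auto
    then show ?thesis
      using that by (simp add: *)
  qed
qed

lemma upper_triangular_pow:
  fixes B :: "'a :: comm_semiring_1 mat"
  assumes B: "B \<in> carrier_mat n n" "\<And>i j. j < i \<Longrightarrow> i < n \<Longrightarrow> B $$ (i, j) = 0"
  shows "(\<forall>i j. j < i \<longrightarrow> i < n \<longrightarrow> (B ^\<^sub>m k) $$ (i, j) = 0) \<and>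
    (\<forall>i<n. (B ^\<^sub>m k) $$ (i, i) = (B $$ (i, i)) ^ k)"
proof (induction k)
  case 0
  then show ?case using B by auto
next
  case (Suc k)
  have C: "B ^\<^sub>m k \<in> carrier_mat n n"
    using B by (intro pow_carrier_mat)
  have 1: "(B ^\<^sub>m k) $$ (i, j) = 0" if "j < i" "i < n" for i j
    using Suc that by blast
  show ?case
    using upper_triangular_mult[OF C 1 B] Suc by (auto simp: mult.commute)
qed

text \<open>The list \<open>bs\<close> holds the eigenvalues with multiplicity. After Schur
  triangularisation both the determinant and the traces of powers are read off the diagonal.\<close>

lemma mat_trace_pow_rev_char_poly:
  assumes A: "A \<in> carrier_mat N N"
  obtains bs where "rev_char_poly N c A = (\<Prod>b\<leftarrow>bs. [:1, - (c * b):])"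
    "\<And>k. mat_trace (A ^\<^sub>m k) = (\<Sum>b\<leftarrow>bs. b ^ k)"
proof -
  obtain es where es: "char_poly A = (\<Prod>a\<leftarrow>es. [:- a, 1:])" "length es = N"
    using char_poly_factorized[OF A] by blast
  obtain B P Q where "schur_decomposition A es = (B, P, Q)"
    by (cases "schur_decomposition A es") auto
  from schur_decomposition[OF A es(1) this] have sim: "similar_mat_wit A B P Q"
    and ut: "upper_triangular B" and diag: "diag_mat B = es"
    by auto
  note w = similar_mat_witD2[OF A sim]
  have utB: "B $$ (i, j) = 0" if "j < i" "i < N" for i j
    using upper_triangularD[OF ut that(1)] that w by auto
  have es_eq: "es = map (\<lambda>i. B $$ (i, i)) [0..<N]"
    using diag w by (auto simp: diag_mat_def)
  have trace: "mat_trace (A ^\<^sub>m k) = (\<Sum>b\<leftarrow>es. b ^ k)" for k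
  proof -
    have Bk: "B ^\<^sub>m k \<in> carrier_mat N N"
      using w by (intro pow_carrier_mat)
    have "mat_trace (A ^\<^sub>m k) = mat_trace (P * B ^\<^sub>m k * Q)"
      using similar_mat_wit_pow_id[OF sim] by simp
    also have "\<dots> = mat_trace (Q * (P * B ^\<^sub>m k))"
      using w Bk by (intro mat_trace_comm[of _ N N]) auto
    also have "Q * (P * B ^\<^sub>m k) = Q * P * B ^\<^sub>m k"
      using w Bk by (intro assoc_mult_mat[symmetric]) auto
    also have "\<dots> = B ^\<^sub>m k"
      using w Bk by simp
    also have "mat_trace (B ^\<^sub>m k) = (\<Sum>i<N. (B ^\<^sub>m k) $$ (i, i))"
      using carrier_matD(1)[OF w(5)] by (simp add: mat_trace_def)
    also have "\<dots> = (\<Sum>i<N. (B $$ (i, i)) ^ k)"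
      using upper_triangular_pow[OF w(5) utB, of k] by simp
    also have "\<dots> = (\<Sum>b\<leftarrow>es. b ^ k)"
      by (simp add: es_eq comp_def interv_sum_list_conv_sum_set_nat lessThan_atLeast0)
    finally show ?thesis .
  qed
  \<comment> \<open>Lifting to constant polynomials turns \<open>P\<close> and \<open>Q\<close> into
    matrices over the polynomial ring that conjugate \<open>I - c u B\<close> into
    \<open>I - c u A\<close>.\<close>
  interpret lift: semiring_hom "\<lambda>z :: complex. [:z:]"
    by unfold_locales auto
  define h where "h = map_mat (\<lambda>z :: complex. [:z:])"
  define M where "M = (\<lambda>V. 1\<^sub>m N - [:0, c:] \<cdot>\<^sub>m h V)"
  have hc: "h U \<in> carrier_mat N N" if "U \<in> carrier_mat N N" for U
    using that by (auto simp: h_def)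
  have hmult: "h (U * V) = h U * h V" if "U \<in> carrier_mat N N" "V \<in> carrier_mat N N" for U V
    unfolding h_def using that by (rule lift.mat_hom_mult)
  have h1: "h (1\<^sub>m N) = 1\<^sub>m N"
    unfolding h_def by (rule lift.mat_hom_one)
  have MB: "M B \<in> carrier_mat N N"
    using hc[OF w(5)] by (auto simp: M_def)
  note hP = hc[OF w(6)] and hQ = hc[OF w(7)] and hB = hc[OF w(5)]
  have PQ: "h P * h Q = 1\<^sub>m N"
    unfolding hmult[OF w(6,7), symmetric] w(1) by (rule h1)
  have QP: "h Q * h P = 1\<^sub>m N"
    unfolding hmult[OF w(7,6), symmetric] w(2) by (rule h1)
  have "h P * M B = h P * 1\<^sub>m N - h P * ([:0, c:] \<cdot>\<^sub>m h B)"
    unfolding M_def using hP hB by (intro mult_minus_distrib_mat) auto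
  also have "\<dots> = h P - [:0, c:] \<cdot>\<^sub>m (h P * h B)"
    using hP hB by (simp add: mult_smult_distrib[of _ N N _ N])
  finally have "h P * M B * h Q = (h P - [:0, c:] \<cdot>\<^sub>m (h P * h B)) * h Q"
    by simp
  also have "\<dots> = h P * h Q - ([:0, c:] \<cdot>\<^sub>m (h P * h B)) * h Q"
    using hP hB hQ by (intro minus_mult_distrib_mat) auto
  also have "([:0, c:] \<cdot>\<^sub>m (h P * h B)) * h Q = [:0, c:] \<cdot>\<^sub>m (h P * h B * h Q)"
    using hP hB hQ by (intro mult_smult_assoc_mat) auto
  also have "h P * h B * h Q = h A"
    unfolding hmult[OF w(6,5), symmetric] hmult[OF mult_carrier_mat[OF w(6,5)] w(7), symmetric]
    by (simp flip: w(3))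
  finally have MA: "M A = h P * M B * h Q"
    by (simp add: PQ M_def)
  have "M A \<in> carrier_mat N N"
    unfolding MA using hP hQ MB by auto
  with hP hQ MB PQ QP MA have "similar_mat (M A) (M B)"
    by (intro similar_matI[of _ _ "h P" "h Q" N]) auto
  then have "det (M A) = det (M B)"
    by (rule det_similar)
  moreover have "upper_triangular (M B)"
    unfolding upper_triangular_def
  proof (intro allI impI)
    fix i j assume "i < dim_row (M B)" "j < i"
    then show "M B $$ (i, j) = 0"
      using MB utB[of j i] carrier_matD[OF w(5)] by (simp add: M_def h_def)
  qed
  then have "det (M B) = prod_list (diag_mat (M B))"
    using MB by (rule det_upper_triangular)
  moreover have "diag_mat (M B) = map (\<lambda>b. [:1, - (c * b):]) es"
  proof -
    have "M B $$ (i, i) = [:1, - (c * B $$ (i, i)):]" if "i < N" for i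
      using that carrier_matD[OF w(5)] by (simp add: M_def h_def) (simp add: poly_eq_iff coeff_pCons split: nat.split)
    then show ?thesis
      using carrier_matD[OF MB] by (simp add: diag_mat_def es_eq)
  qed
  ultimately have "rev_char_poly N c A = (\<Prod>b\<leftarrow>es. [:1, - (c * b):])"
    by (simp add: rev_char_poly_def M_def h_def)
  with trace show ?thesis
    by (intro that[of es])
qed

section \<open>Unitary matrices and the trivial bound for their traces\<close>

lemma mat_adjoint_index:
  fixes A :: "complex mat"
  assumes "A \<in> carrier_mat n m" "i < m" "j < n"
  shows "mat_adjoint A $$ (i, j) = cnj (A $$ (j, i))"
  using assms by (auto simp: mat_adjoint_def mat_of_rows_def cols_def)

lemma mat_adjoint_carrier: 
  fixes A :: "complex mat"
  shows "A \<in> carrier_mat n m \<Longrightarrow> mat_adjoint A \<in> carrier_mat m n"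
  by (auto simp: mat_adjoint_def cols_def)

lemma mat_adjoint_dim [simp]:
  fixes A :: "complex mat"
  shows "dim_row (mat_adjoint A) = dim_col A" "dim_col (mat_adjoint A) = dim_row A"
  using mat_adjoint_carrier[of A "dim_row A" "dim_col A"] by auto

lemma mat_adjoint_mult:
  fixes A B :: "complex mat"
  assumes "A \<in> carrier_mat n n" "B \<in> carrier_mat n n"
  shows "mat_adjoint (A * B) = mat_adjoint B * mat_adjoint A"
proof (rule eq_matI)
  fix i j assume "i < dim_row (mat_adjoint B * mat_adjoint A)" "j < dim_col (mat_adjoint B * mat_adjoint A)"
  then have ij: "i < n" "j < n"
    using assms mat_adjoint_carrier by auto
  have "mat_adjoint (A * B) $$ (i, j) = cnj ((A * B) $$ (j, i))"
    using ij assms by (intro mat_adjoint_index[of _ n n]) auto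
  also have "\<dots> = (\<Sum>l = 0..<n. cnj (A $$ (j, l)) * cnj (B $$ (l, i)))"
    using ij assms by (simp add: scalar_prod_def)
  also have "\<dots> = (\<Sum>l = 0..<n. mat_adjoint B $$ (i, l) * mat_adjoint A $$ (l, j))"
    using ij assms by (intro sum.cong) (auto simp: mat_adjoint_index[of _ n n])
  also have "\<dots> = (mat_adjoint B * mat_adjoint A) $$ (i, j)"
    using ij assms by (simp add: scalar_prod_def)
  finally show "mat_adjoint (A * B) $$ (i, j) = (mat_adjoint B * mat_adjoint A) $$ (i, j)" .
qed simp_all

lemma unitary_mat_mult:
  assumes "unitary_mat N A" "unitary_mat N B"
  shows "unitary_mat N (A * B)"
proof -
  from assms have A: "A \<in> carrier_mat N N" "mat_adjoint A * A = 1\<^sub>m N"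
    and B: "B \<in> carrier_mat N N" "mat_adjoint B * B = 1\<^sub>m N"
    by (auto simp: unitary_mat_def)
  note A' = mat_adjoint_carrier[OF A(1)] and B' = mat_adjoint_carrier[OF B(1)]
  have "mat_adjoint (A * B) * (A * B) = mat_adjoint B * (mat_adjoint A * (A * B))"
    using A B A' B' by (simp add: mat_adjoint_mult assoc_mult_mat[of _ N N _ N _ N])
  also have "mat_adjoint A * (A * B) = B"
    using A B A' by (simp flip: assoc_mult_mat[of _ N N _ N _ N])
  finally show ?thesis
    using A B by (simp add: unitary_mat_def)
qed

lemma unitary_mat_pow:
  assumes "unitary_mat N A"
  shows "unitary_mat N (A ^\<^sub>m k)"
proof (induction k)
  case 0
  have "mat_adjoint (1\<^sub>m N :: complex mat) = 1\<^sub>m N"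
    by (rule eq_matI) (auto simp: mat_adjoint_index[of _ N N])
  then show ?case
    using assms by (auto simp: unitary_mat_def)
next
  case (Suc k)
  then show ?case
    using unitary_mat_mult[OF Suc assms] by simp
qed

text \<open>The columns of a unitary matrix are unit vectors, so every diagonal entry has modulus at
  most \<open>1\<close>.\<close>

lemma norm_mat_trace_unitary_le:
  assumes "unitary_mat N A"
  shows "norm (mat_trace A) \<le> real N"
proof -
  from assms have A: "A \<in> carrier_mat N N" "mat_adjoint A * A = 1\<^sub>m N"
    by (auto simp: unitary_mat_def)
  have "norm (A $$ (i, i)) \<le> 1" if i: "i < N" for i
  proof -
    have "(1 :: complex) = (mat_adjoint A * A) $$ (i, i)"
      using A i by simp
    also have "\<dots> = (\<Sum>l = 0..<N. mat_adjoint A $$ (i, l) * A $$ (l, i))"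
      using i A(1) mat_adjoint_carrier[OF A(1)] by (simp add: scalar_prod_def)
    also have "\<dots> = (\<Sum>l = 0..<N. complex_of_real ((norm (A $$ (l, i)))\<^sup>2))"
      using i A(1) by (intro sum.cong refl, subst complex_norm_square) (simp add: mat_adjoint_index[of _ N N])
    finally have "complex_of_real 1 = complex_of_real (\<Sum>l = 0..<N. (norm (A $$ (l, i)))\<^sup>2)"
      by simp
    then have "(\<Sum>l = 0..<N. (norm (A $$ (l, i)))\<^sup>2) = 1"
      by (simp only: of_real_eq_iff)
    moreover have "(norm (A $$ (i, i)))\<^sup>2 \<le> (\<Sum>l = 0..<N. (norm (A $$ (l, i)))\<^sup>2)"
      using i by (intro member_le_sum) auto
    ultimately show ?thesis
      by (simp add: power_le_one_iff abs_square_le_1)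
  qed
  then have "norm (mat_trace A) \<le> (\<Sum>i<N. 1)"
    unfolding mat_trace_def carrier_matD(1)[OF A(1)] by (intro sum_norm_le) auto
  then show ?thesis
    by simp
qed

section \<open>Logarithmic derivatives of power series\<close>

lemma inverse_one_minus_const_X:
  "inverse (1 - fps_const b * fps_X) = Abs_fps (\<lambda>n. b ^ n)" for b :: "'b :: field"
proof -
  have "(1 - fps_const b * fps_X) * Abs_fps (\<lambda>n. b ^ n) = 1"
  proof (rule fps_ext)
    fix n
    show "fps_nth ((1 - fps_const b * fps_X) * Abs_fps (\<lambda>n. b ^ n)) n = fps_nth 1 n"
      by (cases n) (simp_all add: left_diff_distrib mult.assoc)
  qed
  then show ?thesis
    by (rule fps_inverse_unique)
qed

definition fps_logderiv :: "'b :: field fps \<Rightarrow> 'b fps" where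
  "fps_logderiv f = fps_deriv f * inverse f"

lemma fps_logderiv_mult:
  assumes "fps_nth f 0 \<noteq> 0" "fps_nth h 0 \<noteq> 0"
  shows "fps_logderiv (f * h) = fps_logderiv f + fps_logderiv h"
proof -
  have "inverse f * f = 1" "inverse h * h = 1"
    using assms by (simp_all add: inverse_mult_eq_1)
  then have 1: "f * inverse f = 1" "h * inverse h = 1"
    by (simp_all add: mult.commute)
  have "fps_logderiv (f * h) = fps_deriv h * inverse h * (f * inverse f) + fps_deriv f * inverse f * (h * inverse h)"
    by (simp add: fps_logderiv_def fps_inverse_mult algebra_simps)
  then show ?thesis
    by (simp only: 1) (simp add: fps_logderiv_def)
qed

lemma fps_logderiv_linear:
  "fps_logderiv (1 - fps_const b * fps_X) = Abs_fps (\<lambda>n. - (b ^ Suc n))" for b :: "'b :: field"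
proof -
  have "fps_deriv (1 - fps_const b * fps_X) = fps_const (- b)"
    by simp
  then show ?thesis
    by (simp add: fps_logderiv_def inverse_one_minus_const_X fps_eq_iff)
qed

lemma fps_logderiv_prod_linear:
  fixes bs :: "'b :: field list"
  shows "fps_nth (\<Prod>b\<leftarrow>bs. 1 - fps_const b * fps_X) 0 = 1 \<and>
    fps_logderiv (\<Prod>b\<leftarrow>bs. 1 - fps_const b * fps_X) = Abs_fps (\<lambda>n. - (\<Sum>b\<leftarrow>bs. b ^ Suc n))"
proof (induction bs)
  case Nil
  then show ?case
    by (simp add: fps_logderiv_def fps_eq_iff)
next
  case (Cons b bs)
  then show ?case
    by (simp add: fps_logderiv_mult fps_logderiv_linear) (simp add: fps_eq_iff)
qed

lemma fps_logderiv_exp: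
  fixes G :: "'b :: field_char_0 fps"
  assumes "fps_nth G 0 = 0"
  shows "fps_nth (fps_exp 1 oo G) 0 = 1" "fps_logderiv (fps_exp 1 oo G) = fps_deriv G"
proof -
  let ?Z = "fps_exp 1 oo G"
  show Z0: "fps_nth ?Z 0 = 1"
    by simp
  have d: "fps_deriv ?Z = ?Z * fps_deriv G"
    using assms by (simp add: fps_compose_deriv)
  have "inverse ?Z * ?Z = 1"
    using Z0 by (intro inverse_mult_eq_1) simp
  then have "fps_deriv ?Z * inverse ?Z = fps_deriv G"
    unfolding d by (metis mult.assoc mult.commute mult.right_neutral)
  then show "fps_logderiv ?Z = fps_deriv G"
    by (simp add: fps_logderiv_def)
qed

text \<open>Logarithmic derivatives replace the exponential by the derivative of its exponent and
  the linear factors by power sums. Differentiation shifts indices, so the coefficients of index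
  \<open>k - 1\<close> are compared.\<close>

lemma exp_fps_eq_prod_linear_imp_power_sums:
  fixes G :: "complex fps"
  assumes G: "fps_nth G 0 = 0"
    and eq: "(fps_exp 1 oo G) * ((1 - fps_X) * (1 - fps_const c * fps_X)) = (\<Prod>b\<leftarrow>bs. 1 - fps_const b * fps_X)"
    and k: "k > 0"
  shows "of_nat k * fps_nth G k = 1 + c ^ k - (\<Sum>b\<leftarrow>bs. b ^ k)"
proof -
  have "fps_logderiv ((fps_exp 1 oo G) * ((1 - fps_const 1 * fps_X) * (1 - fps_const c * fps_X))) =
      fps_deriv G + (Abs_fps (\<lambda>n. - (1 ^ Suc n)) + Abs_fps (\<lambda>n. - (c ^ Suc n)))"
    using fps_logderiv_exp[OF G]
    by (subst fps_logderiv_mult, simp, simp, subst fps_logderiv_mult) (simp_all only: fps_logderiv_linear, simp_all)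
  then have "fps_deriv G + (Abs_fps (\<lambda>n. - (1 ^ Suc n)) + Abs_fps (\<lambda>n. - (c ^ Suc n))) = 
      Abs_fps (\<lambda>n. - (\<Sum>b\<leftarrow>bs. b ^ Suc n))"
    using eq fps_logderiv_prod_linear[of bs] by simp
  then have "fps_nth (fps_deriv G + (Abs_fps (\<lambda>n. - (1 ^ Suc n)) + Abs_fps (\<lambda>n. - (c ^ Suc n)))) (k - 1) = 
      fps_nth (Abs_fps (\<lambda>n. - (\<Sum>b\<leftarrow>bs. b ^ Suc n))) (k - 1)"
    by simp
  then have "of_nat (Suc (k - 1)) * fps_nth G (Suc (k - 1)) - 1 - c ^ Suc (k - 1) = - (\<Sum>b\<leftarrow>bs. b ^ Suc (k - 1))"
    by (simp add: algebra_simps)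
  moreover have "Suc (k - 1) = k"
    using k by simp
  ultimately show ?thesis
    by (simp only:) (simp add: algebra_simps)
qed

section \<open>Traces of Frobenius as character sums\<close>

lemma prim_elems_imp_ext_field: "x \<in> prim_elems k \<Longrightarrow> x \<in> ext_field k"
  using prim_elems_subset by blast

text \<open>Above each finite \<open>x\<close> lie \<open>1 + quad_char k (ac_eval Q x)\<close>
  points; the summand \<open>1\<close> is the point at infinity.\<close>

lemma card_hyp_points:
  fixes Q :: "'a :: {finite, field} Polynomial.poly"
  assumes "k > 0"
  shows "real (card (hyp_points Q k)) =
    1 + real CARD('a) ^ k + (\<Sum>x\<in>ext_field k. quad_char k (ac_eval Q x))"
proof -
  note F = finite_card_ext_field[OF assms, where ?'a = 'a]
  define Y where "Y = (\<lambda>x :: 'a alg_closure. {y \<in> ext_field k. y ^ 2 = ac_eval Q x})"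
  have Y: "{(x, y). x \<in> ext_field k \<and> y \<in> ext_field k \<and> y ^ 2 = Polynomial.poly (map_poly to_ac Q) x} =
      (SIGMA x:ext_field k. Y x)"
    by (auto simp: Y_def ac_eval_def)
  have fin: "finite (Y x)" for x
    unfolding Y_def using F by simp
  have "card (hyp_points Q k) = Suc (card (SIGMA x:ext_field k. Y x))"
    unfolding hyp_points_def Y using F fin
    by (subst card_insert_disjoint) (auto simp: card_image)
  also have "card (SIGMA x:ext_field k. Y x) = (\<Sum>x\<in>ext_field k. card (Y x))"
    using F fin by (intro card_SigmaI) auto
  finally have "real (card (hyp_points Q k)) = 1 + (\<Sum>x\<in>ext_field k. 1 + quad_char k (ac_eval Q x))"
    by (simp add: quad_char_def Y_def)
  then show ?thesis
    using F by (simp add: sum.distrib)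
qed

lemma unitarized_frobenius_trace:
  fixes Q :: "'a :: {finite, field} Polynomial.poly"
  assumes A: "unitarized_frobenius g Q A" and k: "k > 0"
  shows "complex_of_real (sqrt (real CARD('a)) ^ k) * mat_trace (A ^\<^sub>m k) =
    - complex_of_real (\<Sum>x\<in>ext_field k. quad_char k (ac_eval Q x))"
proof -
  define c where "c = complex_of_real (sqrt (real CARD('a)))"
  define G :: "complex fps" where "G = Abs_fps (\<lambda>r. of_nat (card (hyp_points Q r)) / of_nat r)"
  have "A \<in> carrier_mat (2 * g) (2 * g)"
    using A by (simp add: unitarized_frobenius_def unitary_mat_def)
  then obtain bs where bs: "rev_char_poly (2 * g) c A = (\<Prod>b\<leftarrow>bs. [:1, - (c * b):])"
    "\<And>k. mat_trace (A ^\<^sub>m k) = (\<Sum>b\<leftarrow>bs. b ^ k)"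
    using mat_trace_pow_rev_char_poly[of A "2 * g" c] by blast
  have lin: "fps_of_poly [:1, - (c * b):] = 1 - fps_const (c * b) * fps_X" for b
    by (simp add: fps_of_poly_pCons mult.commute flip: fps_const_neg)
  have eq: "(fps_exp 1 oo G) * ((1 - fps_X) * (1 - fps_const (of_nat CARD('a)) * fps_X)) =
      (\<Prod>b\<leftarrow>map (\<lambda>b. c * b) bs. 1 - fps_const b * fps_X)"
    using A by (simp add: unitarized_frobenius_def hyp_zeta_numerator_def hyp_zeta_def G_def bs(1)
        fps_of_poly_prod_list lin comp_def flip: c_def)
  have "of_nat k * fps_nth G k = 1 + of_nat CARD('a) ^ k - (\<Sum>b\<leftarrow>map (\<lambda>b. c * b) bs. b ^ k)"
    by (rule exp_fps_eq_prod_linear_imp_power_sums[OF _ eq k]) (simp add: G_def)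
  also have "(\<Sum>b\<leftarrow>map (\<lambda>b. c * b) bs. b ^ k) = c ^ k * (\<Sum>b\<leftarrow>bs. b ^ k)"
    by (simp add: comp_def power_mult_distrib sum_list_const_mult)
  also have "of_nat k * fps_nth G k = complex_of_real (real (card (hyp_points Q k)))"
    using k by (simp add: G_def)
  finally show ?thesis
    unfolding card_hyp_points[OF k] bs(2)[symmetric]
    by (simp add: c_def algebra_simps eq_neg_iff_add_eq_0)
qed

text \<open>The normalised sum \<open>T_k\<close> of the overview. It is defined for polynomials
  with square factors too, as the sieve evaluates it there.\<close>

definition prim_sum :: "nat \<Rightarrow> 'a :: {finite, field} Polynomial.poly \<Rightarrow> real" where
  "prim_sum k B = (\<Sum>x\<in>prim_elems k. quad_char k (ac_eval B x)) / sqrt (real CARD('a)) ^ k"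

section \<open>Separating the points of exact degree from those of proper subfields\<close>

lemma card_zeros_le:
  assumes "B \<noteq> (0 :: 'a :: {finite, field} Polynomial.poly)"
  shows "finite {x. ac_eval B x = 0}" "card {x \<in> X'. ac_eval B x = 0} \<le> Polynomial.degree B"
proof -
  have "map_poly to_ac B \<noteq> 0"
    using assms by simp
  note * = poly_roots_finite[OF this] card_poly_roots_bound[OF this]
  show fin: "finite {x. ac_eval B x = 0}"
    using * by (simp add: ac_eval_def)
  have "card {x \<in> X'. ac_eval B x = 0} \<le> card {x. ac_eval B x = 0}"
    using fin by (intro card_mono) auto
  also have "\<dots> \<le> Polynomial.degree B"
    using * by (simp add: ac_eval_def)
  finally show "card {x \<in> X'. ac_eval B x = 0} \<le> Polynomial.degree B" .
qed

lemma card_small_subfields: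
  "finite (\<Union>d\<in>{1..k div 3}. ext_field d :: 'a :: {finite, field} alg_closure set)"
  "card (\<Union>d\<in>{1..k div 3}. ext_field d :: 'a alg_closure set) \<le> k * CARD('a) ^ (k div 3)"
proof -
  show "finite (\<Union>d\<in>{1..k div 3}. ext_field d :: 'a alg_closure set)"
    using finite_card_ext_field(1)[where ?'a = 'a] by auto
  have "card (\<Union>d\<in>{1..k div 3}. ext_field d :: 'a alg_closure set) \<le>
      (\<Sum>d\<in>{1..k div 3}. card (ext_field d :: 'a alg_closure set))"
    by (rule card_UN_le) simp
  also have "\<dots> \<le> (\<Sum>d\<in>{1..k div 3}. CARD('a) ^ (k div 3))"
    using one_less_CARD_field[where ?'a = 'a]
    by (intro sum_mono) (auto simp: finite_card_ext_field intro!: power_increasing)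
  also have "\<dots> \<le> k * CARD('a) ^ (k div 3)"
    by simp
  finally show "card (\<Union>d\<in>{1..k div 3}. ext_field d :: 'a alg_closure set) \<le> k * CARD('a) ^ (k div 3)" .
qed

text \<open>A proper divisor of \<open>k\<close> is \<open>k / 2\<close> or at most
  \<open>k / 3\<close>. Points of the first kind contribute at the scale \<open>q^(k/2)\<close> of
  the normalisation, the others at most \<open>k * q^(k/3)\<close> in total.\<close>

lemma nonprim_cases:
  assumes "x \<in> ext_field k - prim_elems k" "k > 0"
  shows "even k \<and> x \<in> ext_field (k div 2) \<or> x \<in> (\<Union>d\<in>{1..k div 3}. ext_field d)"
proof -
  obtain d where d: "d > 0" "d dvd k" "x \<in> prim_elems d"
    using assms ext_field_prim_elemsE[of x k] by auto
  then obtain c where c: "k = d * c"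
    by blast
  have "c \<noteq> 0" "c \<noteq> 1"
    using d c assms by auto
  then consider "c = 2" | "c \<ge> 3"
    by linarith
  then show ?thesis
  proof cases
    case 1
    then show ?thesis
      using c d prim_elems_subset by auto
  next
    case 2
    then have "d * 3 \<le> k"
      using c by simp
    then have "d \<in> {1..k div 3}"
      using d by auto
    then show ?thesis
      using d prim_elems_subset by blast
  qed
qed

text \<open>The exponent is \<open>1/3 - 1/2 = - 1/6\<close>; this quantity serves as the common
  error scale from here on.\<close>

lemma q_powr_bounds:
  "real (CARD('a :: {finite, field}) ^ (k div 3)) / sqrt (real CARD('a)) ^ k \<le> real CARD('a) powr (- real k / 6)"
  "1 / sqrt (real CARD('a)) ^ k \<le> real CARD('a) powr (- real k / 6)"
proof -
  have q: "real CARD('a) > 1"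
    using one_less_CARD_field[where ?'a = 'a] by simp
  have s: "sqrt (real CARD('a)) ^ k = real CARD('a) powr (real k / 2)"
    using q by (simp add: powr_half_sqrt[symmetric] powr_powr flip: powr_realpow)
  have "real (CARD('a) ^ (k div 3)) = real CARD('a) powr real (k div 3)"
    using q by (simp add: powr_realpow)
  also have "\<dots> \<le> real CARD('a) powr (real k / 3)"
    using q by (intro powr_mono) auto
  finally show "real (CARD('a) ^ (k div 3)) / sqrt (real CARD('a)) ^ k \<le> real CARD('a) powr (- real k / 6)"
    unfolding s using q by (simp add: divide_le_eq flip: powr_add)
  show "1 / sqrt (real CARD('a)) ^ k \<le> real CARD('a) powr (- real k / 6)"
    unfolding s using q by (simp add: divide_le_eq ge_one_powr_ge_zero flip: powr_add)
qed

lemma norm_trace_frobenius_le: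
  fixes Q :: "'a :: {finite, field} Polynomial.poly"
  assumes A: "unitarized_frobenius g Q A"
  shows "norm (mat_trace (A ^\<^sub>m k)) \<le> real (2 * g)"
  using A unfolding unitarized_frobenius_def by (intro norm_mat_trace_unitary_le unitary_mat_pow) auto

lemma quad_char_ac_eval_square_mult:
  fixes B C :: "'a :: {finite, field} Polynomial.poly"
  assumes "x \<in> ext_field k"
  shows "quad_char k (ac_eval (C ^ 2 * B) x) = (if ac_eval C x = 0 then 0 else quad_char k (ac_eval B x))"
  using quad_char_mult_square[OF ac_eval_in_ext_field[OF assms]] quad_char_0[where ?'a = 'a]
  by (simp add: ac_eval_mult ac_eval_power)

text \<open>A zero of \<open>C\<close> of exact degree \<open>k\<close> would bring its
  \<open>k\<close> conjugates along, more zeros than the degree of \<open>C\<close> permits.\<close>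

lemma prim_sum_square_mult_eq:
  fixes B C :: "'a :: {finite, field} Polynomial.poly"
  assumes "C \<noteq> 0" "Polynomial.degree C < k"
  shows "prim_sum k (C ^ 2 * B) = prim_sum k B"
proof -
  have "ac_eval C x \<noteq> 0" if x: "x \<in> prim_elems k" for x
  proof
    assume "ac_eval C x = 0"
    then have "(\<lambda>i. x ^ (CARD('a) ^ i)) ` {..<k} \<subseteq> {x. ac_eval C x = 0}"
      by (auto simp: ac_eval_frobenius)
    from card_mono[OF card_zeros_le(1)[OF assms(1)] this] have "k \<le> card {x. ac_eval C x = 0}"
      by (simp add: card_image[OF prim_elems_inj[OF x]])
    then show False
      using card_zeros_le(2)[OF assms(1), of UNIV] assms(2) by simp
  qed
  then have "(\<Sum>x\<in>prim_elems k. quad_char k (ac_eval (C ^ 2 * B) x)) = 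
      (\<Sum>x\<in>prim_elems k. quad_char k (ac_eval B x))"
    by (intro sum.cong refl) (auto simp: quad_char_ac_eval_square_mult prim_elems_imp_ext_field)
  then show ?thesis
    by (simp add: prim_sum_def)
qed

context
  assumes odd_q: "odd CARD('a :: {finite, field})"
begin

lemma sum_quad_char_subfield:
  assumes B: "B \<noteq> (0 :: 'a Polynomial.poly)" and d: "d > 0"
  shows "\<bar>(\<Sum>x\<in>ext_field d. quad_char (2 * d) (ac_eval B x)) - real CARD('a) ^ d\<bar> \<le> real (Polynomial.degree B)"
proof -
  note F = finite_card_ext_field[OF d, where ?'a = 'a]
  have "(\<Sum>x\<in>ext_field d. quad_char (2 * d) (ac_eval B x)) =
      (\<Sum>x\<in>ext_field d. 1 - (if ac_eval B x = 0 then 1 else 0))"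
    using quad_char_subfield[OF odd_q ac_eval_in_ext_field] quad_char_0
    by (intro sum.cong) auto
  also have "\<dots> = real CARD('a) ^ d - real (card {x \<in> ext_field d. ac_eval B x = 0})"
    using F by (simp add: sum_subtractf flip: sum.inter_filter)
  finally show ?thesis
    using card_zeros_le(2)[OF B, of "ext_field d"] by simp
qed

lemma abs_sum_quad_char_le:
  "\<bar>\<Sum>x\<in>S. quad_char k (ac_eval (B :: 'a Polynomial.poly) x)\<bar> \<le> real (card S)"
proof -
  have "\<bar>\<Sum>x\<in>S. quad_char k (ac_eval B x)\<bar> \<le> (\<Sum>x\<in>S. 1)"
    by (intro order_trans[OF sum_abs] sum_mono abs_quad_char_le[OF odd_q])
  then show ?thesis by simp
qed

lemma sum_quad_char_prim_elems:
  assumes B: "B \<noteq> (0 :: 'a Polynomial.poly)" and k: "k > 0"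
  shows "\<bar>(\<Sum>x\<in>ext_field k. quad_char k (ac_eval B x)) - (\<Sum>x\<in>prim_elems k. quad_char k (ac_eval B x))
    - of_bool (even k) * sqrt (real CARD('a)) ^ k\<bar> \<le> real (Polynomial.degree B) + real (k * CARD('a) ^ (k div 3))"
proof -
  note F = finite_card_ext_field[OF k, where ?'a = 'a]
  let ?f = "\<lambda>x. quad_char k (ac_eval B x)"
  \<comment> \<open>The subfield of index two, present only for even \<open>k\<close>. It has
    \<open>q^(k/2)\<close> elements, which is exactly the correction term, and the character is
    \<open>1\<close> there except at zeros of \<open>B\<close>.\<close>
  define E where "E = (if even k then ext_field (k div 2) else {} :: 'a alg_closure set)"
  define U where "U = ext_field k - prim_elems k - E"
  have sq: "of_bool (even k) * sqrt (real CARD('a)) ^ k = (if even k then real CARD('a) ^ (k div 2) else 0)"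
    by (auto elim!: evenE simp: power_mult)
  have Esub: "E \<subseteq> ext_field k - prim_elems k"
    using k ext_field_mult[where c = 2 and d = "k div 2" and ?'a = 'a] by (auto simp: E_def prim_elems_def)
  have "(\<Sum>x\<in>ext_field k. ?f x) = (\<Sum>x\<in>prim_elems k. ?f x) + (\<Sum>x\<in>ext_field k - prim_elems k. ?f x)"
    using F prim_elems_subset by (subst add.commute, intro sum.subset_diff) auto
  also have "(\<Sum>x\<in>ext_field k - prim_elems k. ?f x) = (\<Sum>x\<in>U. ?f x) + (\<Sum>x\<in>E. ?f x)"
    unfolding U_def using F Esub by (intro sum.subset_diff) auto
  finally have "(\<Sum>x\<in>ext_field k. ?f x) - (\<Sum>x\<in>prim_elems k. ?f x) - of_bool (even k) * sqrt (real CARD('a)) ^ k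
      = ((\<Sum>x\<in>E. ?f x) - of_bool (even k) * sqrt (real CARD('a)) ^ k) + (\<Sum>x\<in>U. ?f x)"
    by simp
  moreover have "\<bar>(\<Sum>x\<in>E. ?f x) - of_bool (even k) * sqrt (real CARD('a)) ^ k\<bar> \<le> real (Polynomial.degree B)"
    using sum_quad_char_subfield[OF B, of "k div 2"] k unfolding sq by (auto simp: E_def elim!: evenE)
  moreover have "\<bar>\<Sum>x\<in>U. ?f x\<bar> \<le> real (k * CARD('a) ^ (k div 3))"
  proof -
    have "U \<subseteq> (\<Union>d\<in>{1..k div 3}. ext_field d)"
    proof
      fix x assume x: "x \<in> U"
      then show "x \<in> (\<Union>d\<in>{1..k div 3}. ext_field d)"
        using nonprim_cases[of x k] k by (auto simp: U_def E_def split: if_splits)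
    qed
    then have "card U \<le> k * CARD('a) ^ (k div 3)"
      using card_mono[OF card_small_subfields(1)] card_small_subfields(2) by (meson order_trans)
    then show ?thesis
      using abs_sum_quad_char_le[where S = U and k = k and B = B] by linarith
  qed
  ultimately show ?thesis
    by linarith
qed

lemma trace_prim_sum:
  fixes Q :: "'a Polynomial.poly"
  assumes A: "unitarized_frobenius g Q A" and Q: "Q \<in> hyp_ensemble g" and k: "k > 0"
  shows "norm (mat_trace (A ^\<^sub>m k) - (- eta k - complex_of_real (prim_sum k Q))) \<le>
    (real (2 * g + 1) + real k) * real CARD('a) powr (- real k / 6)"
proof -
  let ?s = "sqrt (real CARD('a)) ^ k"
  define S where "S = (\<Sum>x\<in>ext_field k. quad_char k (ac_eval Q x))"
  define P where "P = (\<Sum>x\<in>prim_elems k. quad_char k (ac_eval Q x))"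
  have s: "?s > 0"
    using one_less_CARD_field[where ?'a = 'a] by simp
  have deg: "Polynomial.degree Q = 2 * g + 1"
    using Q by (simp add: hyp_ensemble_def)
  then have "Q \<noteq> 0"
    by auto
  have "mat_trace (A ^\<^sub>m k) = - complex_of_real (S / ?s)"
    using unitarized_frobenius_trace[OF A k] s by (simp add: S_def field_simps)
  moreover have "eta k = complex_of_real (of_bool (even k) * ?s / ?s)"
    using s by (simp add: eta_def)
  ultimately have "mat_trace (A ^\<^sub>m k) - (- eta k - complex_of_real (prim_sum k Q)) =
      - complex_of_real ((S - P - of_bool (even k) * ?s) / ?s)"
    unfolding prim_sum_def P_def[symmetric] by (simp only: diff_divide_distrib of_real_diff) simp
  then have "norm (mat_trace (A ^\<^sub>m k) - (- eta k - complex_of_real (prim_sum k Q))) = 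
      \<bar>S - P - of_bool (even k) * ?s\<bar> / ?s"
    using s by (simp only: norm_minus_cancel norm_of_real) simp
  also have "\<dots> \<le> (real (2 * g + 1) + real (k * CARD('a) ^ (k div 3))) / ?s"
    using sum_quad_char_prim_elems[OF \<open>Q \<noteq> 0\<close> k] deg s unfolding S_def P_def
    by (intro divide_right_mono) auto
  also have "\<dots> = real (2 * g + 1) * (1 / ?s) + real k * (real (CARD('a) ^ (k div 3)) / ?s)"
    by (simp add: add_divide_distrib)
  also have "\<dots> \<le> real (2 * g + 1) * real CARD('a) powr (- real k / 6) + real k * real CARD('a) powr (- real k / 6)"
    by (intro add_mono mult_left_mono q_powr_bounds) auto
  finally show ?thesis
    by (simp add: algebra_simps)
qed

lemma prim_sum_square_mult_le:
  fixes B C :: "'a Polynomial.poly"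
  assumes "C \<noteq> 0" "k > 0"
  shows "\<bar>prim_sum k (C ^ 2 * B)\<bar> \<le> \<bar>prim_sum k B\<bar> + real (Polynomial.degree C)"
proof -
  let ?s = "sqrt (real CARD('a)) ^ k"
  have s: "?s \<ge> 1"
    using one_less_CARD_field[where ?'a = 'a] by (intro one_le_power) simp
  let ?Z = "{x \<in> prim_elems k. ac_eval C x = 0}"
  have "(\<Sum>x\<in>prim_elems k. quad_char k (ac_eval (C ^ 2 * B) x)) =
      (\<Sum>x\<in>prim_elems k - ?Z. quad_char k (ac_eval B x))"
    using assms(2)
    by (intro sum.mono_neutral_cong_right) (auto simp: quad_char_ac_eval_square_mult prim_elems_imp_ext_field)
  also have "\<dots> = (\<Sum>x\<in>prim_elems k. quad_char k (ac_eval B x)) - (\<Sum>x\<in>?Z. quad_char k (ac_eval B x))"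
    using assms(2) by (intro sum_diff) auto
  finally have "prim_sum k (C ^ 2 * B) = prim_sum k B - (\<Sum>x\<in>?Z. quad_char k (ac_eval B x)) / ?s"
    by (simp add: prim_sum_def diff_divide_distrib)
  moreover have "\<bar>(\<Sum>x\<in>?Z. quad_char k (ac_eval B x)) / ?s\<bar> \<le> real (Polynomial.degree C)"
  proof -
    have "\<bar>(\<Sum>x\<in>?Z. quad_char k (ac_eval B x)) / ?s\<bar> = \<bar>\<Sum>x\<in>?Z. quad_char k (ac_eval B x)\<bar> / ?s"
      using s by simp
    also have "\<dots> \<le> \<bar>\<Sum>x\<in>?Z. quad_char k (ac_eval B x)\<bar>"
      using s by (simp add: divide_le_eq mult_le_cancel_left1)
    also have "\<dots> \<le> real (card ?Z)"
      by (rule abs_sum_quad_char_le)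
    also have "\<dots> \<le> real (Polynomial.degree C)"
      using card_zeros_le(2)[OF assms(1)] by simp
    finally show ?thesis .
  qed
  ultimately show ?thesis
    by linarith
qed

end

section \<open>Moments of sums of random signs\<close>

text \<open>The multinomial theorem indexed by maps \<open>h\<close> instead of exponent vectors, so
  that all coefficients are \<open>1\<close> and the exponents are the fibre sizes of
  \<open>h\<close>.\<close>

lemma sum_power_eq_sum_PiE:
  fixes f :: "'b \<Rightarrow> 'c :: comm_semiring_1"
  assumes "finite R"
  shows "(\<Sum>x\<in>R. f x) ^ b = (\<Sum>h\<in>{..<b} \<rightarrow>\<^sub>E R. \<Prod>x\<in>R. f x ^ card {i \<in> {..<b}. h i = x})"
proof -
  have "(\<Sum>x\<in>R. f x) ^ b = (\<Prod>i<b. \<Sum>x\<in>R. f x)"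
    by simp
  also have "\<dots> = (\<Sum>h\<in>{..<b} \<rightarrow>\<^sub>E R. \<Prod>i<b. f (h i))"
    using assms by (intro prod_sum_PiE) auto
  also have "\<dots> = (\<Sum>h\<in>{..<b} \<rightarrow>\<^sub>E R. \<Prod>x\<in>R. f x ^ card {i \<in> {..<b}. h i = x})"
  proof (rule sum.cong[OF refl])
    fix h assume h: "h \<in> {..<b} \<rightarrow>\<^sub>E R"
    have "(\<Prod>x\<in>R. \<Prod>i | i \<in> {..<b} \<and> h i = x. f (h i)) = (\<Prod>i<b. f (h i))"
      using assms h by (intro prod.group) auto
    moreover have "(\<Prod>i | i \<in> {..<b} \<and> h i = x. f (h i)) = f x ^ card {i \<in> {..<b}. h i = x}" for x
      by (subst prod.cong[OF refl, of _ _ "\<lambda>_. f x"]) auto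
    ultimately show "(\<Prod>i<b. f (h i)) = (\<Prod>x\<in>R. f x ^ card {i \<in> {..<b}. h i = x})"
      by simp
  qed
  finally show ?thesis .
qed

lemma fps_exp_sum: "fps_exp (\<Sum>x\<in>A. f x) = (\<Prod>x\<in>A. fps_exp (f x))" for f :: "'b \<Rightarrow> real"
  by (induction A rule: infinite_finite_induct) (simp_all add: fps_exp_add_mult)

text \<open>The series of \<open>cosh u - 1\<close>. A variable that is \<open>0\<close> with
  probability \<delta> and otherwise a random sign has moment generating function
  \<open>1 + (1 - \<delta>) (cosh u - 1)\<close>.\<close>

definition coshm1_fps :: "real fps" where
  "coshm1_fps = Abs_fps (\<lambda>c. if even c \<and> c > 0 then 1 / fact c else 0)"

lemma coshm1_fps_power_odd: "odd b \<Longrightarrow> fps_nth (coshm1_fps ^ m) b = 0"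
proof (induction m arbitrary: b)
  case 0
  then show ?case by (auto simp: odd_pos)
next
  case (Suc m)
  have "fps_nth coshm1_fps i * fps_nth (coshm1_fps ^ m) (b - i) = 0" if "i \<le> b" for i
    using Suc.IH[of "b - i"] Suc.prems that by (cases "even i") (auto simp: coshm1_fps_def)
  then show ?case
    by (simp only: power_Suc fps_mult_nth) (rule sum.neutral, simp)
qed

lemma coshm1_fps_power_eq:
  obtains A where "\<And>m. coshm1_fps ^ m = fps_X ^ (2 * m) * A ^ m" "fps_nth A 0 = 1 / 2"
proof -
  define A :: "real fps" where "A = Abs_fps (\<lambda>c. if even c then 1 / fact (c + 2) else 0)"
  have *: "coshm1_fps = fps_X ^ 2 * A"
  proof (rule fps_ext)
    fix c
    consider "c = 0" | "c = 1" | d where "c = Suc (Suc d)"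
      by (metis One_nat_def not0_implies_Suc)
    then show "fps_nth coshm1_fps c = fps_nth (fps_X ^ 2 * A) c"
      by cases (auto simp: coshm1_fps_def A_def fps_X_power_mult_nth)
  qed
  have "coshm1_fps ^ m = fps_X ^ (2 * m) * A ^ m" for m
    by (simp add: * power_mult_distrib power_mult)
  then show ?thesis
    by (rule that) (simp add: A_def)
qed

lemma coshm1_fps_power_small: "b < 2 * m \<Longrightarrow> fps_nth (coshm1_fps ^ m) b = 0"
  by (rule coshm1_fps_power_eq) (simp add: fps_X_power_mult_nth)

text \<open>The lowest coefficient of the \<open>h\<close>-th power of \<open>u^2 / 2 + ...\<close>;
  it is the source of \<open>2^h\<close> in the denominator of the Gaussian moment.\<close>

lemma coshm1_fps_power_diag: "fps_nth (coshm1_fps ^ h) (2 * h) = 1 / 2 ^ h"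
proof (rule coshm1_fps_power_eq)
  fix A assume A: "\<And>m. coshm1_fps ^ m = fps_X ^ (2 * m) * A ^ m" and A0: "fps_nth A 0 = 1 / 2"
  have "fps_nth (coshm1_fps ^ h) (2 * h) = fps_nth A 0 ^ h"
    by (simp only: A fps_X_power_mult_nth) (simp add: fps_power_zeroth)
  then show ?thesis
    unfolding A0 by (simp only: power_one_over)
qed

text \<open>The \<open>b\<close>-th moment of a sum of \<open>n\<close> independent variables that vanish with probability
  \<open>\<delta>\<close> and otherwise are uniformly distributed signs.\<close>
definition sign_moment :: "real \<Rightarrow> nat \<Rightarrow> nat \<Rightarrow> real" where
  "sign_moment \<delta> n b = fact b * fps_nth ((1 + fps_const (1 - \<delta>) * coshm1_fps) ^ n) b"

text \<open>Binomial expansion in \<open>n\<close>. As \<open>(cosh u - 1)^m\<close> begins with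
  \<open>u^(2m)\<close>, only \<open>m \<le> b div 2\<close> matters, so the number of terms is
  independent of \<open>n\<close>.\<close>

lemma sign_moment_eq:
  "sign_moment \<delta> n b =
    (\<Sum>m\<le>b div 2. real (n choose m) * (1 - \<delta>) ^ m * (fact b * fps_nth (coshm1_fps ^ m) b))"
proof -
  define t where "t = (\<lambda>m. real (n choose m) * (1 - \<delta>) ^ m * (fact b * fps_nth (coshm1_fps ^ m) b))"
  have "(1 + fps_const (1 - \<delta>) * coshm1_fps) ^ n =
      (\<Sum>m\<le>n. fps_const (real (n choose m) * (1 - \<delta>) ^ m) * coshm1_fps ^ m)"
    by (subst add.commute, subst binomial_ring)
       (simp add: power_mult_distrib fps_of_nat fps_const_power mult.assoc flip: fps_const_mult)
  then have "sign_moment \<delta> n b = (\<Sum>m\<le>n. t m)"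
    by (simp add: sign_moment_def t_def fps_sum_nth sum_distrib_left mult_ac)
  also have "\<dots> = (\<Sum>m\<le>max n (b div 2). t m)"
    by (rule sum.mono_neutral_left) (auto simp: t_def)
  also have "\<dots> = (\<Sum>m\<le>b div 2. t m)"
    by (rule sum.mono_neutral_right) (auto simp: t_def coshm1_fps_power_small)
  finally show ?thesis
    by (simp add: t_def)
qed

lemma sign_moment_odd: "odd b \<Longrightarrow> sign_moment \<delta> n b = 0"
  by (simp add: sign_moment_eq coshm1_fps_power_odd)

text \<open>The \<open>b\<close>-th moment of a centred Gaussian variable of variance
  \<open>k\<close>.\<close>

definition gauss_moment :: "nat \<Rightarrow> nat \<Rightarrow> real" where
  "gauss_moment k b = (if even b then real k ^ (b div 2) * (fact b / (2 ^ (b div 2) * fact (b div 2))) else 0)"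

text \<open>The falling factorial. Truncated subtraction is harmless: for \<open>h > n\<close> the
  factor with \<open>i = n\<close> is \<open>0\<close>.\<close>

lemma binomial_eq_prod:
  "fact h * real (n choose h) = (\<Prod>i<h. real (n - i))"
proof (induction h)
  case (Suc h)
  have "Suc h * (n choose Suc h) = (n - h) * (n choose h)"
    by (metis binomial_absorb_comp binomial_absorption)
  then have "real (Suc h) * real (n choose Suc h) = real (n - h) * real (n choose h)"
    by (metis of_nat_mult)
  then have "fact (Suc h) * real (n choose Suc h) = (fact h * real (n choose h)) * real (n - h)"
    by (simp add: mult_ac)
  then show ?case
    using Suc by (simp add: mult_ac)
qed simp

lemma prod_near_one:
  fixes f :: "nat \<Rightarrow> real"
  assumes "\<And>i. i < h \<Longrightarrow> 0 \<le> f i" "\<And>i. i < h \<Longrightarrow> f i \<le> 1" "\<And>i. i < h \<Longrightarrow> 1 - f i \<le> e"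
  shows "\<bar>(\<Prod>i<h. f i) - 1\<bar> \<le> real h * e"
proof -
  have "norm ((\<Prod>i\<in>{..<h}. f i) - (\<Prod>i\<in>{..<h}. 1)) \<le> (\<Sum>i\<in>{..<h}. norm (f i - 1))"
    using assms by (intro norm_prod_diff) auto
  also have "\<dots> \<le> (\<Sum>i\<in>{..<h}. e)"
    using assms by (intro sum_mono) auto
  finally show ?thesis by simp
qed

text \<open>Here \<open>y\<close> plays the role of \<open>q\<^sup>k\<close>; the \<open>n\<close> orbits of size \<open>k\<close> cover all but \<open>(k + 1)\<epsilon>y\<close> of the
  \<open>y\<close> points.\<close>
lemma sign_moment_approx:
  "\<exists>C\<ge>0. \<forall>k n y \<epsilon>. k > 0 \<longrightarrow> y \<ge> 1 \<longrightarrow> real (k * n) \<le> y \<longrightarrow> 1 - real (k * n) / y \<le> (real k + 1) * \<epsilon> \<longrightarrow>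
     1 / y \<le> \<epsilon> \<longrightarrow>
     \<bar>(real k / sqrt y) ^ b * sign_moment (1 / y) n b - gauss_moment k b\<bar> \<le> C * (real k + 1) ^ (b + 1) * \<epsilon>"
proof (cases "even b")
  case False
  then show ?thesis
    by (intro exI[of _ 0]) (simp add: sign_moment_odd gauss_moment_def)
next
  case True
  then obtain h where b: "b = 2 * h" by blast
  define u where "u = (\<lambda>m. fact b * fps_nth (coshm1_fps ^ m) b)"
  have uh: "u h = fact b / 2 ^ h"
    by (simp add: u_def b coshm1_fps_power_diag)
  \<comment> \<open>The first sum pays for the terms with \<open>m < h\<close>, the second summand
    for the distance of the leading term \<open>m = h\<close> from the Gaussian moment.\<close>
  define C where "C = (\<Sum>m<h. \<bar>u m\<bar>) + u h * (real h * (real h + 2))"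
  have C: "C \<ge> 0"
    unfolding C_def uh by (intro add_nonneg_nonneg sum_nonneg) auto
  show ?thesis
  proof (intro exI[of _ C] conjI allI impI C)
    fix k n :: nat and y \<epsilon> :: real
    assume k: "k > 0" and y: "y \<ge> 1" and le: "real (k * n) \<le> y"
      and ge: "1 - real (k * n) / y \<le> (real k + 1) * \<epsilon>" and eps: "1 / y \<le> \<epsilon>"
    have eps0: "\<epsilon> > 0"
      using eps y by (smt (verit) divide_pos_pos)
    define c where "c = (real k / sqrt y) ^ b"
    have c: "c = real k ^ b / y ^ h"
      using y by (simp add: c_def b power_divide power_mult)
    have n_le: "real n \<le> y"
      using le k by (smt (verit) mult_le_cancel_right1 of_nat_0_le_iff of_nat_1 of_nat_mono of_nat_mult Suc_leI One_nat_def)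
    \<comment> \<open>The binomial coefficient is at most \<open>y^m\<close>, whereas
      \<open>c\<close> contains \<open>y^(-h)\<close>; every term below the leading one therefore
      loses a factor \<open>1 / y \<le> \<epsilon>\<close>.\<close>
    have small: "\<bar>c * (real (n choose m) * (1 - 1 / y) ^ m * u m)\<bar> \<le> (real k + 1) ^ (b + 1) * \<epsilon> * \<bar>u m\<bar>"
      if m: "m < h" for m
    proof -
      have "real (n choose m) \<le> fact m * real (n choose m)"
        using fact_ge_1[of m, where ?'a = real] by (intro mult_le_cancel_right1[THEN iffD2]) auto
      also have "\<dots> \<le> (\<Prod>i<m. real n)"
        unfolding binomial_eq_prod by (intro prod_mono) auto
      finally have "real (n choose m) \<le> real (n ^ m)"
        by simp
      also have "\<dots> \<le> y ^ m"
        using n_le by (simp add: power_mono)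
      finally have 1: "real (n choose m) \<le> y ^ m" .
      have 2: "(1 - 1 / y) ^ m \<le> 1" "0 \<le> (1 - 1 / y) ^ m"
        using y by (auto intro!: power_le_one)
      have "y ^ m * y \<le> y ^ h"
        using y m by (metis Suc_leI power_Suc2 power_increasing)
      then have 3: "y ^ m / y ^ h \<le> 1 / y"
        using y by (simp add: field_simps)
      have "c * (real (n choose m) * (1 - 1 / y) ^ m) \<le> c * (y ^ m * 1)"
        using 1 2 y by (intro mult_left_mono mult_mono) (auto simp: c)
      also have "\<dots> = real k ^ b * (y ^ m / y ^ h)"
        by (simp add: c)
      also have "\<dots> \<le> (real k + 1) ^ (b + 1) * \<epsilon>"
      proof (rule mult_mono)
        have "real k ^ b \<le> (real k + 1) ^ b"
          by (intro power_mono) auto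
        also have "\<dots> \<le> (real k + 1) ^ (b + 1)"
          by (intro power_increasing) auto
        finally show "real k ^ b \<le> (real k + 1) ^ (b + 1)" .
      qed (use 3 eps y in auto)
      finally have "c * (real (n choose m) * (1 - 1 / y) ^ m) \<le> (real k + 1) ^ (b + 1) * \<epsilon>" .
      moreover have "0 \<le> c * (real (n choose m) * (1 - 1 / y) ^ m)"
        using 2 y by (simp add: c)
      ultimately have "\<bar>c * (real (n choose m) * (1 - 1 / y) ^ m)\<bar> * \<bar>u m\<bar> \<le> (real k + 1) ^ (b + 1) * \<epsilon> * \<bar>u m\<bar>"
        by (intro mult_right_mono) auto
      then show ?thesis
        by (simp add: abs_mult mult_ac)
    qed
    \<comment> \<open>The leading term is the Gaussian moment times the product of the
      \<open>f i\<close>. Each \<open>f i\<close> falls short of \<open>1\<close> for three reasons: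
      orbits do not cover all points, \<open>i\<close> orbits are already taken, and the character
      can vanish.\<close>
    define f where "f = (\<lambda>i. real k * real (n - i) / y * (1 - 1 / y))"
    have f: "0 \<le> f i" "f i \<le> 1" "1 - f i \<le> (real h + 2) * (real k + 1) * \<epsilon>" if i: "i < h" for i
    proof -
      have d: "0 \<le> 1 - 1 / y" "1 - 1 / y \<le> 1"
        using y by auto
      have a: "0 \<le> real k * real (n - i) / y" "real k * real (n - i) / y \<le> 1"
      proof -
        have "real k * real (n - i) \<le> real (k * n)"
          by (simp add: mult_left_mono)
        then show "real k * real (n - i) / y \<le> 1"
          using le y by simp
      qed (use y in auto)
      show "0 \<le> f i"
        unfolding f_def by (rule mult_nonneg_nonneg[OF a(1) d(1)])
      show "f i \<le> 1"
        unfolding f_def by (rule mult_le_one[OF a(2) d])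
      have "1 - f i \<le> (1 - real k * real (n - i) / y) + 1 / y"
      proof -
        have "real k * real (n - i) / y * (1 / y) \<le> 1 * (1 / y)"
          using a y by (intro mult_right_mono) auto
        then show ?thesis
          unfolding f_def right_diff_distrib by simp
      qed
      also have "1 - real k * real (n - i) / y \<le> (1 - real (k * n) / y) + real k * real i / y"
      proof -
        have "real n - real i \<le> real (n - i)"
          by simp
        then have "real k * (real n - real i) / y \<le> real k * real (n - i) / y"
          using y by (intro divide_right_mono mult_left_mono) auto
        then show ?thesis
          by (simp add: algebra_simps diff_divide_distrib)
      qed
      also have "real k * real i / y \<le> real k * real h * \<epsilon>"
      proof -
        have "real k * real i * (1 / y) \<le> real k * real h * \<epsilon>"
          using i eps y by (intro mult_mono) auto
        then show ?thesis by simp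
      qed
      finally have "1 - f i \<le> (real k + 1) * \<epsilon> + real k * real h * \<epsilon> + \<epsilon>"
        using ge eps by linarith
      also have "\<dots> \<le> (real h + 2) * (real k + 1) * \<epsilon>"
        using eps0 by (simp add: algebra_simps)
      finally show "1 - f i \<le> (real h + 2) * (real k + 1) * \<epsilon>" .
    qed
    have "c * (real (n choose h) * (1 - 1 / y) ^ h) * fact h = real k ^ h * (\<Prod>i<h. f i)"
    proof -
      have kb: "real k ^ b = real k ^ h * real k ^ h"
        by (simp add: b mult_2 power_add)
      have "(\<Prod>i<h. f i) = (real k / y * (1 - 1 / y)) ^ h * (\<Prod>i<h. real (n - i))"
        unfolding f_def by (simp add: prod.distrib flip: times_divide_eq_left)
          (simp add: mult_ac power_mult_distrib prod_dividef power_divide prod.distrib)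
      then have "real k ^ h * (\<Prod>i<h. f i) = real k ^ h * (real k / y * (1 - 1 / y)) ^ h * (fact h * real (n choose h))"
        by (simp add: binomial_eq_prod)
      also have "\<dots> = c * (real (n choose h) * (1 - 1 / y) ^ h) * fact h"
        by (simp add: c kb power_mult_distrib power_divide mult_ac)
      finally show ?thesis by simp
    qed
    then have main: "c * (real (n choose h) * (1 - 1 / y) ^ h * u h) = gauss_moment k b * (\<Prod>i<h. f i)"
      by (simp add: gauss_moment_def b uh field_simps)
    have "\<bar>(\<Prod>i<h. f i) - 1\<bar> \<le> real h * ((real h + 2) * (real k + 1) * \<epsilon>)"
      by (rule prod_near_one) (use f in auto)
    then have "\<bar>gauss_moment k b * ((\<Prod>i<h. f i) - 1)\<bar> \<le>
        (real k ^ h * u h) * (real h * ((real h + 2) * (real k + 1) * \<epsilon>))"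
      unfolding abs_mult
    proof (intro mult_mono)
      have "\<bar>gauss_moment k b\<bar> = real k ^ h * u h / fact h"
        by (simp add: gauss_moment_def b uh)
      also have "\<dots> \<le> real k ^ h * u h / 1"
        using fact_ge_1[of h, where ?'a = real] by (intro divide_left_mono) (auto simp: uh)
      finally show "\<bar>gauss_moment k b\<bar> \<le> real k ^ h * u h"
        by simp
    qed (auto simp: uh)
    also have "\<dots> = (real k ^ h * (real k + 1)) * (u h * (real h * (real h + 2)) * \<epsilon>)"
      by (simp add: mult_ac)
    also have "\<dots> \<le> (real k + 1) ^ (b + 1) * (u h * (real h * (real h + 2)) * \<epsilon>)"
    proof (rule mult_right_mono)
      have "real k ^ h * (real k + 1) \<le> (real k + 1) ^ h * (real k + 1)"
        by (intro mult_right_mono power_mono) auto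
      also have "\<dots> = (real k + 1) ^ (h + 1)"
        by simp
      also have "\<dots> \<le> (real k + 1) ^ (b + 1)"
        by (intro power_increasing) (auto simp: b)
      finally show "real k ^ h * (real k + 1) \<le> (real k + 1) ^ (b + 1)" .
    qed (use eps0 in \<open>auto simp: uh\<close>)
    finally have big: "\<bar>c * (real (n choose h) * (1 - 1 / y) ^ h * u h) - gauss_moment k b\<bar> \<le>
        (real k + 1) ^ (b + 1) * (u h * (real h * (real h + 2)) * \<epsilon>)"
      unfolding main by (simp add: algebra_simps)
    have hb: "b div 2 = h"
      by (simp add: b)
    have "c * sign_moment (1 / y) n b =
        (\<Sum>m<h. c * (real (n choose m) * (1 - 1 / y) ^ m * u m)) + c * (real (n choose h) * (1 - 1 / y) ^ h * u h)"
      unfolding sign_moment_eq hb u_def sum_distrib_left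
      by (simp add: lessThan_Suc_atMost[symmetric])
    then have "\<bar>c * sign_moment (1 / y) n b - gauss_moment k b\<bar> \<le>
        (\<Sum>m<h. \<bar>c * (real (n choose m) * (1 - 1 / y) ^ m * u m)\<bar>) +
        \<bar>c * (real (n choose h) * (1 - 1 / y) ^ h * u h) - gauss_moment k b\<bar>"
      using sum_abs[of "\<lambda>m. c * (real (n choose m) * (1 - 1 / y) ^ m * u m)" "{..<h}"] by linarith
    also have "\<dots> \<le> (\<Sum>m<h. (real k + 1) ^ (b + 1) * \<epsilon> * \<bar>u m\<bar>) +
        (real k + 1) ^ (b + 1) * (u h * (real h * (real h + 2)) * \<epsilon>)"
      using small big by (intro add_mono sum_mono) auto
    also have "\<dots> = C * (real k + 1) ^ (b + 1) * \<epsilon>"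
      unfolding sum_distrib_left[symmetric] C_def distrib_left distrib_right by (simp add: mult_ac)
    finally show "\<bar>(real k / sqrt y) ^ b * sign_moment (1 / y) n b - gauss_moment k b\<bar> \<le> C * (real k + 1) ^ (b + 1) * \<epsilon>"
      by (simp add: c_def)
  qed
qed

section \<open>Square parts of polynomials\<close>

text \<open>The greatest common divisor is a monic nonzero element of least degree in the ideal
  generated by \<open>a\<close> and \<open>b\<close>; division with remainder shows that it divides
  both.\<close>

lemma poly_bezout:
  fixes a b :: "'a :: field Polynomial.poly"
  assumes "a \<noteq> 0"
  obtains d u v a' b' where "d = u * a + v * b" "a = d * a'" "b = d * b'" "Polynomial.lead_coeff d = 1"
proof -
  define I where "I = {u * a + v * b | u v. True}"
  have I_add: "x + y \<in> I" if xy: "x \<in> I" "y \<in> I" for x y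
  proof -
    obtain u v u' v' where "x = u * a + v * b" "y = u' * a + v' * b"
      using xy by (auto simp: I_def)
    then have "x + y = (u + u') * a + (v + v') * b"
      by (simp add: algebra_simps)
    then show ?thesis
      by (auto simp: I_def)
  qed
  have I_mult: "w * x \<in> I" if x: "x \<in> I" for w x
  proof -
    obtain u v where "x = u * a + v * b"
      using x by (auto simp: I_def)
    then have "w * x = (w * u) * a + (w * v) * b"
      by (simp add: algebra_simps)
    then show ?thesis
      by (auto simp: I_def)
  qed
  have aI: "a \<in> I"
  proof -
    have "a = 1 * a + 0 * b" by simp
    then show ?thesis unfolding I_def by blast
  qed
  have bI: "b \<in> I"
  proof -
    have "b = 0 * a + 1 * b" by simp
    then show ?thesis unfolding I_def by blast
  qed
  obtain d0 where d0: "d0 \<in> I" "d0 \<noteq> 0" "\<And>e. e \<in> I \<Longrightarrow> e \<noteq> 0 \<Longrightarrow> Polynomial.degree d0 \<le> Polynomial.degree e"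
    using ex_has_least_nat[of "\<lambda>x. x \<in> I \<and> x \<noteq> 0" a Polynomial.degree] aI assms by blast
  define d where "d = [:inverse (Polynomial.lead_coeff d0):] * d0"
  have d: "d \<in> I" "Polynomial.degree d = Polynomial.degree d0" "Polynomial.lead_coeff d = 1" "d \<noteq> 0"
    using d0(2) I_mult[OF d0(1), of "[:inverse (Polynomial.lead_coeff d0):]"]
    unfolding d_def by (auto simp: lead_coeff_smult)
  have div: "\<exists>e'. e = d * e'" if "e \<in> I" for e
  proof -
    have "e mod d = e + (- (e div d)) * d"
      by (simp add: minus_div_mult_eq_mod[symmetric])
    then have "e mod d \<in> I"
      using I_add[OF that I_mult[OF d(1)]] by metis
    then have "e mod d = 0"
      using d0(3)[of "e mod d"] degree_mod_less[of d e] d by fastforce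
    then show ?thesis
      by (metis dvd_def mod_eq_0_iff_dvd)
  qed
  obtain u v where "d = u * a + v * b"
    using d(1) by (auto simp: I_def)
  moreover obtain a' where "a = d * a'"
    using div[OF aI] by blast
  moreover obtain b' where "b = d * b'"
    using div[OF bI] by blast
  ultimately show ?thesis
    using that d(3) by blast
qed

text \<open>After division by the common divisor \<open>d\<close>, the cofactors \<open>a'\<close>
  and \<open>b'\<close> are coprime. Hence \<open>b' ^ 2\<close> divides \<open>Q\<close> and
  \<open>a' ^ 2\<close> divides \<open>R\<close>, so both are units, and being monic they are
  \<open>1\<close>.\<close>

lemma square_times_squarefree_unique:
  fixes a b Q R :: "'a :: field Polynomial.poly"
  assumes eq: "a ^ 2 * Q = b ^ 2 * R" and sf: "squarefree Q" "squarefree R"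
    and monic: "Polynomial.lead_coeff a = 1" "Polynomial.lead_coeff b = 1"
  shows "a = b"
proof -
  have nz: "a \<noteq> 0" "b \<noteq> 0"
    using monic by auto
  obtain d u v a' b' where d: "d = u * a + v * b" "a = d * a'" "b = d * b'" "Polynomial.lead_coeff d = 1"
    using poly_bezout[OF nz(1), of b] by blast
  have d0: "d \<noteq> 0"
    using d(4) by auto
  have "d * (u * a' + v * b') = d * 1"
    using d by (metis (no_types, lifting) distrib_left mult.left_commute mult.right_neutral)
  then have bez: "u * a' + v * b' = 1"
    using d0 by (metis mult_left_cancel)
  have "d ^ 2 * (a' ^ 2 * Q) = d ^ 2 * (b' ^ 2 * R)"
    using eq unfolding d(2) d(3) by (simp only: power_mult_distrib mult.assoc)
  then have eq': "a' ^ 2 * Q = b' ^ 2 * R"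
    using d0 by simp
  \<comment> \<open>The cube of the Bezout relation is used because each term in the expansion of
    \<open>(w * x + z * y) ^ 3\<close> contains \<open>x ^ 2\<close> or
    \<open>y ^ 2\<close>.\<close>
  have dvd: "y ^ 2 dvd P" if "w * x + z * y = 1" "y ^ 2 dvd x ^ 2 * P" for w x y z P :: "'a Polynomial.poly"
  proof -
    have "P = (w * x + z * y) ^ 3 * P"
      by (simp add: that)
    also have "\<dots> = (x ^ 2 * P) * (w ^ 3 * x + 3 * w ^ 2 * z * y) + y ^ 2 * ((3 * w * x * z ^ 2 + z ^ 3 * y) * P)"
      by (simp add: power3_eq_cube power2_eq_square distrib_left distrib_right mult_ac add_ac)
    finally show ?thesis
      using that(2) by (metis dvd_add dvd_mult2 dvd_triv_left)
  qed
  have "b' ^ 2 dvd a' ^ 2 * Q"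
    unfolding eq' by simp
  then have "b' ^ 2 dvd Q"
    by (rule dvd[OF bez])
  then have ub: "is_unit b'"
    using sf(1) by (simp add: squarefree_def)
  have "a' ^ 2 dvd b' ^ 2 * R"
    unfolding eq'[symmetric] by simp
  moreover have "v * b' + u * a' = 1"
    unfolding bez[symmetric] by (rule add.commute)
  ultimately have "a' ^ 2 dvd R"
    using dvd by blast
  then have ua: "is_unit a'"
    using sf(2) by (simp add: squarefree_def)
  have "Polynomial.lead_coeff d * Polynomial.lead_coeff a' = 1" 
    "Polynomial.lead_coeff d * Polynomial.lead_coeff b' = 1"
    using monic unfolding d(2,3) lead_coeff_mult by auto
  then have lc: "Polynomial.lead_coeff a' = 1" "Polynomial.lead_coeff b' = 1"
    unfolding d(4) by auto
  have unit_eq_1: "e = 1" if e: "is_unit e" "Polynomial.lead_coeff e = 1" for e :: "'a Polynomial.poly"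
  proof -
    obtain c where "e = [:c:]"
      using e(1) unfolding is_unit_poly_iff by blast
    with e(2) show ?thesis
      by simp
  qed
  show ?thesis
    unfolding d(2,3) unit_eq_1[OF ua lc(1)] unit_eq_1[OF ub lc(2)] ..
qed

lemma square_times_squarefree_exists:
  fixes M :: "'a :: field Polynomial.poly"
  assumes "Polynomial.lead_coeff M = 1"
  shows "\<exists>a Q. M = a ^ 2 * Q \<and> squarefree Q \<and> Polynomial.lead_coeff a = 1 \<and> Polynomial.lead_coeff Q = 1"
  using assms
proof (induction "Polynomial.degree M" arbitrary: M rule: less_induct)
  case less
  show ?case
  proof (cases "squarefree M")
    case True
    then show ?thesis
      using less.prems by (intro exI[of _ 1] exI[of _ M]) auto
  next
    case False
    then obtain c where c: "c ^ 2 dvd M" "\<not> is_unit c"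
      by (auto simp: squarefree_def)
    then obtain N where N: "M = c ^ 2 * N"
      by blast
    have "M \<noteq> 0"
      using less.prems by auto
    then have nz: "c \<noteq> 0" "N \<noteq> 0"
      using N by auto
    define l where "l = Polynomial.lead_coeff c"
    have l: "l \<noteq> 0"
      using nz by (simp add: l_def)
    \<comment> \<open>The leading coefficient of \<open>c\<close> is moved into the cofactor, so
      that both factors are monic and the induction hypothesis applies.\<close>
    define c' where "c' = Polynomial.smult (inverse l) c"
    define N' where "N' = Polynomial.smult (l ^ 2) N"
    have M': "M = c' ^ 2 * N'"
      using l by (simp add: N c'_def N'_def smult_power power_inverse)
    have lc': "Polynomial.lead_coeff c' = 1"
      using l by (simp add: c'_def l_def)
    have lN': "Polynomial.lead_coeff N' = 1"
      using less.prems lc' unfolding M' by (simp add: lead_coeff_mult lead_coeff_power)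
    have "Polynomial.degree c > 0"
      using c(2) nz by (metis gr0I is_unit_iff_degree)
    then have "Polynomial.degree N' < Polynomial.degree M"
      using nz l by (simp add: N N'_def degree_mult_eq degree_power_eq)
    from less.hyps[OF this lN'] obtain a Q where
      aQ: "N' = a ^ 2 * Q" "squarefree Q" "Polynomial.lead_coeff a = 1" "Polynomial.lead_coeff Q = 1"
      by blast
    have "M = (c' * a) ^ 2 * Q"
      by (simp add: M' aQ power_mult_distrib mult.assoc)
    moreover have "Polynomial.lead_coeff (c' * a) = 1"
      using lc' aQ by (simp add: lead_coeff_mult)
    ultimately show ?thesis
      using aQ by blast
  qed
qed

definition sqfree_polys :: "nat \<Rightarrow> 'a :: field Polynomial.poly set" where
  "sqfree_polys N = {Q \<in> monic_polys N. squarefree Q}"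

lemma hyp_ensemble_eq: "hyp_ensemble g = sqfree_polys (2 * g + 1)"
  by (auto simp: hyp_ensemble_def sqfree_polys_def monic_polys_def)

lemma finite_sqfree_polys [simp]: "finite (sqfree_polys N :: 'a :: {finite, field} Polynomial.poly set)"
  unfolding sqfree_polys_def using finite_card_monic_polys(1)[where ?'a = 'a] by simp

lemma sum_monic_polys_square_decomp:
  fixes F :: "'a :: {finite, field} Polynomial.poly \<Rightarrow> real"
  shows "(\<Sum>M\<in>monic_polys N. F M) =
    (\<Sum>l\<le>N div 2. \<Sum>a\<in>monic_polys l. \<Sum>Q\<in>sqfree_polys (N - 2 * l). F (a ^ 2 * Q))"
proof -
  define I where "I = (SIGMA l:{..N div 2}. (monic_polys l :: 'a Polynomial.poly set) \<times> (sqfree_polys (N - 2 * l) :: 'a Polynomial.poly set))"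
  have deg: "Polynomial.degree (a ^ 2 * Q) = 2 * Polynomial.degree a + Polynomial.degree Q"
    "Polynomial.lead_coeff (a ^ 2 * Q) = 1"
    if "Polynomial.lead_coeff a = 1" "Polynomial.lead_coeff Q = 1" for a Q :: "'a Polynomial.poly"
  proof -
    have "a \<noteq> 0" "Q \<noteq> 0"
      using that by auto
    then show "Polynomial.degree (a ^ 2 * Q) = 2 * Polynomial.degree a + Polynomial.degree Q"
      by (simp add: degree_mult_eq degree_power_eq)
    show "Polynomial.lead_coeff (a ^ 2 * Q) = 1"
      using that by (simp add: lead_coeff_mult lead_coeff_power)
  qed
  have "bij_betw (\<lambda>(l, a, Q). a ^ 2 * Q) I (monic_polys N)"
  proof (rule bij_betwI')
    fix x y assume x: "x \<in> I" and y: "y \<in> I"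
    obtain l a Q where xx: "x = (l, a, Q)" by (cases x)
    obtain l' a' Q' where yy: "y = (l', a', Q')" by (cases y)
    have a: "Polynomial.lead_coeff a = 1" "Polynomial.lead_coeff a' = 1" "squarefree Q" "squarefree Q'"
      "l = Polynomial.degree a" "l' = Polynomial.degree a'"
      using x y by (auto simp: xx yy I_def monic_polys_def sqfree_polys_def)
    have "x = y" if *: "a ^ 2 * Q = a' ^ 2 * Q'"
    proof -
      have "a = a'"
        using square_times_squarefree_unique[OF * a(3,4,1,2)] .
      moreover have "a \<noteq> 0"
        using a(1) by auto
      ultimately show ?thesis
        using * a by (simp add: xx yy)
    qed
    then show "((case x of (l, a, Q) \<Rightarrow> a ^ 2 * Q) = (case y of (l, a, Q) \<Rightarrow> a ^ 2 * Q)) = (x = y)"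
      by (auto simp: xx yy)
  next
    fix x assume x: "x \<in> I"
    obtain l a Q where xx: "x = (l, a, Q)" by (cases x)
    show "(case x of (l, a, Q) \<Rightarrow> a ^ 2 * Q) \<in> monic_polys N"
      using x deg[of a Q] by (auto simp: xx I_def monic_polys_def sqfree_polys_def)
  next
    fix M :: "'a Polynomial.poly" assume M: "M \<in> monic_polys N"
    then obtain a Q where aQ: "M = a ^ 2 * Q" "squarefree Q" "Polynomial.lead_coeff a = 1" "Polynomial.lead_coeff Q = 1"
      using square_times_squarefree_exists[of M] by (auto simp: monic_polys_def)
    have "N = 2 * Polynomial.degree a + Polynomial.degree Q"
      using M deg[OF aQ(3,4)] by (simp add: monic_polys_def aQ(1))
    then have "(Polynomial.degree a, a, Q) \<in> I"
      using aQ by (auto simp: I_def monic_polys_def sqfree_polys_def)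
    then show "\<exists>x\<in>I. M = (case x of (l, a, Q) \<Rightarrow> a ^ 2 * Q)"
      using aQ(1) by (intro bexI[of _ "(Polynomial.degree a, a, Q)"]) auto
  qed
  then have "(\<Sum>M\<in>monic_polys N. F M) = (\<Sum>x\<in>I. F (case x of (l, a, Q) \<Rightarrow> a ^ 2 * Q))"
    by (rule sum.reindex_bij_betw[symmetric])
  also have "\<dots> = (\<Sum>l\<le>N div 2. \<Sum>x\<in>monic_polys l \<times> sqfree_polys (N - 2 * l). F (case (l, x) of (l, a, Q) \<Rightarrow> a ^ 2 * Q))"
    unfolding I_def using finite_card_monic_polys(1)[where ?'a = 'a]
    by (subst sum.Sigma) (auto simp: split_def)
  also have "\<dots> = (\<Sum>l\<le>N div 2. \<Sum>a\<in>monic_polys l. \<Sum>Q\<in>sqfree_polys (N - 2 * l). F (a ^ 2 * Q))"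
    by (intro sum.cong refl) (simp add: sum.cartesian_product split_def)
  finally show ?thesis .
qed

section \<open>Moments over all monic polynomials\<close>

lemma prim_elems_disjoint:
  assumes "x \<in> prim_elems k" "x \<in> prim_elems l" "k > 0" "l > 0"
  shows "k = l"
  using assms by (auto simp: prim_elems_def dest: leI intro!: antisym)

lemma sum_prim_elems_representatives:
  fixes R :: "'a :: {finite, field} alg_closure set"
  assumes k: "k > 0" and R: "R \<subseteq> prim_elems k"
    and bij: "bij_betw (\<lambda>(x, i). x ^ (CARD('a) ^ i)) (R \<times> {..<k}) (prim_elems k)"
  shows "(\<Sum>x\<in>prim_elems k. quad_char k (ac_eval B x)) = real k * (\<Sum>x\<in>R. quad_char k (ac_eval B x))"
    and "card (prim_elems k :: 'a alg_closure set) = k * card R"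
proof -
  have "(\<Sum>x\<in>prim_elems k. quad_char k (ac_eval B x)) =
      (\<Sum>p\<in>R \<times> {..<k}. quad_char k (ac_eval B (case p of (x, i) \<Rightarrow> x ^ (CARD('a) ^ i))))"
    by (rule sum.reindex_bij_betw[OF bij, symmetric])
  also have "\<dots> = (\<Sum>x\<in>R. \<Sum>i<k. quad_char k (ac_eval B (x ^ (CARD('a) ^ i))))"
    by (simp add: sum.cartesian_product split_def)
  also have "\<dots> = (\<Sum>x\<in>R. \<Sum>i<k. quad_char k (ac_eval B x))"
  proof (intro sum.cong refl)
    fix x i assume "x \<in> R"
    then have "x \<in> ext_field k"
      using R prim_elems_subset by blast
    then show "quad_char k (ac_eval B (x ^ (CARD('a) ^ i))) = quad_char k (ac_eval B x)"
      unfolding ac_eval_frobenius by (intro quad_char_frobenius[OF k] ac_eval_in_ext_field)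
  qed
  finally show "(\<Sum>x\<in>prim_elems k. quad_char k (ac_eval B x)) = real k * (\<Sum>x\<in>R. quad_char k (ac_eval B x))"
    by (simp add: sum_distrib_left)
  show "card (prim_elems k :: 'a alg_closure set) = k * card R"
    using bij_betw_same_card[OF bij] by (simp add: card_cartesian_product mult.commute)
qed

text \<open>The \<open>b\<close>-th moment of \<open>T_k\<close> under the model in which the orbits
  of degree \<open>k\<close> carry independent values. The type argument only conveys
  \<open>q\<close>.\<close>

definition prim_moment :: "'a :: {finite, field} itself \<Rightarrow> nat \<Rightarrow> nat \<Rightarrow> real" where
  "prim_moment t k b = (real k / sqrt (real CARD('a) ^ k)) ^ b *
     sign_moment (1 / real CARD('a) ^ k) (card (prim_elems k :: 'a alg_closure set) div k) b"

context
  assumes odd_q: "odd CARD('a :: {finite, field})"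
begin

text \<open>The exponential generating function of the left-hand side is that of a sum of
  independent copies of \<open>quad_char k z\<close>, with \<open>z\<close> uniform in the field of order \<open>q\<^sup>k\<close>.\<close>
lemma sum_PiE_char_moment:
  fixes R :: "'b set"
  assumes R: "finite R" and k: "k > 0"
  shows "(\<Sum>h\<in>{..<b} \<rightarrow>\<^sub>E R. \<Prod>x\<in>R. char_moment (real CARD('a) ^ k) (card {i \<in> {..<b}. h i = x})) =
    sign_moment (1 / real CARD('a) ^ k) (card R) b"
proof -
  define K :: "'a alg_closure set" where "K = ext_field k"
  define y where "y = real CARD('a) ^ k"
  define c where "c = (\<lambda>(h :: nat \<Rightarrow> 'b) x. card {i \<in> {..<b}. h i = x})"
  have fin: "finite K" "card K = CARD('a) ^ k"
    unfolding K_def by (rule finite_card_ext_field[OF k])+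
  have cm: "char_moment y m = (\<Sum>z\<in>K. quad_char k z ^ m / y)" for m
    unfolding K_def y_def using avg_quad_char_power[OF odd_q k, of m] by (simp add: sum_divide_distrib)
  have E: "(\<Sum>z\<in>K. fps_const (1 / y) * fps_exp (quad_char k z)) = 1 + fps_const (1 - 1 / y) * coshm1_fps"
  proof (rule fps_ext)
    fix m
    have "fps_nth (\<Sum>z\<in>K. fps_const (1 / y) * fps_exp (quad_char k z)) m = char_moment y m / fact m"
      unfolding cm by (simp add: fps_sum_nth sum_divide_distrib mult.commute)
    then show "fps_nth (\<Sum>z\<in>K. fps_const (1 / y) * fps_exp (quad_char k z)) m =
        fps_nth (1 + fps_const (1 - 1 / y) * coshm1_fps) m"
      by (auto simp: char_moment_def coshm1_fps_def odd_pos)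
  qed
  \<comment> \<open>With each \<open>char_moment\<close> written as an average over
    \<open>K\<close>, exchanging the sums reassembles the \<open>b\<close>-th power of a sum over
    \<open>R\<close>, averaged over all assignments \<open>u\<close> of points of
    \<open>K\<close>.\<close>
  have "(\<Sum>h\<in>{..<b} \<rightarrow>\<^sub>E R. \<Prod>x\<in>R. char_moment y (c h x)) =
      (\<Sum>h\<in>{..<b} \<rightarrow>\<^sub>E R. \<Sum>u\<in>R \<rightarrow>\<^sub>E K. \<Prod>x\<in>R. quad_char k (u x) ^ c h x / y)"
    unfolding cm using R fin by (intro sum.cong refl prod_sum_PiE) auto
  also have "\<dots> = (\<Sum>u\<in>R \<rightarrow>\<^sub>E K. \<Sum>h\<in>{..<b} \<rightarrow>\<^sub>E R. \<Prod>x\<in>R. quad_char k (u x) ^ c h x / y)"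
    by (rule sum.swap)
  also have "\<dots> = (\<Sum>u\<in>R \<rightarrow>\<^sub>E K. (1 / y) ^ card R * (\<Sum>x\<in>R. quad_char k (u x)) ^ b)"
    unfolding sum_power_eq_sum_PiE[OF R] c_def sum_distrib_left
    by (intro sum.cong refl) (simp add: prod_dividef power_one_over field_simps)
  also have "\<dots> = (\<Sum>u\<in>R \<rightarrow>\<^sub>E K. fact b * fps_nth (\<Prod>x\<in>R. fps_const (1 / y) * fps_exp (quad_char k (u x))) b)"
  proof (rule sum.cong[OF refl])
    fix u
    have "(\<Prod>x\<in>R. fps_const (1 / y) * fps_exp (quad_char k (u x))) = 
        fps_const ((1 / y) ^ card R) * fps_exp (\<Sum>x\<in>R. quad_char k (u x))"
      by (simp add: prod.distrib fps_exp_sum fps_const_power)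
    then show "(1 / y) ^ card R * (\<Sum>x\<in>R. quad_char k (u x)) ^ b =
        fact b * fps_nth (\<Prod>x\<in>R. fps_const (1 / y) * fps_exp (quad_char k (u x))) b"
      by (simp only:) simp
  qed
  also have "\<dots> = fact b * fps_nth (\<Sum>u\<in>R \<rightarrow>\<^sub>E K. \<Prod>x\<in>R. fps_const (1 / y) * fps_exp (quad_char k (u x))) b"
    by (simp add: fps_sum_nth sum_distrib_left)
  also have "(\<Sum>u\<in>R \<rightarrow>\<^sub>E K. \<Prod>x\<in>R. fps_const (1 / y) * fps_exp (quad_char k (u x))) =
      (\<Prod>x\<in>R. \<Sum>z\<in>K. fps_const (1 / y) * fps_exp (quad_char k z))"
    using R fin by (intro prod_sum_PiE[symmetric]) auto
  finally show ?thesis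
    unfolding E prod_constant unfolding sign_moment_def y_def c_def .
qed

text \<open>A single term in the expansion of the moments. Although \<open>R j\<close> contains
  about \<open>q^(kk j) / kk j\<close> points, the tuple \<open>H j\<close> meets at most
  \<open>b j\<close> of them, so the relevant orbits have total degree at most \<open>N\<close> and
  the values there are independent.\<close>

lemma sum_monic_polys_tuples:
  fixes R :: "'i \<Rightarrow> 'a alg_closure set"
  assumes J: "finite J" "inj_on kk J" "\<And>j. j \<in> J \<Longrightarrow> kk j > 0"
    and R: "\<And>j. j \<in> J \<Longrightarrow> R j \<subseteq> prim_elems (kk j)"
      "\<And>j x y. j \<in> J \<Longrightarrow> x \<in> R j \<Longrightarrow> y \<in> R j \<Longrightarrow> y \<in> frob_orbit x \<Longrightarrow> x = y"
    and le: "(\<Sum>j\<in>J. b j * kk j) \<le> N"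
    and H: "H \<in> (\<Pi>\<^sub>E j\<in>J. {..<b j} \<rightarrow>\<^sub>E R j)"
  shows "(\<Sum>B\<in>monic_polys N. \<Prod>j\<in>J. \<Prod>x\<in>R j. quad_char (kk j) (ac_eval B x) ^ card {i \<in> {..<b j}. H j i = x}) =
    real CARD('a) ^ N * (\<Prod>j\<in>J. \<Prod>x\<in>R j. char_moment (real CARD('a) ^ kk j) (card {i \<in> {..<b j}. H j i = x}))"
proof -
  define cnt where "cnt = (\<lambda>j x. card {i \<in> {..<b j}. H j i = x})"
  define c where "c = (\<lambda>x. \<Sum>j\<in>J. cnt j x)"
  define dg where "dg = (\<lambda>x :: 'a alg_closure. THE d. d > 0 \<and> x \<in> prim_elems d)"
  define U where "U = (\<lambda>j. H j ` {..<b j})"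
  define S where "S = (\<Union>j\<in>J. U j)"
  have U: "U j \<subseteq> R j" "finite (U j)" if "j \<in> J" for j
    using H that by (auto simp: U_def PiE_iff)
  have finR: "finite (R j)" if "j \<in> J" for j
    using finite_subset[OF R(1) finite_prim_elems[OF J(3)]] that by blast
  have dg: "dg x = kk j" if "x \<in> R j" "j \<in> J" for x j
    unfolding dg_def using prim_elems_disjoint R(1)[of j] J(3)[of j] that by (intro the_equality) auto
  have R_eq: "j = j'" if "x \<in> R j" "x \<in> R j'" "j \<in> J" "j' \<in> J" for x j j'
    using dg[OF that(1,3)] dg[OF that(2,4)] J(2) that by (auto dest: inj_onD)
  have cnt_0: "cnt j x = 0" if "x \<notin> U j" for x j
    using that by (auto simp: cnt_def U_def)
  have c: "c x = cnt j x" if "x \<in> R j" "j \<in> J" for x j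
  proof -
    have "cnt i x = 0" if "i \<in> J - {j}" for i
      using that \<open>x \<in> R j\<close> \<open>j \<in> J\<close> R_eq[of x i j] U(1)[of i] by (intro cnt_0) auto
    then have "c x = (\<Sum>j\<in>{j}. cnt j x)"
      unfolding c_def using \<open>j \<in> J\<close> J(1) by (intro sum.mono_neutral_right) auto
    then show ?thesis by simp
  qed
  have disj: "\<forall>i\<in>J. \<forall>j\<in>J. i \<noteq> j \<longrightarrow> U i \<inter> U j = {}"
    using U R_eq by blast
  \<comment> \<open>One rearrangement for both sides of the claim: points that are not hit have
    exponent \<open>0\<close> and contribute \<open>1\<close>, and distinct degrees make the sets
    \<open>U j\<close> disjoint, so the double product becomes a product over
    \<open>S\<close>.\<close>
  have key: "(\<Prod>j\<in>J. \<Prod>x\<in>R j. \<phi> x (kk j) (cnt j x)) = (\<Prod>x\<in>S. \<phi> x (dg x) (c x))"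
    if \<phi>: "\<And>x d. \<phi> x d 0 = (1 :: real)" for \<phi>
  proof -
    have "(\<Prod>j\<in>J. \<Prod>x\<in>R j. \<phi> x (kk j) (cnt j x)) = (\<Prod>j\<in>J. \<Prod>x\<in>U j. \<phi> x (dg x) (c x))"
    proof (rule prod.cong[OF refl])
      fix j assume j: "j \<in> J"
      have "(\<Prod>x\<in>R j. \<phi> x (kk j) (cnt j x)) = (\<Prod>x\<in>U j. \<phi> x (kk j) (cnt j x))"
        using U[OF j] finR[OF j] by (intro prod.mono_neutral_right) (auto simp: cnt_0 \<phi>)
      also have "\<dots> = (\<Prod>x\<in>U j. \<phi> x (dg x) (c x))"
        using U[OF j] dg[OF _ j] c[OF _ j] by (intro prod.cong refl) auto
      finally show "(\<Prod>x\<in>R j. \<phi> x (kk j) (cnt j x)) = (\<Prod>x\<in>U j. \<phi> x (dg x) (c x))" .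
    qed
    also have "\<dots> = (\<Prod>x\<in>S. \<phi> x (dg x) (c x))"
      unfolding S_def using J(1) U disj by (intro prod.UNION_disjoint[symmetric]) auto
    finally show ?thesis .
  qed
  have S: "finite S" "\<exists>j\<in>J. x \<in> R j" if "x \<in> S" for x
    using that U J(1) by (auto simp: S_def)
  have finS: "finite S"
    unfolding S_def using U J(1) by auto
  have "(\<Sum>x\<in>S. dg x) = (\<Sum>j\<in>J. \<Sum>x\<in>U j. dg x)"
    unfolding S_def using J(1) U disj by (intro sum.UNION_disjoint) auto
  also have "\<dots> \<le> (\<Sum>j\<in>J. b j * kk j)"
  proof (rule sum_mono)
    fix j assume j: "j \<in> J"
    have "(\<Sum>x\<in>U j. dg x) = (\<Sum>x\<in>U j. kk j)"
      using U[OF j] dg[OF _ j] by (intro sum.cong refl) auto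
    also have "\<dots> \<le> b j * kk j"
      using card_image_le[of "{..<b j}" "H j"] by (simp add: U_def)
    finally show "(\<Sum>x\<in>U j. dg x) \<le> b j * kk j" .
  qed
  finally have le': "(\<Sum>x\<in>S. dg x) \<le> N"
    using le by simp
  have prim: "x \<in> prim_elems (dg x)" "dg x > 0" if "x \<in> S" for x
    using S(2)[OF that] R(1) dg J(3) by (auto simp: subset_iff)
  have nc: "x = y" if xy: "x \<in> S" "y \<in> S" "y \<in> frob_orbit x" for x y
  proof -
    obtain j where j: "j \<in> J" "x \<in> R j"
      using S(2)[OF xy(1)] by blast
    obtain j' where j': "j' \<in> J" "y \<in> R j'"
      using S(2)[OF xy(2)] by blast
    have "y \<in> prim_elems (kk j)"
      using xy(3) R(1)[OF j(1)] j(2) by (auto simp: frob_orbit_def prim_elems_frobenius)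
    then have "kk j = kk j'"
      by (rule prim_elems_disjoint[OF _ _ J(3)[OF j(1)] J(3)[OF j'(1)]]) (rule subsetD[OF R(1)[OF j'(1)] j'(2)])
    then have "j = j'"
      using J(2) j j' by (auto dest: inj_onD)
    then show ?thesis
      using R(2) j j' xy(3) by blast
  qed
  have "(\<Sum>B\<in>monic_polys N. \<Prod>j\<in>J. \<Prod>x\<in>R j. quad_char (kk j) (ac_eval B x) ^ cnt j x) =
      (\<Sum>B\<in>monic_polys N. \<Prod>x\<in>S. quad_char (dg x) (ac_eval B x) ^ c x)"
  proof (rule sum.cong[OF refl])
    fix B :: "'a Polynomial.poly"
    show "(\<Prod>j\<in>J. \<Prod>x\<in>R j. quad_char (kk j) (ac_eval B x) ^ cnt j x) =
        (\<Prod>x\<in>S. quad_char (dg x) (ac_eval B x) ^ c x)"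
      by (rule key[where \<phi> = "\<lambda>x d c. quad_char d (ac_eval B x) ^ c"]) simp
  qed
  also have "\<dots> = real CARD('a) ^ N * (\<Prod>x\<in>S. char_moment (real CARD('a) ^ dg x) (c x))"
    by (rule sum_monic_polys_quad_char[OF odd_q finS prim nc le'])
  also have "(\<Prod>x\<in>S. char_moment (real CARD('a) ^ dg x) (c x)) =
      (\<Prod>j\<in>J. \<Prod>x\<in>R j. char_moment (real CARD('a) ^ kk j) (cnt j x))"
    by (rule key[where \<phi> = "\<lambda>x d c. char_moment (real CARD('a) ^ d) c", symmetric]) (simp add: char_moment_def)
  finally show ?thesis
    by (simp add: cnt_def)
qed

lemma sum_monic_polys_prod_prim_sum:
  assumes J: "finite J" "inj_on kk J" "\<And>j. j \<in> J \<Longrightarrow> kk j > 0"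
    and le: "(\<Sum>j\<in>J. b j * kk j) \<le> N"
  shows "(\<Sum>B\<in>monic_polys N. \<Prod>j\<in>J. prim_sum (kk j) (B :: 'a Polynomial.poly) ^ b j) =
      real CARD('a) ^ N * (\<Prod>j\<in>J. prim_moment TYPE('a) (kk j) (b j))"
proof -
  have "\<forall>j\<in>J. \<exists>R :: 'a alg_closure set. R \<subseteq> prim_elems (kk j) \<and>
      bij_betw (\<lambda>(x, i). x ^ (CARD('a) ^ i)) (R \<times> {..<kk j}) (prim_elems (kk j)) \<and>
      (\<forall>x\<in>R. \<forall>y\<in>R. y \<in> frob_orbit x \<longrightarrow> x = y)"
    using orbit_representatives J(3) by metis
  then obtain R :: "_ \<Rightarrow> 'a alg_closure set" where R: "\<And>j. j \<in> J \<Longrightarrow> R j \<subseteq> prim_elems (kk j)"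
    "\<And>j. j \<in> J \<Longrightarrow> bij_betw (\<lambda>(x, i). x ^ (CARD('a) ^ i)) (R j \<times> {..<kk j}) (prim_elems (kk j))"
    "\<And>j x y. j \<in> J \<Longrightarrow> x \<in> R j \<Longrightarrow> y \<in> R j \<Longrightarrow> y \<in> frob_orbit x \<Longrightarrow> x = y"
    by (metis bchoice)
  have finR: "finite (R j)" if "j \<in> J" for j
    using finite_subset[OF R(1) finite_prim_elems[OF J(3)]] that by blast
  define s where "s = (\<lambda>j. real (kk j) / sqrt (real CARD('a) ^ kk j))"
  have ps: "prim_sum (kk j) B = s j * (\<Sum>x\<in>R j. quad_char (kk j) (ac_eval B x))" if "j \<in> J" for j and B :: "'a Polynomial.poly"
    unfolding prim_sum_def s_def sum_prim_elems_representatives(1)[OF J(3)[OF that] R(1)[OF that] R(2)[OF that]]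
    by (simp add: real_sqrt_power)
  have pm: "prim_moment TYPE('a) (kk j) (b j) = s j ^ b j *
      (\<Sum>h\<in>{..<b j} \<rightarrow>\<^sub>E R j. \<Prod>x\<in>R j. char_moment (real CARD('a) ^ kk j) (card {i \<in> {..<b j}. h i = x}))"
    if "j \<in> J" for j
    unfolding prim_moment_def s_def sum_PiE_char_moment[OF finR[OF that] J(3)[OF that]]
      sum_prim_elems_representatives(2)[OF J(3)[OF that] R(1)[OF that] R(2)[OF that]]
    using J(3)[OF that] by simp
  let ?X = "\<lambda>B H. \<Prod>j\<in>J. \<Prod>x\<in>R j. quad_char (kk j) (ac_eval (B :: 'a Polynomial.poly) x) ^ card {i \<in> {..<b j}. H j i = x}"
  have "(\<Sum>B\<in>monic_polys N. \<Prod>j\<in>J. prim_sum (kk j) (B :: 'a Polynomial.poly) ^ b j) =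
      (\<Sum>B\<in>monic_polys N. (\<Prod>j\<in>J. s j ^ b j) * (\<Sum>H\<in>(\<Pi>\<^sub>E j\<in>J. {..<b j} \<rightarrow>\<^sub>E R j). ?X B H))"
  proof (rule sum.cong[OF refl])
    fix B :: "'a Polynomial.poly"
    have "(\<Prod>j\<in>J. prim_sum (kk j) B ^ b j) = (\<Prod>j\<in>J. s j ^ b j *
        (\<Sum>h\<in>{..<b j} \<rightarrow>\<^sub>E R j. \<Prod>x\<in>R j. quad_char (kk j) (ac_eval B x) ^ card {i \<in> {..<b j}. h i = x}))"
      by (intro prod.cong refl) (simp only: ps power_mult_distrib sum_power_eq_sum_PiE[OF finR])
    also have "\<dots> = (\<Prod>j\<in>J. s j ^ b j) * (\<Prod>j\<in>J.
        (\<Sum>h\<in>{..<b j} \<rightarrow>\<^sub>E R j. \<Prod>x\<in>R j. quad_char (kk j) (ac_eval B x) ^ card {i \<in> {..<b j}. h i = x}))"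
      by (rule prod.distrib)
    also have "(\<Prod>j\<in>J. (\<Sum>h\<in>{..<b j} \<rightarrow>\<^sub>E R j. \<Prod>x\<in>R j. quad_char (kk j) (ac_eval B x) ^ card {i \<in> {..<b j}. h i = x})) =
        (\<Sum>H\<in>(\<Pi>\<^sub>E j\<in>J. {..<b j} \<rightarrow>\<^sub>E R j). ?X B H)"
      using J(1) finR by (intro prod_sum_PiE finite_PiE) auto
    finally show "(\<Prod>j\<in>J. prim_sum (kk j) B ^ b j) =
        (\<Prod>j\<in>J. s j ^ b j) * (\<Sum>H\<in>(\<Pi>\<^sub>E j\<in>J. {..<b j} \<rightarrow>\<^sub>E R j). ?X B H)" .
  qed
  also have "\<dots> = (\<Prod>j\<in>J. s j ^ b j) * (\<Sum>H\<in>(\<Pi>\<^sub>E j\<in>J. {..<b j} \<rightarrow>\<^sub>E R j). \<Sum>B\<in>monic_polys N. ?X B H)"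
    by (subst sum.swap) (simp add: sum_distrib_left)
  also have "(\<Sum>H\<in>(\<Pi>\<^sub>E j\<in>J. {..<b j} \<rightarrow>\<^sub>E R j). \<Sum>B\<in>monic_polys N. ?X B H) =
      (\<Sum>H\<in>(\<Pi>\<^sub>E j\<in>J. {..<b j} \<rightarrow>\<^sub>E R j). real CARD('a) ^ N *
        (\<Prod>j\<in>J. \<Prod>x\<in>R j. char_moment (real CARD('a) ^ kk j) (card {i \<in> {..<b j}. H j i = x})))"
    by (intro sum.cong refl sum_monic_polys_tuples[OF J R(1,3) le])
  also have "\<dots> = real CARD('a) ^ N * (\<Prod>j\<in>J. \<Sum>h\<in>{..<b j} \<rightarrow>\<^sub>E R j. \<Prod>x\<in>R j.
        char_moment (real CARD('a) ^ kk j) (card {i \<in> {..<b j}. h i = x}))"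
    unfolding sum_distrib_left[symmetric] using J(1) finR
    by (subst prod_sum_PiE) (auto intro!: finite_PiE)
  also have "(\<Prod>j\<in>J. s j ^ b j) * \<dots> = real CARD('a) ^ N * (\<Prod>j\<in>J. prim_moment TYPE('a) (kk j) (b j))"
    using pm by (simp add: prod.distrib)
  finally show "(\<Sum>B\<in>monic_polys N. \<Prod>j\<in>J. prim_sum (kk j) (B :: 'a Polynomial.poly) ^ b j) =
      real CARD('a) ^ N * (\<Prod>j\<in>J. prim_moment TYPE('a) (kk j) (b j))" .
qed

end

section \<open>Sieving for squarefree polynomials\<close>

context
  fixes F :: "'a :: {finite, field} Polynomial.poly \<Rightarrow> real" and D K :: nat
  assumes D: "D \<ge> 2" and K: "K > 0"
    and inv: "\<And>a Q. a \<noteq> 0 \<Longrightarrow> Polynomial.degree a < K \<Longrightarrow> F (a ^ 2 * Q) = F Q"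
begin

text \<open>For \<open>2 * l \<le> N\<close>, the contribution to the sum over monic polynomials of
  degree \<open>N\<close> of those whose square part \<open>a ^ 2\<close> has \<open>a\<close> of
  degree \<open>l\<close>.\<close>

definition sieve_layer :: "nat \<Rightarrow> nat \<Rightarrow> real" where
  "sieve_layer N l = (\<Sum>a\<in>monic_polys l. \<Sum>Q\<in>sqfree_polys (N - 2 * l). F (a ^ 2 * Q))"

lemma sieve_layer_small:
  assumes "l < K"
  shows "sieve_layer N l = real CARD('a) ^ l * (\<Sum>Q\<in>sqfree_polys (N - 2 * l). F Q)"
proof -
  have "sieve_layer N l = (\<Sum>a\<in>(monic_polys l :: 'a Polynomial.poly set). \<Sum>Q\<in>sqfree_polys (N - 2 * l). F Q)"
    unfolding sieve_layer_def using assms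
    by (intro sum.cong refl inv) (auto simp: monic_polys_def)
  then show ?thesis
    by (simp add: finite_card_monic_polys)
qed

text \<open>Telescoping: there are \<open>q^l\<close> monic \<open>a\<close> of degree
  \<open>l\<close>, so for \<open>l < K\<close> layer \<open>l\<close> in degree \<open>D\<close> is
  \<open>q\<close> times layer \<open>l - 1\<close> in degree \<open>D - 2\<close>. In terms of
  generating functions this is multiplication by \<open>1 - q T^2\<close>, the inverse of the series
  that counts squares.\<close>

lemma sieve_identity:
  "(\<Sum>Q\<in>sqfree_polys D. F Q) =
    (\<Sum>M\<in>monic_polys D. F M) - real CARD('a) * (\<Sum>M\<in>monic_polys (D - 2). F M)
    - (\<Sum>l\<in>{K..D div 2}. sieve_layer D l - real CARD('a) * sieve_layer (D - 2) (l - 1))"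
proof -
  have D2: "(D - 2) div 2 = D div 2 - 1" "D div 2 \<ge> 1"
    using D by auto
  have "(\<Sum>M\<in>monic_polys D. F M) = (\<Sum>l\<le>D div 2. sieve_layer D l)"
    unfolding sieve_layer_def by (rule sum_monic_polys_square_decomp)
  also have "{..D div 2} = insert 0 {1..D div 2}"
    by auto
  also have "(\<Sum>l\<in>insert 0 {1..D div 2}. sieve_layer D l) = (\<Sum>Q\<in>sqfree_polys D. F Q) + (\<Sum>l\<in>{1..D div 2}. sieve_layer D l)"
    using sieve_layer_small[OF K, of D] by simp
  finally have 1: "(\<Sum>M\<in>monic_polys D. F M) = (\<Sum>Q\<in>sqfree_polys D. F Q) + (\<Sum>l\<in>{1..D div 2}. sieve_layer D l)" .
  have "(\<Sum>M\<in>monic_polys (D - 2). F M) = (\<Sum>l\<le>(D - 2) div 2. sieve_layer (D - 2) l)"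
    unfolding sieve_layer_def by (rule sum_monic_polys_square_decomp)
  also have "\<dots> = (\<Sum>l\<in>{1..D div 2}. sieve_layer (D - 2) (l - 1))"
    using D2 by (intro sum.reindex_bij_witness[of _ "\<lambda>l. l - 1" Suc]) auto
  finally have 2: "(\<Sum>M\<in>monic_polys (D - 2). F M) = (\<Sum>l\<in>{1..D div 2}. sieve_layer (D - 2) (l - 1))" .
  have 3: "sieve_layer D l - real CARD('a) * sieve_layer (D - 2) (l - 1) = 0" if "l \<in> {1..D div 2}" "l < K" for l
  proof -
    have "D - 2 - 2 * (l - 1) = D - 2 * l" "l = Suc (l - 1)" "l - 1 < K"
      using that by auto
    then show ?thesis
      using sieve_layer_small[OF that(2), of D] sieve_layer_small[of "l - 1" "D - 2"]
      by (metis (no_types, lifting) diff_self mult.assoc power_Suc)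
  qed
  have "(\<Sum>l\<in>{1..D div 2}. sieve_layer D l - real CARD('a) * sieve_layer (D - 2) (l - 1)) =
      (\<Sum>l\<in>{K..D div 2}. sieve_layer D l - real CARD('a) * sieve_layer (D - 2) (l - 1))"
    using K 3 by (intro sum.mono_neutral_right) auto
  with 1 2 show ?thesis
    by (simp add: sum_subtractf sum_distrib_left)
qed

lemma sieve_layer_bound:
  assumes W: "\<And>M. M \<in> monic_polys N \<Longrightarrow> \<bar>F M\<bar> \<le> W" and l: "2 * l \<le> N"
  shows "\<bar>sieve_layer N l\<bar> \<le> W * real CARD('a) ^ (N - l)"
proof -
  have "\<bar>sieve_layer N l\<bar> \<le> (\<Sum>a\<in>monic_polys l. \<Sum>Q\<in>sqfree_polys (N - 2 * l). \<bar>F (a ^ 2 * Q)\<bar>)"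
    unfolding sieve_layer_def by (intro order_trans[OF sum_abs] sum_mono) auto
  also have "\<dots> \<le> (\<Sum>a\<in>(monic_polys l :: 'a Polynomial.poly set). \<Sum>Q\<in>(sqfree_polys (N - 2 * l) :: 'a Polynomial.poly set). W)"
  proof (intro sum_mono W)
    fix a Q :: "'a Polynomial.poly" assume a: "a \<in> monic_polys l" and Q: "Q \<in> sqfree_polys (N - 2 * l)"
    then have "a \<noteq> 0" "Q \<noteq> 0"
      by (auto simp: monic_polys_def sqfree_polys_def)
    with a Q l have "Polynomial.degree (a ^ 2 * Q) = N"
      by (auto simp: monic_polys_def sqfree_polys_def degree_mult_eq degree_power_eq)
    moreover have "Polynomial.lead_coeff (a ^ 2 * Q) = 1"
      using a Q unfolding monic_polys_def sqfree_polys_def lead_coeff_mult lead_coeff_power by auto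
    ultimately show "a ^ 2 * Q \<in> monic_polys N"
      by (simp add: monic_polys_def)
  qed
  also have "\<dots> = W * (real CARD('a) ^ l * real (card (sqfree_polys (N - 2 * l) :: 'a Polynomial.poly set)))"
    by (simp add: finite_card_monic_polys)
  also have "\<dots> \<le> W * (real CARD('a) ^ l * real CARD('a) ^ (N - 2 * l))"
  proof (intro mult_left_mono)
    have "card (sqfree_polys (N - 2 * l) :: 'a Polynomial.poly set) \<le> card (monic_polys (N - 2 * l) :: 'a Polynomial.poly set)"
      using finite_card_monic_polys(1)[where ?'a = 'a] by (intro card_mono) (auto simp: sqfree_polys_def)
    then show "real (card (sqfree_polys (N - 2 * l) :: 'a Polynomial.poly set)) \<le> real CARD('a) ^ (N - 2 * l)"
      by (simp add: finite_card_monic_polys)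
    have "Polynomial.monom 1 N \<in> (monic_polys N :: 'a Polynomial.poly set)"
      by (simp add: monic_polys_def degree_monom_eq)
    from W[OF this] show "0 \<le> W"
      by linarith
  qed auto
  also have "real CARD('a) ^ l * real CARD('a) ^ (N - 2 * l) = real CARD('a) ^ (N - l)"
    using l by (simp flip: power_add)
  finally show ?thesis .
qed

lemma sieve_error:
  assumes W: "\<And>N M. N \<in> {D, D - 2} \<Longrightarrow> M \<in> monic_polys N \<Longrightarrow> \<bar>F M\<bar> \<le> W"
  shows "\<bar>(\<Sum>Q\<in>sqfree_polys D. F Q) -
      ((\<Sum>M\<in>monic_polys D. F M) - real CARD('a) * (\<Sum>M\<in>monic_polys (D - 2). F M))\<bar> \<le>
    2 * W * real D * (real CARD('a) ^ D / real CARD('a) ^ K)"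
proof -
  have q: "real CARD('a) \<ge> 1"
    using one_less_CARD_field[where ?'a = 'a] by simp
  have "Polynomial.monom 1 D \<in> (monic_polys D :: 'a Polynomial.poly set)"
    by (simp add: monic_polys_def degree_monom_eq)
  from W[OF _ this] have W0: "0 \<le> W"
    by auto
  have "\<bar>\<Sum>l\<in>{K..D div 2}. sieve_layer D l - real CARD('a) * sieve_layer (D - 2) (l - 1)\<bar> \<le>
      (\<Sum>l\<in>{K..D div 2}. 2 * W * (real CARD('a) ^ D / real CARD('a) ^ K))"
  proof (intro order_trans[OF sum_abs] sum_mono)
    fix l assume l: "l \<in> {K..D div 2}"
    \<comment> \<open>The last equation makes both layers equally large:
      \<open>q * q^((D - 2) - (l - 1)) = q^(D - l)\<close>.\<close>
    then have l': "2 * l \<le> D" "2 * (l - 1) \<le> D - 2" "Suc (D - 2 - (l - 1)) = D - l"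
      using K by auto
    have "\<bar>sieve_layer D l\<bar> \<le> W * real CARD('a) ^ (D - l)"
      by (rule sieve_layer_bound[OF W l'(1)]) auto
    moreover have "\<bar>real CARD('a) * sieve_layer (D - 2) (l - 1)\<bar> \<le> W * real CARD('a) ^ (D - l)"
    proof -
      have "real CARD('a) * \<bar>sieve_layer (D - 2) (l - 1)\<bar> \<le> real CARD('a) * (W * real CARD('a) ^ (D - 2 - (l - 1)))"
        by (intro mult_left_mono sieve_layer_bound[OF W l'(2)]) auto
      also have "\<dots> = W * real CARD('a) ^ (D - l)"
        unfolding l'(3)[symmetric] by simp
      finally show ?thesis
        by (simp add: abs_mult)
    qed
    moreover have "real CARD('a) ^ (D - l) \<le> real CARD('a) ^ D / real CARD('a) ^ K"
    proof -
      have "real CARD('a) ^ (D - l) \<le> real CARD('a) ^ (D - K)"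
        using l q by (intro power_increasing) auto
      also have "\<dots> = real CARD('a) ^ D / real CARD('a) ^ K"
        using l q by (intro power_diff) auto
      finally show ?thesis .
    qed
    then have "W * real CARD('a) ^ (D - l) \<le> W * (real CARD('a) ^ D / real CARD('a) ^ K)"
      by (intro mult_left_mono W0)
    ultimately show "\<bar>sieve_layer D l - real CARD('a) * sieve_layer (D - 2) (l - 1)\<bar> \<le>
        2 * W * (real CARD('a) ^ D / real CARD('a) ^ K)"
      by linarith
  qed
  also have "\<dots> = real (card {K..D div 2}) * (2 * W * (real CARD('a) ^ D / real CARD('a) ^ K))"
    by simp
  also have "\<dots> \<le> real D * (2 * W * (real CARD('a) ^ D / real CARD('a) ^ K))"
    using W0 K by (intro mult_right_mono) auto
  finally show ?thesis
    unfolding sieve_identity by (simp add: mult_ac)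
qed

end

text \<open>The sieve applied to the constant \<open>1\<close>. This function is invariant under all
  square factors, so \<open>K = D + 1\<close> is admissible; the error range is then empty and the
  count is exact.\<close>

lemma card_sqfree_polys:
  assumes "D \<ge> 2"
  shows "real (card (sqfree_polys D :: 'a :: {finite, field} Polynomial.poly set)) =
    real CARD('a) ^ D * (1 - 1 / real CARD('a))"
proof -
  have q: "real CARD('a) > 0"
    using one_less_CARD_field[where ?'a = 'a] by simp
  have "real (card (sqfree_polys D :: 'a Polynomial.poly set)) =
      real CARD('a) ^ D - real CARD('a) * real CARD('a) ^ (D - 2)"
    using sieve_identity[of D "Suc D" "\<lambda>_ :: 'a Polynomial.poly. 1"] assms by (simp add: finite_card_monic_polys)
  also have "\<dots> = real CARD('a) ^ D * (1 - 1 / real CARD('a))"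
  proof -
    have "real CARD('a) ^ D = real CARD('a) * (real CARD('a) * real CARD('a) ^ (D - 2))"
      using assms by (metis Suc_1 Suc_diff_le diff_Suc_Suc diff_zero le_add_diff_inverse power_Suc plus_1_eq_Suc add_Suc)
    then show ?thesis
      using q by (simp add: right_diff_distrib)
  qed
  finally show ?thesis .
qed

section \<open>Error terms\<close>

text \<open>Writing the powers out and dividing each factor by \<open>L\<close> places all factors
  in the unit disc, where the difference of two products is at most the sum of the differences of
  their factors.\<close>

lemma norm_prod_power_diff_le:
  fixes x y :: "'i \<Rightarrow> 'c :: real_normed_field"
  assumes J: "finite J" and L: "L \<ge> 1"
    and x: "\<And>j. j \<in> J \<Longrightarrow> norm (x j) \<le> L" and y: "\<And>j. j \<in> J \<Longrightarrow> norm (y j) \<le> L"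
    and d: "\<And>j. j \<in> J \<Longrightarrow> norm (x j - y j) \<le> e"
  shows "norm ((\<Prod>j\<in>J. x j ^ a j) - (\<Prod>j\<in>J. y j ^ a j)) \<le> real (\<Sum>j\<in>J. a j) * L ^ (\<Sum>j\<in>J. a j) * e"
proof -
  define I where "I = (SIGMA j:J. {..<a j})"
  define A where "A = (\<Sum>j\<in>J. a j)"
  have I: "finite I" "card I = A"
    using J by (auto simp: I_def A_def)
  have eq: "(\<Prod>j\<in>J. f j ^ a j) = of_real L ^ A * (\<Prod>t\<in>I. f (fst t) / of_real L)" for f :: "'i \<Rightarrow> 'c"
  proof -
    have "(\<Prod>j\<in>J. f j ^ a j) = (\<Prod>j\<in>J. \<Prod>i<a j. f j)"
      by simp
    also have "\<dots> = (\<Prod>t\<in>I. f (fst t))"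
      unfolding I_def using J by (subst prod.Sigma) (auto simp: split_def)
    also have "\<dots> = of_real L ^ A * (\<Prod>t\<in>I. f (fst t) / of_real L)"
      using L I by (simp add: prod_dividef)
    finally show ?thesis .
  qed
  have "norm ((\<Prod>t\<in>I. x (fst t) / of_real L) - (\<Prod>t\<in>I. y (fst t) / of_real L)) \<le>
      (\<Sum>t\<in>I. norm (x (fst t) / of_real L - y (fst t) / of_real L))"
    using x y L by (intro norm_prod_diff) (auto simp: norm_divide I_def)
  also have "\<dots> \<le> (\<Sum>t\<in>I. e)"
  proof (rule sum_mono)
    fix t assume "t \<in> I"
    then have t: "fst t \<in> J" by (auto simp: I_def)
    have "norm (x (fst t) / of_real L - y (fst t) / of_real L) = norm (x (fst t) - y (fst t)) / L"
      using L by (simp add: norm_divide flip: diff_divide_distrib)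
    also have "\<dots> \<le> norm (x (fst t) - y (fst t))"
      using L by (simp add: divide_le_eq mult_le_cancel_left1)
    also have "\<dots> \<le> e"
      by (rule d[OF t])
    finally show "norm (x (fst t) / of_real L - y (fst t) / of_real L) \<le> e" .
  qed
  finally have "norm ((\<Prod>t\<in>I. x (fst t) / of_real L) - (\<Prod>t\<in>I. y (fst t) / of_real L)) \<le> real A * e"
    using I by simp
  then have "L ^ A * norm ((\<Prod>t\<in>I. x (fst t) / of_real L) - (\<Prod>t\<in>I. y (fst t) / of_real L)) \<le> L ^ A * (real A * e)"
    using L by (intro mult_left_mono) auto
  then show ?thesis
    using L unfolding eq by (simp add: norm_mult norm_power A_def mult_ac flip: right_diff_distrib)
qed

text \<open>For \<open>b \<le> a\<close>, the coefficient of \<open>X^b\<close> in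
  \<open>(- eta k - X)^a\<close>.\<close>

definition trace_coeff :: "nat \<Rightarrow> nat \<Rightarrow> nat \<Rightarrow> real" where
  "trace_coeff a k b = real (a choose b) * (- 1) ^ b * (- of_bool (even k)) ^ (a - b)"

lemma abs_trace_coeff_le: "\<bar>trace_coeff a k b\<bar> \<le> real (a choose b)"
proof -
  have "\<bar>(- of_bool (even k)) ^ (a - b)\<bar> \<le> (1 :: real)"
    by (auto simp: power_abs power_0_left)
  then have "real (a choose b) * \<bar>(- of_bool (even k) :: real) ^ (a - b)\<bar> \<le> real (a choose b) * 1"
    by (intro mult_left_mono) auto
  then show ?thesis
    by (simp add: trace_coeff_def abs_mult)
qed

text \<open>The expectation of \<open>(- eta k - X)^a\<close> for a centred Gaussian
  \<open>X\<close> of variance \<open>k\<close>.\<close>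

definition main_term :: "nat \<Rightarrow> nat \<Rightarrow> real" where
  "main_term a k = (\<Sum>b\<le>a. trace_coeff a k b * gauss_moment k b)"

lemma main_term_eq:
  "complex_of_real (main_term a k) =
    (\<Sum>i=0..a div 2. of_nat k ^ i * of_nat (a choose (2 * i)) * (fact (2 * i) / (2 ^ i * fact i)) * (- eta k) ^ (a - 2 * i))"
proof -
  have "main_term a k = (\<Sum>b\<in>(\<lambda>i. 2 * i) ` {0..a div 2}. trace_coeff a k b * gauss_moment k b)"
    unfolding main_term_def
    by (rule sum.mono_neutral_right) (auto simp: gauss_moment_def elim!: evenE)
  also have "\<dots> = (\<Sum>i=0..a div 2. trace_coeff a k (2 * i) * gauss_moment k (2 * i))"
    by (subst sum.reindex) (auto simp: inj_on_def)
  finally show ?thesis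
    by (simp add: trace_coeff_def gauss_moment_def eta_def mult_ac)
qed

section \<open>From the exact moments to the Gaussian ones\<close>

lemma q_gt_1: "real CARD('a :: {finite, field}) > 1"
  using one_less_CARD_field[where ?'a = 'a] by simp

text \<open>Orbits have exactly \<open>k\<close> elements, whence the divisibility. The missing
  points lie in the subfield of index two or in the small subfields; a factor \<open>1 / s\<close>
  is given away for the latter so that the bound takes the common form.\<close>

lemma prim_elems_card:
  assumes k: "k > 0"
  shows "k dvd card (prim_elems k :: 'a :: {finite, field} alg_closure set)"
    and "real (card (prim_elems k :: 'a alg_closure set)) \<le> real CARD('a) ^ k"
    and "1 - real (card (prim_elems k :: 'a alg_closure set)) / real CARD('a) ^ k \<le>
      (real k + 1) * real CARD('a) powr (- real k / 6)"
proof -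
  note F = finite_card_ext_field[OF k, where ?'a = 'a]
  let ?P = "prim_elems k :: 'a alg_closure set"
  obtain R :: "'a alg_closure set" where "R \<subseteq> prim_elems k"
    "bij_betw (\<lambda>(x, i). x ^ (CARD('a) ^ i)) (R \<times> {..<k}) (prim_elems k)"
    using orbit_representatives[OF k] by metis
  then show "k dvd card ?P"
    using sum_prim_elems_representatives(2)[OF k, where R = R] by simp
  have "card ?P \<le> card (ext_field k :: 'a alg_closure set)"
    using F prim_elems_subset by (intro card_mono) auto
  then show "real (card ?P) \<le> real CARD('a) ^ k"
    using F(2) by (metis of_nat_le_iff of_nat_power)
  define s where "s = sqrt (real CARD('a)) ^ k"
  have s: "s \<ge> 1"
    unfolding s_def using q_gt_1[where ?'a = 'a] by (intro one_le_power) simp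
  have ss: "real CARD('a) ^ k = s * s"
    by (simp add: s_def flip: power_mult_distrib)
  define E where "E = (if even k then ext_field (k div 2) else {} :: 'a alg_closure set)"
  let ?U = "\<Union>d\<in>{1..k div 3}. ext_field d :: 'a alg_closure set"
  have finE: "finite E"
    using k finite_card_ext_field(1)[of "k div 2", where ?'a = 'a] by (auto simp: E_def elim!: evenE)
  have cardE: "real (card E) \<le> s"
    using k s finite_card_ext_field(2)[of "k div 2", where ?'a = 'a]
    by (auto simp: E_def s_def power_mult elim!: evenE)
  have "ext_field k - ?P \<subseteq> E \<union> ?U"
    using nonprim_cases[OF _ k] by (auto simp: E_def)
  then have "card (ext_field k - ?P) \<le> card E + card ?U"
    using finE card_small_subfields(1) by (meson card_Un_le card_mono finite_UnI order_trans)
  then have "real (card (ext_field k - ?P)) \<le> s + real (k * CARD('a) ^ (k div 3))"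
    using cardE card_small_subfields(2)[of k, where ?'a = 'a] by linarith
  moreover have "card (ext_field k - ?P) = card (ext_field k :: 'a alg_closure set) - card ?P"
    using F prim_elems_subset k by (intro card_Diff_subset) auto
  then have "real (card (ext_field k - ?P)) = real CARD('a) ^ k - real (card ?P)"
    using \<open>card ?P \<le> _\<close> F(2) by (simp add: of_nat_diff)
  ultimately have "real CARD('a) ^ k - real (card ?P) \<le> s + real k * real (CARD('a) ^ (k div 3))"
    by simp
  then have "(real CARD('a) ^ k - real (card ?P)) / real CARD('a) ^ k \<le>
      (s + real k * real (CARD('a) ^ (k div 3))) / real CARD('a) ^ k"
    by (intro divide_right_mono) auto
  also have "\<dots> = 1 / s + real k * (real (CARD('a) ^ (k div 3)) / s) / s"
    using s unfolding ss by (simp add: field_simps)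
  also have "\<dots> \<le> 1 / s + real k * (real (CARD('a) ^ (k div 3)) / s)"
    using s divide_left_mono[of 1 s "real k * (real (CARD('a) ^ (k div 3)) / s)"] by simp
  also have "\<dots> \<le> real CARD('a) powr (- real k / 6) + real k * real CARD('a) powr (- real k / 6)"
    unfolding s_def by (intro add_mono mult_left_mono q_powr_bounds) auto
  finally show "1 - real (card ?P) / real CARD('a) ^ k \<le> (real k + 1) * real CARD('a) powr (- real k / 6)"
    using q_gt_1[where ?'a = 'a] by (simp add: diff_divide_distrib algebra_simps)
qed

text \<open>\<open>sign_moment_approx\<close> with \<open>y = q^k\<close>, with \<open>n\<close> the
  number of orbits and with the error scale \<open>q powr (- k / 6)\<close> as \<epsilon>.\<close>

lemma prim_moment_approx:
  "\<exists>C\<ge>0. \<forall>k>0. \<bar>prim_moment TYPE('a :: {finite, field}) k b - gauss_moment k b\<bar> \<le>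
     C * (real k + 1) ^ (b + 1) * real CARD('a) powr (- real k / 6)"
proof -
  obtain C where C: "C \<ge> 0" "\<And>k n y \<epsilon>. k > 0 \<Longrightarrow> y \<ge> 1 \<Longrightarrow> real (k * n) \<le> y \<Longrightarrow>
      1 - real (k * n) / y \<le> (real k + 1) * \<epsilon> \<Longrightarrow> 1 / y \<le> \<epsilon> \<Longrightarrow>
     \<bar>(real k / sqrt y) ^ b * sign_moment (1 / y) n b - gauss_moment k b\<bar> \<le> C * (real k + 1) ^ (b + 1) * \<epsilon>"
    using sign_moment_approx[of b] by blast
  show ?thesis
  proof (intro exI[of _ C] conjI allI impI C(1))
    fix k :: nat assume k: "k > 0"
    define n where "n = card (prim_elems k :: 'a alg_closure set) div k"
    have kn: "k * n = card (prim_elems k :: 'a alg_closure set)"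
      using prim_elems_card(1)[OF k, where ?'a = 'a] by (simp add: n_def)
    have s: "sqrt (real CARD('a)) ^ k \<ge> 1"
      using q_gt_1[where ?'a = 'a] by (intro one_le_power) simp
    have "1 / real CARD('a) ^ k = (1 / sqrt (real CARD('a)) ^ k) * (1 / sqrt (real CARD('a)) ^ k)"
      by (simp flip: power_mult_distrib)
    also have "\<dots> \<le> 1 / sqrt (real CARD('a)) ^ k"
      using s by (intro mult_left_le) auto
    also have "\<dots> \<le> real CARD('a) powr (- real k / 6)"
      by (rule q_powr_bounds)
    finally have "1 / real CARD('a) ^ k \<le> real CARD('a) powr (- real k / 6)" .
    moreover have "real CARD('a) ^ k \<ge> 1"
      using q_gt_1[where ?'a = 'a] by (intro one_le_power) simp
    ultimately show "\<bar>prim_moment TYPE('a) k b - gauss_moment k b\<bar> \<le>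
        C * (real k + 1) ^ (b + 1) * real CARD('a) powr (- real k / 6)"
      unfolding prim_moment_def n_def[symmetric]
      by (intro C(2) k) (use prim_elems_card(2,3)[OF k, where ?'a = 'a] kn in auto)
  qed
qed

text \<open>The counterpart of \<open>main_term\<close> with the exact moments in place of the
  Gaussian ones.\<close>

definition prim_main :: "'a :: {finite, field} itself \<Rightarrow> nat \<Rightarrow> nat \<Rightarrow> real" where
  "prim_main t a k = (\<Sum>b\<le>a. trace_coeff a k b * prim_moment t k b)"

lemma prim_main_approx:
  "\<exists>C\<ge>1. \<forall>k>0. \<bar>prim_main TYPE('a :: {finite, field}) a k - main_term a k\<bar> \<le>
     C * (real k + 1) ^ (a + 1) * real CARD('a) powr (- real k / 6) \<and>
     \<bar>main_term a k\<bar> \<le> C * (real k + 1) ^ (a + 1)"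
proof -
  obtain C where C: "\<And>b. C b \<ge> 0" "\<And>b k. k > 0 \<Longrightarrow> \<bar>prim_moment TYPE('a) k b - gauss_moment k b\<bar> \<le>
     C b * (real k + 1) ^ (b + 1) * real CARD('a) powr (- real k / 6)"
    using prim_moment_approx by metis
  define C1 where "C1 = (\<Sum>b\<le>a. real (a choose b) * C b)"
  define C2 where "C2 = (\<Sum>b\<le>a. real (a choose b) * fact b)"
  have C12: "C1 \<ge> 0" "C2 \<ge> 0"
    unfolding C1_def C2_def using C(1) by (auto intro!: sum_nonneg)
  show ?thesis
  proof (intro exI[of _ "C1 + C2 + 1"] conjI allI impI)
    show "1 \<le> C1 + C2 + 1"
      using C12 by simp
    fix k :: nat assume k: "k > 0"
    let ?e = "real CARD('a) powr (- real k / 6)"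
    have pow: "(real k + 1) ^ (b + 1) \<le> (real k + 1) ^ (a + 1)" if "b \<le> a" for b
      using that by (intro power_increasing) auto
    have "\<bar>prim_main TYPE('a) a k - main_term a k\<bar> =
        \<bar>\<Sum>b\<le>a. trace_coeff a k b * (prim_moment TYPE('a) k b - gauss_moment k b)\<bar>"
      by (simp add: prim_main_def main_term_def right_diff_distrib sum_subtractf)
    also have "\<dots> \<le> (\<Sum>b\<le>a. real (a choose b) * (C b * (real k + 1) ^ (a + 1) * ?e))"
    proof (intro order_trans[OF sum_abs] sum_mono)
      fix b assume "b \<in> {..a}"
      then have "C b * (real k + 1) ^ (b + 1) * ?e \<le> C b * (real k + 1) ^ (a + 1) * ?e"
        using pow C(1) by (intro mult_right_mono mult_left_mono) auto
      then have "\<bar>prim_moment TYPE('a) k b - gauss_moment k b\<bar> \<le> C b * (real k + 1) ^ (a + 1) * ?e"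
        using C(2)[OF k, of b] by linarith
      then show "\<bar>trace_coeff a k b * (prim_moment TYPE('a) k b - gauss_moment k b)\<bar> \<le>
          real (a choose b) * (C b * (real k + 1) ^ (a + 1) * ?e)"
        unfolding abs_mult by (intro mult_mono abs_trace_coeff_le) auto
    qed
    also have "\<dots> = C1 * ((real k + 1) ^ (a + 1) * ?e)"
      by (simp only: C1_def sum_distrib_right mult.assoc)
    also have "\<dots> \<le> (C1 + C2 + 1) * ((real k + 1) ^ (a + 1) * ?e)"
      using C12 by (intro mult_right_mono) auto
    finally show "\<bar>prim_main TYPE('a) a k - main_term a k\<bar> \<le> (C1 + C2 + 1) * (real k + 1) ^ (a + 1) * ?e"
      by (simp add: mult.assoc)
    have "\<bar>main_term a k\<bar> \<le> (\<Sum>b\<le>a. real (a choose b) * (fact b * (real k + 1) ^ (a + 1)))"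
      unfolding main_term_def
    proof (intro order_trans[OF sum_abs] sum_mono)
      fix b assume b: "b \<in> {..a}"
      have "\<bar>gauss_moment k b\<bar> \<le> fact b * (real k + 1) ^ (a + 1)"
      proof (cases "even b")
        case True
        have "real k ^ (b div 2) \<le> (real k + 1) ^ (b div 2)"
          by (intro power_mono) auto
        also have "\<dots> \<le> (real k + 1) ^ (a + 1)"
          using b by (intro power_increasing) auto
        finally have 1: "real k ^ (b div 2) \<le> (real k + 1) ^ (a + 1)" .
        have "1 * 1 \<le> (2 :: real) ^ (b div 2) * fact (b div 2)"
          by (intro mult_mono) (auto simp: fact_ge_1)
        then have "fact b / (2 ^ (b div 2) * fact (b div 2)) \<le> (fact b :: real) / 1"
          by (intro divide_left_mono) auto
        then have "real k ^ (b div 2) * (fact b / (2 ^ (b div 2) * fact (b div 2))) \<le> (real k + 1) ^ (a + 1) * fact b"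
          using 1 by (intro mult_mono) auto
        then show ?thesis
          using True by (simp add: gauss_moment_def mult.commute)
      qed (simp add: gauss_moment_def)
      then show "\<bar>trace_coeff a k b * gauss_moment k b\<bar> \<le> real (a choose b) * (fact b * (real k + 1) ^ (a + 1))"
        unfolding abs_mult by (intro mult_mono abs_trace_coeff_le) auto
    qed
    also have "\<dots> = C2 * (real k + 1) ^ (a + 1)"
      by (simp only: C2_def sum_distrib_right mult.assoc)
    also have "\<dots> \<le> (C1 + C2 + 1) * (real k + 1) ^ (a + 1)"
      using C12 by (intro mult_right_mono) auto
    finally show "\<bar>main_term a k\<bar> \<le> (C1 + C2 + 1) * (real k + 1) ^ (a + 1)" .
  qed
qed

text \<open>The order of the quantifiers matters: \<open>C\<close> and \<open>R\<close> depend on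
  \<open>J\<close> and \<open>a\<close> (and on \<open>q\<close>) but not on \<open>kk\<close>,
  because the \<open>k_j\<close> vary with \<open>g\<close>.\<close>

lemma prod_main_approx:
  fixes a :: "'i \<Rightarrow> nat"
  assumes J: "finite J"
  shows "\<exists>C R. \<forall>kk G K. (\<forall>j\<in>J. kk j > 0 \<and> K \<le> kk j \<and> real (kk j) + 1 \<le> G) \<longrightarrow> G \<ge> 1 \<longrightarrow>
    \<bar>(\<Prod>j\<in>J. prim_main TYPE('a :: {finite, field}) (a j) (kk j)) - (\<Prod>j\<in>J. main_term (a j) (kk j))\<bar> \<le>
      C * G ^ R * real CARD('a) powr (- real K / 6)"
proof -
  have q: "real CARD('a) > 1"
    by (rule q_gt_1[where ?'a = 'a])
  obtain c where c: "\<And>b. c b \<ge> 1" "\<And>b k. k > 0 \<Longrightarrow> \<bar>prim_main TYPE('a) b k - main_term b k\<bar> \<le>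
      c b * (real k + 1) ^ (b + 1) * real CARD('a) powr (- real k / 6)"
    "\<And>b k. k > 0 \<Longrightarrow> \<bar>main_term b k\<bar> \<le> c b * (real k + 1) ^ (b + 1)"
    using prim_main_approx by metis
  define A where "A = (\<Sum>j\<in>J. a j) + 1"
  define C where "C = 1 + (\<Sum>j\<in>J. c (a j))"
  have c0: "0 \<le> c b" for b
    using c(1)[of b] by linarith
  have cC: "c (a j) \<le> C" if "j \<in> J" for j
    using member_le_sum[of j J "\<lambda>j. c (a j)"] that J c0 by (simp add: C_def)
  have aA: "a j + 1 \<le> A" if "j \<in> J" for j
    using member_le_sum[of j J a] that J by (simp add: A_def)
  have C1: "C \<ge> 1"
    unfolding C_def using c0 by (simp add: sum_nonneg)
  show ?thesis
  proof (intro exI[of _ "real (card J) * (2 * C) ^ card J * C"] exI[of _ "A * card J + A"] allI impI)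
    fix kk :: "'i \<Rightarrow> nat" and G :: real and K :: nat
    assume kk: "\<forall>j\<in>J. kk j > 0 \<and> K \<le> kk j \<and> real (kk j) + 1 \<le> G" and G: "G \<ge> 1"
    define \<epsilon> where "\<epsilon> = real CARD('a) powr (- real K / 6)"
    define e where "e = C * G ^ A * \<epsilon>"
    have eps: "0 \<le> \<epsilon>" "\<epsilon> \<le> 1"
      using powr_mono[of "- real K / 6" 0 "real CARD('a)"] q by (simp_all add: \<epsilon>_def)
    have pow: "c (a j) * (real (kk j) + 1) ^ (a j + 1) \<le> C * G ^ A" if j: "j \<in> J" for j
    proof (intro mult_mono cC[OF j])
      have "(real (kk j) + 1) ^ (a j + 1) \<le> G ^ (a j + 1)"
        using kk j by (intro power_mono) auto
      also have "\<dots> \<le> G ^ A"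
        using aA[OF j] G by (intro power_increasing) auto
      finally show "(real (kk j) + 1) ^ (a j + 1) \<le> G ^ A" .
    qed (use C1 in auto)
    have CG: "C * G ^ A \<ge> 1"
      using mult_mono[OF C1 one_le_power[OF G, of A]] C1 by simp
    have d: "norm (prim_main TYPE('a) (a j) (kk j) - main_term (a j) (kk j)) \<le> e" if j: "j \<in> J" for j
    proof -
      have "\<bar>prim_main TYPE('a) (a j) (kk j) - main_term (a j) (kk j)\<bar> \<le>
          c (a j) * (real (kk j) + 1) ^ (a j + 1) * real CARD('a) powr (- real (kk j) / 6)"
        by (rule c(2)) (use kk j in blast)
      also have "\<dots> \<le> C * G ^ A * \<epsilon>"
      proof (rule mult_mono[OF pow[OF j]])
        show "real CARD('a) powr (- real (kk j) / 6) \<le> \<epsilon>"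
          unfolding \<epsilon>_def using kk j q by (intro powr_mono) auto
      qed (use CG in auto)
      finally show ?thesis
        by (simp add: e_def)
    qed
    have m: "norm (main_term (a j) (kk j)) \<le> C * G ^ A" if j: "j \<in> J" for j
      using c(3)[of "kk j" "a j"] pow[OF j] kk j by fastforce
    have e_le: "e \<le> C * G ^ A"
      unfolding e_def using eps CG by (intro mult_left_le) auto
    \<comment> \<open>The exponents \<open>1\<close> fit the shape of
      \<open>norm_prod_power_diff_le\<close>. The factor \<open>2\<close> in the radius is there
      because \<open>prim_main\<close> differs from \<open>main_term\<close> by at most
      \<open>e\<close>, and both \<open>e\<close> and \<open>main_term\<close> are bounded by
      \<open>C * G ^ A\<close>.\<close>
    have "norm ((\<Prod>j\<in>J. prim_main TYPE('a) (a j) (kk j) ^ 1) - (\<Prod>j\<in>J. main_term (a j) (kk j) ^ 1)) \<le>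
        real (\<Sum>j\<in>J. 1) * (2 * (C * G ^ A)) ^ (\<Sum>j\<in>J. 1) * e"
    proof (rule norm_prod_power_diff_le[OF J _ _ _ d])
      show "1 \<le> 2 * (C * G ^ A)"
        using CG by linarith
      fix j assume j: "j \<in> J"
      show "norm (main_term (a j) (kk j)) \<le> 2 * (C * G ^ A)"
        using m[OF j] CG by linarith
      show "norm (prim_main TYPE('a) (a j) (kk j)) \<le> 2 * (C * G ^ A)"
        using m[OF j] d[OF j] e_le by (simp add: abs_diff_le_iff) linarith
    qed
    also have "\<dots> = real (card J) * (2 * C) ^ card J * C * G ^ (A * card J + A) * \<epsilon>"
      by (simp add: e_def power_mult_distrib power_add power_mult mult_ac)
    finally show "\<bar>(\<Prod>j\<in>J. prim_main TYPE('a) (a j) (kk j)) - (\<Prod>j\<in>J. main_term (a j) (kk j))\<bar> \<le>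
        real (card J) * (2 * C) ^ card J * C * G ^ (A * card J + A) * real CARD('a) powr (- real K / 6)"
      by (simp add: \<epsilon>_def)
  qed
qed

text \<open>The approximation to the product of traces, stated without a Frobenius matrix so that it
  is defined for every polynomial and the sieve can be applied to it.\<close>

definition trace_prod :: "'i set \<Rightarrow> ('i \<Rightarrow> nat) \<Rightarrow> ('i \<Rightarrow> nat) \<Rightarrow> 'a :: {finite, field} Polynomial.poly \<Rightarrow> real" where
  "trace_prod J a kk M = (\<Prod>j\<in>J. (- of_bool (even (kk j)) - prim_sum (kk j) M) ^ a j)"

context
  assumes odd_q: "odd CARD('a :: {finite, field})"
begin

lemma sum_monic_polys_trace_prod:
  assumes J: "finite J" "inj_on kk J" "\<And>j. j \<in> J \<Longrightarrow> kk j > 0"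
    and le: "(\<Sum>j\<in>J. a j * kk j) \<le> N"
  shows "(\<Sum>M\<in>monic_polys N. trace_prod J a kk (M :: 'a Polynomial.poly)) =
    real CARD('a) ^ N * (\<Prod>j\<in>J. prim_main TYPE('a) (a j) (kk j))"
proof -
  have expand: "trace_prod J a kk M =
      (\<Sum>\<beta>\<in>(\<Pi>\<^sub>E j\<in>J. {..a j}). (\<Prod>j\<in>J. trace_coeff (a j) (kk j) (\<beta> j)) * (\<Prod>j\<in>J. prim_sum (kk j) M ^ \<beta> j))"
    for M :: "'a Polynomial.poly"
  proof -
    have "(- of_bool (even (kk j)) - prim_sum (kk j) M) ^ a j =
        (\<Sum>b\<le>a j. trace_coeff (a j) (kk j) b * prim_sum (kk j) M ^ b)" for j
    proof -
      have "- of_bool (even (kk j)) - prim_sum (kk j) M = (- prim_sum (kk j) M) + (- of_bool (even (kk j)))"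
        by simp
      then have "(- of_bool (even (kk j)) - prim_sum (kk j) M) ^ a j =
          ((- prim_sum (kk j) M) + (- of_bool (even (kk j)))) ^ a j"
        by (rule arg_cong)
      also have "\<dots> = (\<Sum>b\<le>a j. trace_coeff (a j) (kk j) b * prim_sum (kk j) M ^ b)"
        unfolding binomial_ring by (intro sum.cong refl) (simp add: trace_coeff_def power_minus[of "prim_sum _ _"] mult_ac)
      finally show ?thesis .
    qed
    then have "trace_prod J a kk M = (\<Prod>j\<in>J. \<Sum>b\<le>a j. trace_coeff (a j) (kk j) b * prim_sum (kk j) M ^ b)"
      by (simp add: trace_prod_def)
    also have "\<dots> = (\<Sum>\<beta>\<in>(\<Pi>\<^sub>E j\<in>J. {..a j}). \<Prod>j\<in>J. trace_coeff (a j) (kk j) (\<beta> j) * prim_sum (kk j) M ^ \<beta> j)"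
      using J(1) by (intro prod_sum_PiE) auto
    finally show ?thesis
      by (simp add: prod.distrib)
  qed
  have "(\<Sum>M\<in>monic_polys N. trace_prod J a kk (M :: 'a Polynomial.poly)) =
      (\<Sum>\<beta>\<in>(\<Pi>\<^sub>E j\<in>J. {..a j}). (\<Prod>j\<in>J. trace_coeff (a j) (kk j) (\<beta> j)) *
        (\<Sum>M\<in>monic_polys N. \<Prod>j\<in>J. prim_sum (kk j) (M :: 'a Polynomial.poly) ^ \<beta> j))"
    unfolding expand by (subst sum.swap) (simp add: sum_distrib_left)
  also have "\<dots> = (\<Sum>\<beta>\<in>(\<Pi>\<^sub>E j\<in>J. {..a j}). (\<Prod>j\<in>J. trace_coeff (a j) (kk j) (\<beta> j)) *
        (real CARD('a) ^ N * (\<Prod>j\<in>J. prim_moment TYPE('a) (kk j) (\<beta> j))))"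
  proof (rule sum.cong[OF refl])
    fix \<beta> assume "\<beta> \<in> (\<Pi>\<^sub>E j\<in>J. {..a j})"
    then have "(\<Sum>j\<in>J. \<beta> j * kk j) \<le> (\<Sum>j\<in>J. a j * kk j)"
      by (intro sum_mono mult_right_mono) (auto simp: PiE_iff)
    then have "(\<Sum>j\<in>J. \<beta> j * kk j) \<le> N"
      using le by simp
    from sum_monic_polys_prod_prim_sum[OF odd_q J this]
    show "(\<Prod>j\<in>J. trace_coeff (a j) (kk j) (\<beta> j)) *
        (\<Sum>M\<in>monic_polys N. \<Prod>j\<in>J. prim_sum (kk j) (M :: 'a Polynomial.poly) ^ \<beta> j) =
        (\<Prod>j\<in>J. trace_coeff (a j) (kk j) (\<beta> j)) * (real CARD('a) ^ N * (\<Prod>j\<in>J. prim_moment TYPE('a) (kk j) (\<beta> j)))"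
      by simp
  qed
  also have "\<dots> = real CARD('a) ^ N * (\<Sum>\<beta>\<in>(\<Pi>\<^sub>E j\<in>J. {..a j}). \<Prod>j\<in>J. trace_coeff (a j) (kk j) (\<beta> j) * prim_moment TYPE('a) (kk j) (\<beta> j))"
    by (simp add: sum_distrib_left prod.distrib mult_ac)
  also have "(\<Sum>\<beta>\<in>(\<Pi>\<^sub>E j\<in>J. {..a j}). \<Prod>j\<in>J. trace_coeff (a j) (kk j) (\<beta> j) * prim_moment TYPE('a) (kk j) (\<beta> j)) =
      (\<Prod>j\<in>J. prim_main TYPE('a) (a j) (kk j))"
    unfolding prim_main_def using J(1) by (intro prod_sum_PiE[symmetric]) auto
  finally show ?thesis .
qed

end

section \<open>Averages over the hyperelliptic ensemble\<close>

lemma prod_le_power_bound: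
  fixes x :: "'i \<Rightarrow> 'c :: real_normed_field"
  assumes "finite J" "L \<ge> 1" "\<And>j. j \<in> J \<Longrightarrow> norm (x j) \<le> L"
  shows "norm (\<Prod>j\<in>J. x j ^ a j) \<le> L ^ (\<Sum>j\<in>J. a j)"
proof -
  have "norm (\<Prod>j\<in>J. x j ^ a j) = (\<Prod>j\<in>J. norm (x j) ^ a j)"
    by (simp add: prod_norm[symmetric] norm_power)
  also have "\<dots> \<le> (\<Prod>j\<in>J. L ^ a j)"
    using assms by (intro prod_mono conjI power_mono) auto
  finally show ?thesis
    by (simp add: power_sum)
qed

context
  fixes \<Theta> :: "'a :: {finite, field} Polynomial.poly \<Rightarrow> complex mat"
  assumes odd_q: "odd CARD('a)"
    and frob: "\<And>g Q. Q \<in> hyp_ensemble g \<Longrightarrow> unitarized_frobenius g Q (\<Theta> Q)"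
begin

text \<open>Since \<open>N\<close> is odd, the squarefree part \<open>Q\<close> of \<open>M\<close>
  has odd degree and lies in an ensemble of some genus, where unitarity bounds the trace and hence
  \<open>T_k(Q)\<close>. Restoring the square factor costs at most the degree of
  \<open>C\<close>.\<close>

lemma abs_prim_sum_le:
  assumes M: "M \<in> monic_polys N" and N: "odd N" and k: "k > 0"
  shows "\<bar>prim_sum k (M :: 'a Polynomial.poly)\<bar> \<le> 3 * real N + real k"
proof -
  obtain C Q where CQ: "M = C ^ 2 * Q" "squarefree Q" "Polynomial.lead_coeff C = 1" "Polynomial.lead_coeff Q = 1"
    using square_times_squarefree_exists[of M] M by (auto simp: monic_polys_def)
  have nz: "C \<noteq> 0" "Q \<noteq> 0"
    using CQ by auto
  have deg: "N = 2 * Polynomial.degree C + Polynomial.degree Q"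
    using M nz by (auto simp: monic_polys_def CQ(1) degree_mult_eq degree_power_eq)
  then obtain g where g: "Polynomial.degree Q = 2 * g + 1"
    using N by (auto elim: oddE)
  then have Q: "Q \<in> hyp_ensemble g"
    using CQ by (auto simp: hyp_ensemble_def)
  have q: "real CARD('a) powr (- real k / 6) \<le> 1"
    using powr_mono[of "- real k / 6" 0 "real CARD('a)"] q_gt_1[where ?'a = 'a] by simp
  have "norm (complex_of_real (prim_sum k Q)) \<le>
      norm (mat_trace (\<Theta> Q ^\<^sub>m k) - (- eta k - complex_of_real (prim_sum k Q))) + norm (mat_trace (\<Theta> Q ^\<^sub>m k)) + norm (eta k)"
    using norm_triangle_ineq4[of "mat_trace (\<Theta> Q ^\<^sub>m k) - (- eta k - complex_of_real (prim_sum k Q))" "mat_trace (\<Theta> Q ^\<^sub>m k)"]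
      norm_triangle_ineq4[of "mat_trace (\<Theta> Q ^\<^sub>m k) - (- eta k - complex_of_real (prim_sum k Q)) - mat_trace (\<Theta> Q ^\<^sub>m k)" "eta k"]
    by (simp del: norm_of_real)
  also have "norm (mat_trace (\<Theta> Q ^\<^sub>m k) - (- eta k - complex_of_real (prim_sum k Q))) \<le> (real (2 * g + 1) + real k) * 1"
    using trace_prim_sum[OF odd_q frob[OF Q] Q k] q
    by (meson add_nonneg_nonneg mult_left_mono of_nat_0_le_iff order_trans)
  also have "norm (mat_trace (\<Theta> Q ^\<^sub>m k)) \<le> real (2 * g)"
    using norm_trace_frobenius_le[OF frob[OF Q]] .
  also have "norm (eta k) \<le> 1"
    by (simp add: eta_def)
  finally have "\<bar>prim_sum k Q\<bar> \<le> real (2 * g + 1) + real k + real (2 * g) + 1"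
    by simp
  moreover have "\<bar>prim_sum k M\<bar> \<le> \<bar>prim_sum k Q\<bar> + real (Polynomial.degree C)"
    unfolding CQ(1) by (rule prim_sum_square_mult_le[OF odd_q nz(1) k])
  moreover have "real N = 2 * real (Polynomial.degree C) + real (2 * g + 1)"
    using deg g by simp
  ultimately show ?thesis
    by simp
qed

lemma hyp_avg_approx:
  assumes J: "finite J" "J \<noteq> {}" "inj_on kk J" "\<And>j. j \<in> J \<Longrightarrow> kk j > 0" and a: "\<And>j. j \<in> J \<Longrightarrow> a j \<ge> 1"
    and g: "g \<ge> 1" and le: "(\<Sum>j\<in>J. a j * kk j) \<le> 2 * g - 1"
    and K: "K > 0" "\<And>j. j \<in> J \<Longrightarrow> K \<le> kk j"
  shows "norm (hyp_avg g (\<lambda>Q :: 'a Polynomial.poly. \<Prod>j\<in>J. mat_trace (\<Theta> Q ^\<^sub>m kk j) ^ a j) -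
      complex_of_real (\<Prod>j\<in>J. prim_main TYPE('a) (a j) (kk j))) \<le>
    (real (\<Sum>j\<in>J. a j) + 4) * (12 * real g) ^ ((\<Sum>j\<in>J. a j) + 1) * real CARD('a) powr (- real K / 6)"
proof -
  define A where "A = (\<Sum>j\<in>J. a j)"
  \<comment> \<open>For \<open>N \<le> 2 * g + 1\<close> and \<open>k_j \<le> 2 * g - 1\<close> the
    bound \<open>1 + 3 * N + k_j\<close> is at most \<open>8 * g + 3\<close>. The value
    \<open>12 * g\<close> exceeds this and also the traces, \<open>D\<close> and the factor
    \<open>2 * g + 1 + k_j\<close>.\<close>
  define L where "L = 12 * real g"
  define \<epsilon> where "\<epsilon> = real CARD('a) powr (- real K / 6)"
  define D where "D = 2 * g + 1"
  define Y where "Y = (\<lambda>j M. - of_bool (even (kk j)) - prim_sum (kk j) (M :: 'a Polynomial.poly))"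
  define P where "P = (\<Prod>j\<in>J. prim_main TYPE('a) (a j) (kk j))"
  let ?H = "sqfree_polys D :: 'a Polynomial.poly set"
  let ?F = "trace_prod J a kk :: 'a Polynomial.poly \<Rightarrow> real"
  let ?X = "\<lambda>Q. \<Prod>j\<in>J. mat_trace (\<Theta> Q ^\<^sub>m kk j) ^ a j"
  have q: "real CARD('a) > 1"
    by (rule q_gt_1[where ?'a = 'a])
  have L: "L \<ge> 1"
    using g by (simp add: L_def)
  have kk_le: "kk j \<le> 2 * g - 1" if "j \<in> J" for j
  proof -
    have "kk j \<le> a j * kk j"
      using a[OF that] by simp
    also have "\<dots> \<le> (\<Sum>j\<in>J. a j * kk j)"
      using J(1) that by (intro member_le_sum) auto
    finally show ?thesis
      using le by simp
  qed
  have eps: "real CARD('a) powr (- real (kk j) / 6) \<le> \<epsilon>" if "j \<in> J" for j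
    unfolding \<epsilon>_def using q K(2)[OF that] by (intro powr_mono) auto
  have eps0: "\<epsilon> > 0"
    using q by (simp add: \<epsilon>_def)
  have Y_le: "norm (Y j M) \<le> L" if "j \<in> J" "M \<in> monic_polys N" "N \<in> {D, D - 2}" for j M N
  proof -
    have N: "odd N" "N \<le> 2 * g + 1"
      using that(3) g by (auto simp: D_def)
    have "\<bar>prim_sum (kk j) M\<bar> \<le> 3 * real N + real (kk j)"
      using abs_prim_sum_le[OF that(2) N(1) J(4)[OF that(1)]] .
    moreover have "real N \<le> 2 * real g + 1" "real (kk j) \<le> 2 * real g - 1"
      using N kk_le[OF that(1)] g by (simp_all add: le_diff_conv2 flip: of_nat_le_iff)
    moreover have "norm (Y j M) \<le> 1 + \<bar>prim_sum (kk j) M\<bar>"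
      by (auto simp: Y_def)
    moreover have "real g \<ge> 1"
      using g by simp
    ultimately show ?thesis
      unfolding L_def by linarith
  qed
  have F_eq: "?F M = (\<Prod>j\<in>J. Y j M ^ a j)" for M
    by (simp add: trace_prod_def Y_def)
  have F_le: "\<bar>?F M\<bar> \<le> L ^ A" if "N \<in> {D, D - 2}" "M \<in> monic_polys N" for M N
    unfolding F_eq real_norm_def[symmetric] A_def using that
    by (intro prod_le_power_bound J(1) L Y_le)
  have X_close: "norm (?X Q - complex_of_real (?F Q)) \<le> real A * L ^ A * (L * \<epsilon>)" if Q: "Q \<in> ?H" for Q
  proof -
    have Q': "Q \<in> hyp_ensemble g"
      using Q by (simp add: hyp_ensemble_eq D_def)
    have QM: "Q \<in> monic_polys D"
      using Q by (simp add: sqfree_polys_def)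
    have "norm (?X Q - (\<Prod>j\<in>J. complex_of_real (Y j Q) ^ a j)) \<le> real (\<Sum>j\<in>J. a j) * L ^ (\<Sum>j\<in>J. a j) * (L * \<epsilon>)"
    proof (rule norm_prod_power_diff_le[OF J(1) L])
      fix j assume j: "j \<in> J"
      show "norm (mat_trace (\<Theta> Q ^\<^sub>m kk j)) \<le> L"
        using norm_trace_frobenius_le[OF frob[OF Q'], of "kk j"] g by (simp add: L_def)
      show "norm (complex_of_real (Y j Q)) \<le> L"
        using Y_le[OF j QM] by simp
      have "norm (mat_trace (\<Theta> Q ^\<^sub>m kk j) - complex_of_real (Y j Q)) \<le>
          (real (2 * g + 1) + real (kk j)) * real CARD('a) powr (- real (kk j) / 6)"
      proof -
        have "complex_of_real (Y j Q) = - eta (kk j) - complex_of_real (prim_sum (kk j) Q)"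
          by (simp add: Y_def eta_def)
        then show ?thesis
          using trace_prim_sum[OF odd_q frob[OF Q'] Q' J(4)[OF j]] by simp
      qed
      also have "\<dots> \<le> L * \<epsilon>"
      proof (intro mult_mono eps[OF j])
        show "real (2 * g + 1) + real (kk j) \<le> L"
          using kk_le[OF j] g by (simp add: L_def)
      qed (use L in auto)
      finally show "norm (mat_trace (\<Theta> Q ^\<^sub>m kk j) - complex_of_real (Y j Q)) \<le> L * \<epsilon>" .
    qed
    then show ?thesis
      by (simp add: F_eq A_def)
  qed
  have cardH: "real (card ?H) = real CARD('a) ^ D * (1 - 1 / real CARD('a))"
    using g by (intro card_sqfree_polys) (simp add: D_def)
  \<comment> \<open>At least half of the monic polynomials are squarefree. Replacing
    \<open>q^D\<close> by \<open>2 * card ?H\<close> turns the constant \<open>2\<close> of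
    \<open>sieve_error\<close> into \<open>4\<close>.\<close>
  have q2: "1 - 1 / real CARD('a) \<ge> 1 / 2"
  proof -
    have "real CARD('a) \<ge> 2"
      using one_less_CARD_field[where ?'a = 'a] by simp
    then show ?thesis
      by (simp add: field_simps)
  qed
  have qD: "real CARD('a) ^ D > 0"
    using q by simp
  have H0: "real (card ?H) > 0"
    unfolding cardH using q2 qD by (intro mult_pos_pos) auto
  have avg_X: "norm ((\<Sum>Q\<in>?H. ?X Q) / of_nat (card ?H) - complex_of_real ((\<Sum>Q\<in>?H. ?F Q) / real (card ?H)))
      \<le> real A * L ^ A * (L * \<epsilon>)"
  proof -
    have "(\<Sum>Q\<in>?H. ?X Q) / of_nat (card ?H) - complex_of_real ((\<Sum>Q\<in>?H. ?F Q) / real (card ?H)) =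
        (\<Sum>Q\<in>?H. ?X Q - complex_of_real (?F Q)) / of_nat (card ?H)"
      by (simp add: sum_subtractf diff_divide_distrib)
    also have "norm \<dots> = norm (\<Sum>Q\<in>?H. ?X Q - complex_of_real (?F Q)) / real (card ?H)"
      by (simp add: norm_divide)
    also have "\<dots> \<le> (\<Sum>Q\<in>?H. real A * L ^ A * (L * \<epsilon>)) / real (card ?H)"
      using X_close by (intro divide_right_mono sum_norm_le) auto
    also have "\<dots> = real A * L ^ A * (L * \<epsilon>)"
      unfolding sum_constant using H0 by (intro nonzero_mult_div_cancel_left) linarith
    finally show ?thesis .
  qed
  have avg_F: "\<bar>(\<Sum>Q\<in>?H. ?F Q) / real (card ?H) - P\<bar> \<le> 4 * L ^ A * (L * \<epsilon>)"
  proof -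
    have F_inv: "?F (b ^ 2 * Q) = ?F Q" if "b \<noteq> 0" "Polynomial.degree b < K" for b Q :: "'a Polynomial.poly"
      unfolding F_eq Y_def using that K(2) 
      by (intro prod.cong refl) (simp add: prim_sum_square_mult_eq less_le_trans)
    have D2: "D \<ge> 2"
      using g by (simp add: D_def)
    \<comment> \<open>The degree \<open>D - 2 = 2 * g - 1\<close> is where the hypothesis on the sum
      of the \<open>a_j k_j\<close> is used to its full extent. The factor \<open>P\<close> is the
      same in both degrees.\<close>
    have sums: "(\<Sum>M\<in>monic_polys D. ?F M) = real CARD('a) ^ D * P"
      "(\<Sum>M\<in>monic_polys (D - 2). ?F M) = real CARD('a) ^ (D - 2) * P"
      unfolding P_def using le by (intro sum_monic_polys_trace_prod[OF odd_q J(1,3,4)]; simp add: D_def)+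
    have "real CARD('a) * real CARD('a) ^ (D - 2) = real CARD('a) ^ D / real CARD('a)"
    proof -
      have "real CARD('a) ^ D = real CARD('a) * (real CARD('a) * real CARD('a) ^ (D - 2))"
        using D2 by (metis add_2_eq_Suc le_add_diff_inverse power_Suc)
      then show ?thesis
        using q by simp
    qed
    then have "(\<Sum>M\<in>monic_polys D. ?F M) - real CARD('a) * (\<Sum>M\<in>monic_polys (D - 2). ?F M) = real (card ?H) * P"
      unfolding sums cardH by (simp add: algebra_simps flip: mult.assoc)
    then have "\<bar>(\<Sum>Q\<in>?H. ?F Q) - real (card ?H) * P\<bar> \<le>
        2 * L ^ A * real D * (real CARD('a) ^ D / real CARD('a) ^ K)"
      using sieve_error[OF D2 K(1) F_inv F_le] by simp
    also have "\<dots> \<le> 2 * L ^ A * L * ((2 * real (card ?H)) * \<epsilon>)"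
    proof (intro mult_mono)
      show "real D \<le> L"
        using g by (simp add: D_def L_def)
      have "1 / real CARD('a) ^ K = real CARD('a) powr (- real K)"
        using q by (simp add: powr_minus powr_realpow divide_inverse)
      also have "\<dots> \<le> \<epsilon>"
        unfolding \<epsilon>_def using q by (intro powr_mono) auto
      finally have "1 / real CARD('a) ^ K \<le> \<epsilon>" .
      moreover have "real CARD('a) ^ D \<le> 2 * real (card ?H)"
        unfolding cardH using q2 qD by (simp add: field_simps)
      ultimately have "real CARD('a) ^ D * (1 / real CARD('a) ^ K) \<le> (2 * real (card ?H)) * \<epsilon>"
        using q by (intro mult_mono) auto
      then show "real CARD('a) ^ D / real CARD('a) ^ K \<le> (2 * real (card ?H)) * \<epsilon>"
        by simp
    qed (use L q in auto)
    finally have "\<bar>(\<Sum>Q\<in>?H. ?F Q) - real (card ?H) * P\<bar> / real (card ?H) \<le>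
        (2 * L ^ A * L * ((2 * real (card ?H)) * \<epsilon>)) / real (card ?H)"
      by (intro divide_right_mono) auto
    also have "(2 * L ^ A * L * ((2 * h) * \<epsilon>)) / h = 4 * L ^ A * (L * \<epsilon>)" if "h > 0" for h :: real
      using that by simp
    note this[OF H0]
    also have "\<bar>(\<Sum>Q\<in>?H. ?F Q) - real (card ?H) * P\<bar> / real (card ?H) =
        \<bar>((\<Sum>Q\<in>?H. ?F Q) - real (card ?H) * P) / real (card ?H)\<bar>"
      by simp
    also have "((\<Sum>Q\<in>?H. ?F Q) - h * P) / h = (\<Sum>Q\<in>?H. ?F Q) / h - P" if "h > 0" for h :: real
      using that by (simp add: diff_divide_distrib)
    note this[OF H0]
    finally show ?thesis .
  qed
  have "norm (hyp_avg g ?X - complex_of_real P) =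
      norm (((\<Sum>Q\<in>?H. ?X Q) / of_nat (card ?H) - complex_of_real ((\<Sum>Q\<in>?H. ?F Q) / real (card ?H))) +
        complex_of_real ((\<Sum>Q\<in>?H. ?F Q) / real (card ?H) - P))"
    by (simp add: hyp_avg_def hyp_ensemble_eq D_def)
  also have "\<dots> \<le> real A * L ^ A * (L * \<epsilon>) + 4 * L ^ A * (L * \<epsilon>)"
    using avg_X avg_F by (intro norm_triangle_mono) (simp_all only: norm_of_real)
  also have "\<dots> = (real A + 4) * L ^ (A + 1) * \<epsilon>"
    by (simp add: algebra_simps)
  finally show ?thesis
    by (simp add: P_def A_def L_def \<epsilon>_def)
qed

end

section \<open>Decay of the error terms and the limit\<close>

lemma power_times_powr_tendsto_0:
  fixes K :: "nat \<Rightarrow> nat"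
  assumes q: "q > 1" and K: "filterlim (\<lambda>g. real (K g) / log q (real g)) at_top sequentially"
  shows "(\<lambda>g. real g ^ R * q powr (- real (K g) / 6)) \<longlonglongrightarrow> 0"
proof (rule tendsto_0_le[where K = 1])
  \<comment> \<open>The \<open>6\<close> undoes the exponent \<open>1/6\<close>, and
    \<open>R + 1\<close> instead of \<open>R\<close> leaves a factor \<open>1 / g\<close> after
    cancelling \<open>g^R\<close>.\<close>
  have "eventually (\<lambda>g. real (K g) / log q (real g) \<ge> 6 * (real R + 1)) sequentially"
    using K by (simp add: filterlim_at_top)
  then show "eventually (\<lambda>g. norm (real g ^ R * q powr (- real (K g) / 6)) \<le> norm (1 / real g) * 1) sequentially"
    using eventually_gt_at_top[of 1]
  proof eventually_elim
    case (elim g)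
    have l: "log q (real g) > 0"
      using elim q by simp
    have "(real R + 1) * log q (real g) \<le> real (K g) / 6"
      using elim l by (simp add: le_divide_eq algebra_simps)
    then have "q powr (- real (K g) / 6) \<le> q powr (- ((real R + 1) * log q (real g)))"
      using q by (intro powr_mono) auto
    also have "\<dots> = real g powr (- (real R + 1))"
      using q elim by (simp add: powr_powr[symmetric] mult.commute[of _ "log q _"] flip: mult_minus_right)
    also have "real R + 1 = real (Suc R)"
      by simp
    also have "real g powr (- real (Suc R)) = 1 / (real g ^ R * real g)"
      using elim by (simp only: powr_minus powr_realpow of_nat_0_less_iff) (simp add: field_simps)
    finally have "real g ^ R * q powr (- real (K g) / 6) \<le> real g ^ R * (1 / (real g ^ R * real g))"
      by (intro mult_left_mono) auto
    then show ?case
      using elim by simp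
  qed
  show "(\<lambda>g. 1 / real g) \<longlonglongrightarrow> 0"
    by (rule lim_1_over_n)
qed

theorem theorem1p1:
  fixes \<Theta> :: "'a :: {finite, field} Polynomial.poly \<Rightarrow> complex mat"
    and n :: nat and a :: "nat \<Rightarrow> nat" and k :: "nat \<Rightarrow> nat \<Rightarrow> nat"
  assumes q_odd: "odd CARD('a)"
    and frob: "\<And>g Q. Q \<in> hyp_ensemble g \<Longrightarrow> unitarized_frobenius g Q (\<Theta> Q)"
    and n_pos: "n \<ge> 1"
    and a_pos: "\<And>j. j \<in> {1..n} \<Longrightarrow> a j \<ge> 1"
    and k_pos: "eventually (\<lambda>g. \<forall>j\<in>{1..n}. k g j \<ge> 1) sequentially"
    and k_distinct: "eventually (\<lambda>g. inj_on (k g) {1..n}) sequentially"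
    and k_sum: "eventually (\<lambda>g. (\<Sum>j=1..n. a j * k g j) \<le> 2 * g - 1) sequentially"
    and k_large: "filterlim (\<lambda>g. real (Min (k g ` {1..n})) / log (real CARD('a)) (real g))
                    at_top sequentially"
  shows "(\<lambda>g. hyp_avg g (\<lambda>Q::'a Polynomial.poly. \<Prod>j=1..n. mat_trace (\<Theta> Q ^\<^sub>m k g j) ^ a j)
            - (\<Prod>j=1..n. \<Sum>i=0..a j div 2.
                 of_nat (k g j) ^ i * of_nat (a j choose (2 * i))
                 * (fact (2 * i) / (2 ^ i * fact i)) * (- eta (k g j)) ^ (a j - 2 * i)))
         \<longlonglongrightarrow> 0"
proof -
  define J where "J = {1..n}"
  define A where "A = (\<Sum>j\<in>J. a j)"
  define K where "K = (\<lambda>g. Min (k g ` J))"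
  define \<epsilon> where "\<epsilon> = (\<lambda>g. real CARD('a) powr (- real (K g) / 6))"
  define V where "V = (\<lambda>g. hyp_avg g (\<lambda>Q::'a Polynomial.poly. \<Prod>j\<in>J. mat_trace (\<Theta> Q ^\<^sub>m k g j) ^ a j))"
  define P where "P = (\<lambda>g. \<Prod>j\<in>J. prim_main TYPE('a) (a j) (k g j))"
  define m where "m = (\<lambda>g. \<Prod>j\<in>J. main_term (a j) (k g j))"
  have J: "finite J" "J \<noteq> {}"
    using n_pos by (auto simp: J_def)
  obtain C R where CR: "\<And>kk G K. (\<forall>j\<in>J. kk j > 0 \<and> K \<le> kk j \<and> real (kk j) + 1 \<le> G) \<Longrightarrow> G \<ge> 1 \<Longrightarrow>
    \<bar>(\<Prod>j\<in>J. prim_main TYPE('a) (a j) (kk j)) - (\<Prod>j\<in>J. main_term (a j) (kk j))\<bar> \<le>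
      C * G ^ R * real CARD('a) powr (- real K / 6)"
    using prod_main_approx[OF J(1), of a] by blast
  \<comment> \<open>The powers of \<open>12\<close> and \<open>2\<close> come from the bounds
    \<open>12 * g\<close> in \<open>hyp_avg_approx\<close> and \<open>G = 2 * g\<close> in
    \<open>prod_main_approx\<close>; what remains in each term is a power of \<open>g\<close> times
    \<epsilon>.\<close>
  define f where "f = (\<lambda>g. (real A + 4) * 12 ^ (A + 1) * (real g ^ (A + 1) * \<epsilon> g) + C * 2 ^ R * (real g ^ R * \<epsilon> g))"
  have bound: "eventually (\<lambda>g. norm (V g - complex_of_real (m g)) \<le> f g) sequentially"
    using k_pos k_distinct k_sum eventually_ge_at_top[of 1]
  proof eventually_elim
    case (elim g)
    have kk: "k g j > 0" if "j \<in> J" for j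
      using elim(1) that by (auto simp: J_def Suc_le_eq)
    have Kle: "K g \<le> k g j" if "j \<in> J" for j
      unfolding K_def using J that by (intro Min_le) auto
    have "K g \<in> k g ` J"
      unfolding K_def using J by (intro Min_in) auto
    then have K0: "K g > 0"
      using kk by auto
    have kle: "real (k g j) + 1 \<le> 2 * real g" if j: "j \<in> J" for j
    proof -
      have "k g j \<le> a j * k g j"
        using a_pos[of j] j by (simp add: J_def)
      also have "\<dots> \<le> (\<Sum>j\<in>J. a j * k g j)"
        using J(1) j by (intro member_le_sum) auto
      also have "\<dots> \<le> 2 * g - 1"
        using elim(3) by (simp add: J_def)
      finally have "k g j + 1 \<le> 2 * g"
        using elim(4) by linarith
      then show ?thesis
        by (simp flip: of_nat_Suc of_nat_le_iff)
    qed
    have "norm (V g - complex_of_real (P g)) \<le> (real A + 4) * (12 * real g) ^ (A + 1) * \<epsilon> g"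
      unfolding V_def P_def A_def \<epsilon>_def
      by (rule hyp_avg_approx[OF q_odd frob J _ kk _ elim(4) _ K0 Kle])
        (use elim a_pos in \<open>auto simp: J_def\<close>)
    moreover have "norm (complex_of_real (P g) - complex_of_real (m g)) \<le> C * (2 * real g) ^ R * \<epsilon> g"
      unfolding P_def m_def \<epsilon>_def of_real_diff[symmetric] norm_of_real
      using kk Kle kle elim(4) by (intro CR) auto
    ultimately have "norm (V g - complex_of_real (m g)) \<le>
        (real A + 4) * (12 * real g) ^ (A + 1) * \<epsilon> g + C * (2 * real g) ^ R * \<epsilon> g"
      using norm_triangle_ineq[of "V g - complex_of_real (P g)" "complex_of_real (P g) - complex_of_real (m g)"]
      by simp
    then show ?case
      by (simp add: f_def power_mult_distrib mult_ac)
  qed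
  have eps: "(\<lambda>g. real g ^ r * \<epsilon> g) \<longlonglongrightarrow> 0" for r
    unfolding \<epsilon>_def using k_large one_less_CARD_field[where ?'a = 'a]
    by (intro power_times_powr_tendsto_0) (simp_all add: K_def J_def)
  have "f \<longlonglongrightarrow> (real A + 4) * 12 ^ (A + 1) * 0 + C * 2 ^ R * 0"
    unfolding f_def by (intro tendsto_add tendsto_mult tendsto_const eps)
  then have f0: "f \<longlonglongrightarrow> 0"
    by simp
  have "(\<lambda>g. V g - complex_of_real (m g)) \<longlonglongrightarrow> 0"
    using bound by (intro tendsto_0_le[OF f0, where K = 1]) (auto elim!: eventually_mono)
  then show ?thesis
    by (simp add: V_def m_def J_def main_term_eq)
qed

end
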